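(* Let $G$ be a finitely generated nilpotent group. Then, for all $q\ge0$, $$\Sigma^q(G,\mathbb{Z})=\Big(\tau_1^{\mathbb{R}}\big(\bigcup_{i\le q}\mathcal{V}^i_1(G,\mathbb{C})\big)\Big)^{c},$$ where $(\cdot)^c$ denotes the complement in $\mathrm{Hom}(G,\mathbb{R})=H^1(G,\mathbb{R})$.
   Context: $\Sigma^q(G,\mathbb{Z})$ (Bieri–Renz invariant): the set of non-zero homomorphisms $\chi\colon G\to\mathbb{R}$ such that the trivial module $\mathbb{Z}$ is of type $\mathrm{FP}_q$ over the monoid ring $\mathbb{Z}G_\chi$, where $G_\chi=\{g\in G\mid\chi(g)\ge0\}$. (A module over a ring is of type $\mathrm{FP}_q$ if it has a projective resolution $P_\bullet$ with $P_i$ finitely generated for $i\le q$.) $\mathcal{V}^i_1(G,\mathbb{C})=\{\rho\in\mathrm{Hom}(G,\mathbb{C}^\times)\mid H_i(G,\mathbb{C}_\rho)\ne0\}$, where $\mathbb{C}_\rho$ is $\mathbb{C}$ with $G$ acting through $\rho$. For a Zariski closed $W\subseteq\mathrm{Hom}(G,\mathbb{C}^\times)$, $\tau_1(W)=\{z\in\mathrm{Hom}(G,\mathbb{C})\mid\exp(tz)\in W\text{ for all }t\in\mathbb{C}\}$, where $\exp(z)(g)=e^{z(g)}$, and $\tau_1^{\mathbb{R}}(W)=\tau_1(W)\cap\mathrm{Hom}(G,\mathbb{R})$. *)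

theory Defs
  imports Complex_Main "HOL-Algebra.Algebra"
begin

section \<open>Finitely generated and nilpotent groups\<close>

definition fin_gen_group :: "('a, 'b) monoid_scheme \<Rightarrow> bool" where
  "fin_gen_group G \<longleftrightarrow> group G \<and> (\<exists>S. finite S \<and> S \<subseteq> carrier G \<and> generate G S = carrier G)"

primrec lower_central :: "('a, 'b) monoid_scheme \<Rightarrow> nat \<Rightarrow> 'a set" where
  "lower_central G 0 = carrier G"
| "lower_central G (Suc n) =
     generate G {g \<otimes>\<^bsub>G\<^esub> h \<otimes>\<^bsub>G\<^esub> inv\<^bsub>G\<^esub> g \<otimes>\<^bsub>G\<^esub> inv\<^bsub>G\<^esub> h | g h. g \<in> carrier G \<and> h \<in> lower_central G n}"

definition nilpotent_group :: "('a, 'b) monoid_scheme \<Rightarrow> bool" where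
  "nilpotent_group G \<longleftrightarrow> group G \<and> (\<exists>n. lower_central G n = {\<one>\<^bsub>G\<^esub>})"


section \<open>Homomorphisms into abelian groups\<close>

text \<open>Homomorphisms are normalised to be \<open>undefined\<close> outside the carrier, so that equality of
  functions is equality of homomorphisms.\<close>

definition Hom :: "('a, 'c) monoid_scheme \<Rightarrow> ('b, 'd) monoid_scheme \<Rightarrow> ('a \<Rightarrow> 'b) set" where
  "Hom G A = hom G A \<inter> extensional (carrier G)"

definition additive_group :: "'b::ab_group_add monoid" where
  "additive_group = \<lparr>carrier = UNIV, monoid.mult = (+), one = 0\<rparr>"

definition multiplicative_group :: "'b::field monoid" where
  "multiplicative_group = \<lparr>carrier = UNIV - {0}, monoid.mult = (*), one = 1\<rparr>"


section \<open>Left modules and finiteness properties\<close>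

text \<open>The library locale for modules requires a commutative ring; its record type is reused here for
  left modules over arbitrary rings. As in the library, the multiplication and the unit of the
  record of a module are irrelevant.\<close>

locale left_module = R?: ring R + M?: abelian_group M
  for R :: "('r, 'c) ring_scheme" (structure) and M :: "('r, 'm, 'd) module_scheme" (structure) +
  assumes smult_closed:
      "\<lbrakk>a \<in> carrier R; x \<in> carrier M\<rbrakk> \<Longrightarrow> a \<odot>\<^bsub>M\<^esub> x \<in> carrier M"
    and smult_l_distr:
      "\<lbrakk>a \<in> carrier R; b \<in> carrier R; x \<in> carrier M\<rbrakk> \<Longrightarrow>
        (a \<oplus>\<^bsub>R\<^esub> b) \<odot>\<^bsub>M\<^esub> x = a \<odot>\<^bsub>M\<^esub> x \<oplus>\<^bsub>M\<^esub> b \<odot>\<^bsub>M\<^esub> x"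
    and smult_r_distr:
      "\<lbrakk>a \<in> carrier R; x \<in> carrier M; y \<in> carrier M\<rbrakk> \<Longrightarrow>
        a \<odot>\<^bsub>M\<^esub> (x \<oplus>\<^bsub>M\<^esub> y) = a \<odot>\<^bsub>M\<^esub> x \<oplus>\<^bsub>M\<^esub> a \<odot>\<^bsub>M\<^esub> y"
    and smult_assoc1:
      "\<lbrakk>a \<in> carrier R; b \<in> carrier R; x \<in> carrier M\<rbrakk> \<Longrightarrow>
        (a \<otimes>\<^bsub>R\<^esub> b) \<odot>\<^bsub>M\<^esub> x = a \<odot>\<^bsub>M\<^esub> (b \<odot>\<^bsub>M\<^esub> x)"
    and smult_one:
      "x \<in> carrier M \<Longrightarrow> \<one>\<^bsub>R\<^esub> \<odot>\<^bsub>M\<^esub> x = x"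

definition lmod_hom ::
  "('r, 'c) ring_scheme \<Rightarrow> ('r, 'm) module \<Rightarrow> ('r, 'n) module \<Rightarrow> ('m \<Rightarrow> 'n) set" where
  "lmod_hom R M N = {f \<in> carrier M \<rightarrow> carrier N.
     (\<forall>x\<in>carrier M. \<forall>y\<in>carrier M. f (x \<oplus>\<^bsub>M\<^esub> y) = f x \<oplus>\<^bsub>N\<^esub> f y) \<and>
     (\<forall>a\<in>carrier R. \<forall>x\<in>carrier M. f (a \<odot>\<^bsub>M\<^esub> x) = a \<odot>\<^bsub>N\<^esub> f x)}"

definition lmod_kernel :: "('r, 'm) module \<Rightarrow> ('r, 'n) module \<Rightarrow> ('m \<Rightarrow> 'n) \<Rightarrow> 'm set" where
  "lmod_kernel M N f = {x \<in> carrier M. f x = \<zero>\<^bsub>N\<^esub>}"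

definition fin_gen_module :: "('r, 'c) ring_scheme \<Rightarrow> ('r, 'm) module \<Rightarrow> bool" where
  "fin_gen_module R M \<longleftrightarrow> (\<exists>S. finite S \<and> S \<subseteq> carrier M \<and>
     (\<forall>x\<in>carrier M. \<exists>a \<in> S \<rightarrow> carrier R. x = (\<Oplus>\<^bsub>M\<^esub>s\<in>S. a s \<odot>\<^bsub>M\<^esub> s)))"

text \<open>Projectivity is the lifting property against surjections. HOL cannot quantify over the types
  of the test modules; the types chosen here lose nothing, since they admit as a test the surjection
  onto \<open>P\<close> from the free module on the set \<open>carrier P\<close> (finitely supported functions from
  \<open>carrier P\<close> to \<open>R\<close>). Lifting the identity of \<open>P\<close> along it makes \<open>P\<close> a direct summand of a free
  module, and so gives the lifting property against all surjections.\<close>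

definition projective_module :: "('r, 'c) ring_scheme \<Rightarrow> ('r, 'p) module \<Rightarrow> bool" where
  "projective_module R P \<longleftrightarrow> left_module R P \<and>
     (\<forall>(M :: ('r, 'p \<Rightarrow> 'r) module) (N :: ('r, 'p) module). \<forall>f \<in> lmod_hom R M N. \<forall>g \<in> lmod_hom R P N.
        left_module R M \<and> left_module R N \<and> f ` carrier M = carrier N \<longrightarrow>
        (\<exists>h \<in> lmod_hom R P M. \<forall>x\<in>carrier P. f (h x) = g x))"

definition projective_resolution ::
  "('r, 'c) ring_scheme \<Rightarrow> ('r, 'm) module \<Rightarrow> (nat \<Rightarrow> ('r, 'p) module) \<Rightarrow>
    (nat \<Rightarrow> 'p \<Rightarrow> 'p) \<Rightarrow> ('p \<Rightarrow> 'm) \<Rightarrow> bool" where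
  "projective_resolution R M P d e \<longleftrightarrow>
     (\<forall>i. projective_module R (P i)) \<and>
     (\<forall>i. d i \<in> lmod_hom R (P (Suc i)) (P i)) \<and>
     e \<in> lmod_hom R (P 0) M \<and>
     e ` carrier (P 0) = carrier M \<and>
     d 0 ` carrier (P 1) = lmod_kernel (P 0) M e \<and>
     (\<forall>i. d (Suc i) ` carrier (P (Suc (Suc i))) = lmod_kernel (P (Suc i)) (P i) (d i))"

text \<open>The modules of the resolution live on the type \<^typ>\<open>nat \<Rightarrow> 'r\<close>. This is no restriction up to
  isomorphism: a resolution that is finitely generated up to degree \<open>q\<close> may be replaced above
  degree \<open>q\<close> by a free resolution of the kernel, with all cardinalities at most that of \<open>R\<close> or
  countable, hence at most that of \<^typ>\<open>nat \<Rightarrow> 'r\<close>.\<close>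

definition type_FP :: "nat \<Rightarrow> ('r, 'c) ring_scheme \<Rightarrow> ('r, 'm) module \<Rightarrow> bool" where
  "type_FP q R M \<longleftrightarrow>
     (\<exists>(P :: nat \<Rightarrow> ('r, nat \<Rightarrow> 'r) module) d e.
        projective_resolution R M P d e \<and> (\<forall>i\<le>q. fin_gen_module R (P i)))"


section \<open>Monoid rings and the Bieri--Renz invariants\<close>

definition monoid_ring :: "('a, 'b) monoid_scheme \<Rightarrow> ('a \<Rightarrow>\<^sub>0 int) ring" where
  "monoid_ring M =
     \<lparr>carrier = {c. Poly_Mapping.keys c \<subseteq> carrier M},
      monoid.mult = (\<lambda>c c'. frag_extend (\<lambda>a. frag_extend (\<lambda>b. frag_of (a \<otimes>\<^bsub>M\<^esub> b)) c') c),
      one = frag_of \<one>\<^bsub>M\<^esub>,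
      ring.zero = 0,
      add = (+)\<rparr>"

text \<open>The trivial module \<open>\<int>\<close>: the monoid ring acts through the augmentation.\<close>

definition trivial_int_module :: "('a \<Rightarrow>\<^sub>0 int, int) module" where
  "trivial_int_module =
     \<lparr>carrier = UNIV, monoid.mult = (*), one = 1, ring.zero = 0, add = (+),
      smult = (\<lambda>c n. (\<Sum>g\<in>Poly_Mapping.keys c. Poly_Mapping.lookup c g) * n)\<rparr>"

definition char_submonoid :: "('a, 'b) monoid_scheme \<Rightarrow> ('a \<Rightarrow> real) \<Rightarrow> ('a, 'b) monoid_scheme" where
  "char_submonoid G \<chi> = G\<lparr>carrier := {g \<in> carrier G. \<chi> g \<ge> 0}\<rparr>"

definition bieri_renz :: "nat \<Rightarrow> ('a, 'b) monoid_scheme \<Rightarrow> ('a \<Rightarrow> real) set" where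
  "bieri_renz q G = {\<chi> \<in> Hom G additive_group.
     \<chi> \<noteq> (\<lambda>g\<in>carrier G. 0) \<and> type_FP q (monoid_ring (char_submonoid G \<chi>)) trivial_int_module}"


section \<open>Group homology and characteristic varieties\<close>

text \<open>The homology of \<open>G\<close> with coefficients in a left \<open>G\<close>-module \<open>A\<close> (an abelian group with action
  \<open>act\<close>) is computed from the inhomogeneous bar complex. A chain of degree \<open>n\<close> is a formal sum of
  symbols \<open>[g\<^sub>1|\<dots>|g\<^sub>n]\<close> with coefficients in \<open>A\<close>, and
  \<open>\<partial>([g\<^sub>1|\<dots>|g\<^sub>n] \<otimes> m)\<close> is
  \<open>[g\<^sub>2|\<dots>|g\<^sub>n] \<otimes> g\<^sub>1\<inverse>m + (\<Sum>0<i<n. (-1)^i [g\<^sub>1|\<dots>|g\<^sub>ig\<^sub>i\<^sub>+\<^sub>1|\<dots>|g\<^sub>n] \<otimes> m) + (-1)^n [g\<^sub>1|\<dots>|g\<^sub>n\<^sub>-\<^sub>1] \<otimes> m\<close>;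
  the inverse makes the left module \<open>A\<close> a right one.\<close>

definition bar_merge :: "('a, 'b) monoid_scheme \<Rightarrow> nat \<Rightarrow> 'a list \<Rightarrow> 'a list" where
  "bar_merge G i xs = take (i - 1) xs @ [xs ! (i - 1) \<otimes>\<^bsub>G\<^esub> xs ! i] @ drop (Suc i) xs"

definition bar_boundary_basis ::
  "('a, 'b) monoid_scheme \<Rightarrow> ('a \<Rightarrow> 'v \<Rightarrow> 'v) \<Rightarrow> 'a list \<Rightarrow> 'v \<Rightarrow> ('a list \<Rightarrow>\<^sub>0 'v::ab_group_add)" where
  "bar_boundary_basis G act xs m =
     (if xs = [] then 0 else
        Poly_Mapping.single (tl xs) (act (inv\<^bsub>G\<^esub> (hd xs)) m)
        + (\<Sum>i=1..<length xs. Poly_Mapping.single (bar_merge G i xs) (if even i then m else - m))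
        + Poly_Mapping.single (butlast xs) (if even (length xs) then m else - m))"

definition bar_boundary ::
  "('a, 'b) monoid_scheme \<Rightarrow> ('a \<Rightarrow> 'v \<Rightarrow> 'v) \<Rightarrow> ('a list \<Rightarrow>\<^sub>0 'v) \<Rightarrow> ('a list \<Rightarrow>\<^sub>0 'v::ab_group_add)" where
  "bar_boundary G act c =
     (\<Sum>xs\<in>Poly_Mapping.keys c. bar_boundary_basis G act xs (Poly_Mapping.lookup c xs))"

definition bar_chains :: "('a, 'b) monoid_scheme \<Rightarrow> nat \<Rightarrow> ('a list \<Rightarrow>\<^sub>0 'v::ab_group_add) set" where
  "bar_chains G n = {c. \<forall>xs\<in>Poly_Mapping.keys c. length xs = n \<and> set xs \<subseteq> carrier G}"

definition group_homology ::
  "nat \<Rightarrow> ('a, 'b) monoid_scheme \<Rightarrow> ('a \<Rightarrow> 'v \<Rightarrow> 'v) \<Rightarrow> ('a list \<Rightarrow>\<^sub>0 'v::ab_group_add) set monoid" where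
  "group_homology n G act =
     additive_group\<lparr>carrier := {c \<in> bar_chains G n. bar_boundary G act c = 0}\<rparr>
       Mod (bar_boundary G act ` bar_chains G (Suc n))"

definition char_variety :: "nat \<Rightarrow> ('a, 'b) monoid_scheme \<Rightarrow> ('a \<Rightarrow> complex) set" where
  "char_variety i G = {\<rho> \<in> Hom G multiplicative_group.
     carrier (group_homology i G (\<lambda>g m. \<rho> g * m)) \<noteq> {\<one>\<^bsub>group_homology i G (\<lambda>g m. \<rho> g * m)\<^esub>}}"


section \<open>Exponential tangent cones\<close>

definition exp_tangent_cone ::
  "('a, 'b) monoid_scheme \<Rightarrow> ('a \<Rightarrow> complex) set \<Rightarrow> ('a \<Rightarrow> complex) set" where
  "exp_tangent_cone G W = {z \<in> Hom G additive_group. \<forall>t. (\<lambda>g\<in>carrier G. exp (t * z g)) \<in> W}"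

definition real_exp_tangent_cone ::
  "('a, 'b) monoid_scheme \<Rightarrow> ('a \<Rightarrow> complex) set \<Rightarrow> ('a \<Rightarrow> real) set" where
  "real_exp_tangent_cone G W = {x \<in> Hom G additive_group.
     (\<lambda>g\<in>carrier G. complex_of_real (x g)) \<in> exp_tangent_cone G W}"

end

theory Submission
  imports Defs "HOL-Library.Function_Algebras"
begin

text \<open>For a finitely generated nilpotent group the formula says that both sides equal
  \<open>Hom(G, \<real>) - {0}\<close>. Choose a chain \<open>1 = N\<^sub>0 \<le> \<dots> \<le> N\<^sub>r = G\<close> of normal subgroups in which
  \<open>N\<^sub>i\<^sub>+\<^sub>1\<close> is generated by \<open>N\<^sub>i\<close> and an element \<open>a\<close> that is central modulo \<open>N\<^sub>i\<close>, where \<open>\<chi>(a) \<ge> 0\<close>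
  after replacing \<open>a\<close> by its inverse. The permutation modules \<open>M\<^sub>i = k[G\<^sub>\<chi>N\<^sub>i/N\<^sub>i]\<close> lead from the regular
  module to the trivial one, and \<open>M\<^sub>i\<^sub>+\<^sub>1\<close> is the cokernel of the endomorphism \<open>1 - a\<close> of \<open>M\<^sub>i\<close> (with \<open>a\<close>
  acting from the right). It therefore has a resolution by copies of \<open>M\<^sub>i\<close>, of length one or periodic
  according to the order of \<open>a\<close> modulo \<open>N\<^sub>i\<close>.

  For \<open>k = \<int>\<close> this shows inductively that all \<open>M\<^sub>i\<close>, in particular \<open>\<int>\<close>, have a resolution by finitely
  generated free modules over the monoid ring. For \<open>k = \<complex>\<close>, \<open>\<chi> = 0\<close> and a character \<open>\<rho>\<close> with \<open>\<rho>(h) \<noteq> 1\<close> it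
  shows that \<open>\<theta> = h - \<rho>(h)\<inverse>\<close> acts nilpotently on each homology group of \<open>G\<close> with coefficients in
  \<open>\<complex>\<^sub>\<rho> \<otimes> M\<^sub>i\<close>; since \<open>\<theta>\<close> is an invertible scalar on \<open>\<complex>\<^sub>\<rho>\<close>, the homology with coefficients in \<open>\<complex>\<^sub>\<rho>\<close>
  vanishes.\<close>

section \<open>Linear extension\<close>

text \<open>If \<open>a\<close> has finite order modulo \<open>N\<close>, the resolution of the next
  module by copies of the previous one is infinite, and resolving its terms again would lead to
  unbounded double complexes. These are never formed. A property \<open>Good\<close> of modules is
  carried along the chain; all that is required of it at a step is that it passes to every member of
  a family \<open>\<Q>\<close> in which each module is a quotient of a good one with kernel again in
  \<open>\<Q>\<close>. Three modules make up such a family. For finiteness this closure is proved by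
  coinduction on syzygies, for homology by induction on the degree, since passing to a kernel lowers
  the degree by one. Vanishing of homology cannot be carried along: \<open>H_0\<close> of the
  regular module twisted by \<open>\<rho>\<close> is not zero. It is killed by
  \<open>\<theta>\<close>, and exponents add up in exact sequences, so nilpotence is what survives.
  Right translations are recorded next to the left action because \<open>\<theta>\<close> acts from
  that side.\<close>

abbreviation single :: "'x \<Rightarrow> 'k::zero \<Rightarrow> ('x \<Rightarrow>\<^sub>0 'k)" where
  "single \<equiv> Poly_Mapping.single"

abbreviation lookup :: "('x \<Rightarrow>\<^sub>0 'k::zero) \<Rightarrow> 'x \<Rightarrow> 'k" where
  "lookup \<equiv> Poly_Mapping.lookup"

abbreviation keys :: "('x \<Rightarrow>\<^sub>0 'k::zero) \<Rightarrow> 'x set" where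
  "keys \<equiv> Poly_Mapping.keys"

text \<open>The coefficient is an argument of \<open>F\<close> instead of a scalar in front of
  \<open>F x\<close>, so one operator serves coefficients in a ring and coefficients in a
  module.\<close>

definition lin_ext :: "('x \<Rightarrow> 'k::zero \<Rightarrow> 'm::comm_monoid_add) \<Rightarrow> ('x \<Rightarrow>\<^sub>0 'k) \<Rightarrow> 'm" where
  "lin_ext F c = (\<Sum>x\<in>keys c. F x (lookup c x))"

definition free_on :: "'x set \<Rightarrow> ('x \<Rightarrow>\<^sub>0 'k::zero) set" where
  "free_on E = {c. keys c \<subseteq> E}"

definition push :: "('x \<Rightarrow> 'y) \<Rightarrow> ('x \<Rightarrow>\<^sub>0 'k) \<Rightarrow> ('y \<Rightarrow>\<^sub>0 'k::comm_monoid_add)" where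
  "push f = lin_ext (\<lambda>x. single (f x))"

definition scal :: "'k \<Rightarrow> ('x \<Rightarrow>\<^sub>0 'k) \<Rightarrow> ('x \<Rightarrow>\<^sub>0 'k::comm_ring_1)" where
  "scal k = lin_ext (\<lambda>x l. single x (k * l))"

lemma additive_single: "additive (single x :: 'k::ab_group_add \<Rightarrow> _)"
  by unfold_locales (rule single_add)

lemma additive_lookup: "additive (\<lambda>c :: 'x \<Rightarrow>\<^sub>0 'k::ab_group_add. lookup c x)"
  by unfold_locales (rule lookup_add)

lemma additive_compose: "additive f \<Longrightarrow> additive g \<Longrightarrow> additive (\<lambda>x. f (g x))"
  by (simp add: additive_def)

lemma additive_id: "additive (\<lambda>x. x)"
  by (simp add: additive_def)

lemma additive_zero: "additive (\<lambda>x. 0)"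
  by (simp add: additive_def)

lemma additive_minus: "additive f \<Longrightarrow> additive g \<Longrightarrow> additive (\<lambda>x. f x - g x)"
  by (simp add: additive_def algebra_simps)

lemma additive_sum:
  assumes "\<And>i. i \<in> I \<Longrightarrow> additive (f i)"
  shows "additive (\<lambda>x. \<Sum>i\<in>I. f i x)"
  using assms by (simp add: additive_def sum.distrib)

lemma additive_mult: "additive (\<lambda>x::'k::comm_ring_1. k * x)"
  by (simp add: additive_def distrib_left)

lemma lin_ext_superset:
  assumes "\<And>x. F x 0 = 0" "finite S" "keys c \<subseteq> S"
  shows "lin_ext F c = (\<Sum>x\<in>S. F x (lookup c x))"
  unfolding lin_ext_def
  by (rule sum.mono_neutral_left) (use assms in \<open>auto simp: in_keys_iff\<close>)

lemma lin_ext_single: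
  assumes "F x 0 = 0"
  shows "lin_ext F (single x k) = F x k"
  using assms by (simp add: lin_ext_def)

lemma additive_lin_ext:
  fixes F :: "'x \<Rightarrow> 'k::ab_group_add \<Rightarrow> 'm::ab_group_add"
  assumes "\<And>x. additive (F x)"
  shows "additive (lin_ext F)"
proof
  fix c d :: "'x \<Rightarrow>\<^sub>0 'k"
  let ?S = "keys c \<union> keys d"
  have z: "\<And>x. F x 0 = 0" using assms additive.zero by blast
  have "keys (c + d) \<subseteq> ?S" by (rule keys_add)
  then have "lin_ext F (c + d) = (\<Sum>x\<in>?S. F x (lookup (c + d) x))"
    by (intro lin_ext_superset) (auto simp: z)
  also have "\<dots> = (\<Sum>x\<in>?S. F x (lookup c x)) + (\<Sum>x\<in>?S. F x (lookup d x))"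
    by (simp add: lookup_add additive.add[OF assms] sum.distrib)
  also have "(\<Sum>x\<in>?S. F x (lookup c x)) = lin_ext F c"
    by (intro lin_ext_superset[symmetric]) (auto simp: z)
  also have "(\<Sum>x\<in>?S. F x (lookup d x)) = lin_ext F d"
    by (intro lin_ext_superset[symmetric]) (auto simp: z)
  finally show "lin_ext F (c + d) = lin_ext F c + lin_ext F d" .
qed

lemma sum_single_lookup:
  fixes c :: "'x \<Rightarrow>\<^sub>0 'k::comm_monoid_add"
  shows "(\<Sum>x\<in>keys c. single x (lookup c x)) = c"
  by (rule poly_mapping_eqI) (simp add: lookup_sum lookup_single when_def in_keys_iff)

lemma free_on_induct [consumes 1, case_names zero single add]:
  fixes c :: "'x \<Rightarrow>\<^sub>0 'k::comm_monoid_add"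
  assumes c: "c \<in> free_on E" and "P 0"
    and s: "\<And>x k. x \<in> E \<Longrightarrow> P (single x k)"
    and a: "\<And>c d. P c \<Longrightarrow> P d \<Longrightarrow> P (c + d)"
  shows "P c"
proof -
  have "P (\<Sum>x\<in>S. single x (lookup c x))"
    if "finite S" "S \<subseteq> E" for S
    using that
  proof (induction S)
    case (insert x S)
    then show ?case by (simp add: a s)
  qed (simp add: assms(2))
  from this[OF finite_keys[of c]] show ?thesis using c by (simp add: free_on_def sum_single_lookup)
qed

lemma zero_free_on [simp]: "0 \<in> free_on E"
  by (simp add: free_on_def)

lemma single_free_on [simp]: "x \<in> E \<Longrightarrow> single x k \<in> free_on E"
  by (simp add: free_on_def)

lemma add_free_on [simp]: "c \<in> free_on E \<Longrightarrow> d \<in> free_on E \<Longrightarrow> c + d \<in> free_on E"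
  using keys_add[of c d] by (auto simp: free_on_def)

lemma uminus_free_on [simp]:
  "- c \<in> free_on E \<longleftrightarrow> (c :: _ \<Rightarrow>\<^sub>0 'k::ab_group_add) \<in> free_on E"
  by (simp add: free_on_def subset_iff in_keys_iff)

lemma minus_free_on [simp]:
  "c \<in> free_on E \<Longrightarrow> d \<in> free_on E \<Longrightarrow> c - (d :: _ \<Rightarrow>\<^sub>0 'k::ab_group_add) \<in> free_on E"
  by (metis add_free_on uminus_free_on diff_conv_add_uminus)

lemma sum_free_on: "(\<And>i. i \<in> I \<Longrightarrow> f i \<in> free_on E) \<Longrightarrow> sum f I \<in> free_on E"
  by (induction I rule: infinite_finite_induct) auto

lemma free_on_mono: "E \<subseteq> Y \<Longrightarrow> c \<in> free_on E \<Longrightarrow> c \<in> free_on Y"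
  by (auto simp: free_on_def)

text \<open>The usual way to prove identities below: a comparison on single terms is enough.\<close>

lemma additive_eq_on_free:
  assumes "additive f" "additive g" "c \<in> free_on E"
    and "\<And>x k. x \<in> E \<Longrightarrow> f (single x k) = g (single x k)"
  shows "f c = g c"
  using assms(3)
proof (induction rule: free_on_induct)
  case zero
  show ?case using assms(1,2) by (simp add: additive.zero)
next
  case (add c d)
  then show ?case using assms(1,2) by (simp add: additive.add)
qed (use assms in auto)

lemma additive_push: "additive (push f :: ('x \<Rightarrow>\<^sub>0 'k) \<Rightarrow> ('y \<Rightarrow>\<^sub>0 'k::ab_group_add))"
  unfolding push_def by (rule additive_lin_ext) (rule additive_single)

lemma additive_scal: "additive (scal k)"
  unfolding scal_def by (rule additive_lin_ext) (simp add: additive_def single_add distrib_left)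

lemma push_single [simp]: "push f (single x k) = single (f x) k"
  unfolding push_def by (rule lin_ext_single) simp

lemma scal_single [simp]: "scal k (single x l) = single x (k * l)"
  unfolding scal_def by (rule lin_ext_single) simp

lemmas push_simps [simp] =
  additive.zero[OF additive_push] additive.add[OF additive_push] additive.minus[OF additive_push]
  additive.diff[OF additive_push] additive.sum[OF additive_push]

lemmas scal_simps [simp] =
  additive.zero[OF additive_scal] additive.add[OF additive_scal] additive.minus[OF additive_scal]
  additive.diff[OF additive_scal] additive.sum[OF additive_scal]

lemma lookup_scal [simp]: "lookup (scal k c) x = k * lookup c x"
  by (rule additive_eq_on_free[where E = UNIV])
    (auto intro: additive_compose[OF additive_lookup additive_scal]
      additive_compose[OF additive_mult additive_lookup] simp: free_on_def lookup_single when_def)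

lemma scal_zero [simp]: "scal 0 c = 0"
  by (rule poly_mapping_eqI) simp

lemma scal_add: "scal (k + l) c = scal k c + scal l c"
  by (rule poly_mapping_eqI) (simp add: lookup_add distrib_right)

lemma scal_scal: "scal k (scal l c) = scal (k * l) c"
  by (rule poly_mapping_eqI) (simp add: mult.assoc)

lemma scal_one [simp]: "scal 1 c = c"
  by (rule poly_mapping_eqI) simp

lemma additive_scal_left: "additive (\<lambda>k. scal k c)"
  by (simp add: additive_def scal_add)

lemma scal_free_on: "c \<in> free_on E \<Longrightarrow> scal k c \<in> free_on E"
  unfolding free_on_def by (auto simp: in_keys_iff subset_iff) (metis mult_zero_right)

lemma push_free_on:
  assumes "c \<in> free_on E" "\<And>x. x \<in> E \<Longrightarrow> f x \<in> Y"
  shows "push f (c :: 'x \<Rightarrow>\<^sub>0 'k::ab_group_add) \<in> free_on Y"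
  using assms(1) by (induction rule: free_on_induct) (auto simp: assms(2))

lemma push_cong:
  assumes "c \<in> free_on E" "\<And>x. x \<in> E \<Longrightarrow> f x = g x"
  shows "push f (c :: 'x \<Rightarrow>\<^sub>0 'k::ab_group_add) = push g c"
  using assms(1) by (induction rule: free_on_induct) (auto simp: assms(2))

lemma push_push: "push f (push g (c :: 'x \<Rightarrow>\<^sub>0 'k::ab_group_add)) = push (\<lambda>x. f (g x)) c"
  by (rule additive_eq_on_free[where E = UNIV and c = c])
    (auto intro: additive_push additive_compose simp: free_on_def)

lemma push_id: "push (\<lambda>x. x) (c :: 'x \<Rightarrow>\<^sub>0 'k::ab_group_add) = c"
  by (rule additive_eq_on_free[where E = UNIV and c = c])
    (auto intro: additive_push additive_id simp: free_on_def)

lemma push_scal: "push f (scal k c) = scal k (push f c)"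
  by (rule additive_eq_on_free[where E = UNIV and c = c])
    (auto intro: additive_push additive_scal additive_compose simp: free_on_def)

lemma push_commute:
  assumes "c \<in> free_on E" "\<And>x. x \<in> E \<Longrightarrow> f (g x) = g' (f' x)"
  shows "push f (push g (c :: 'x \<Rightarrow>\<^sub>0 'k::ab_group_add)) = push g' (push f' c)"
  unfolding push_push by (rule push_cong[OF assms(1)]) (use assms(2) in auto)

lemma lookup_push_inj:
  fixes c :: "'x \<Rightarrow>\<^sub>0 'k::ab_group_add"
  assumes "inj_on f E" "c \<in> free_on E" "x \<in> E"
  shows "lookup (push f c) (f x) = lookup c x"
  using assms(2)
  by (induction rule: free_on_induct)
    (use assms(1,3) in \<open>auto simp: lookup_add lookup_single when_def inj_on_def\<close>)

lemma lin_ext_in_free: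
  assumes "c \<in> free_on E" "0 \<in> S" "\<And>v w. v \<in> S \<Longrightarrow> w \<in> S \<Longrightarrow> v + w \<in> S"
    "\<And>x k. x \<in> E \<Longrightarrow> F x k \<in> S"
  shows "lin_ext F c \<in> S"
proof -
  have "sum (\<lambda>x. F x (lookup c x)) T \<in> S" if "finite T" "T \<subseteq> E" for T
    using that by (induction T) (use assms in auto)
  then show ?thesis using assms(1) by (simp add: lin_ext_def free_on_def)
qed

text \<open>With the group multiplication for \<open>act\<close> this is the product of the monoid
  ring, with \<open>l_coset G\<close> the module structure of a permutation module.\<close>

definition gsm :: "('g \<Rightarrow> 'x \<Rightarrow> 'y) \<Rightarrow> ('g \<Rightarrow>\<^sub>0 'k) \<Rightarrow> ('x \<Rightarrow>\<^sub>0 'k) \<Rightarrow> ('y \<Rightarrow>\<^sub>0 'k::comm_ring_1)" where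
  "gsm act c v = lin_ext (\<lambda>g n. scal n (push (act g) v)) c"

lemma additive_gsm_left: "additive (\<lambda>c. gsm act c v)"
  unfolding gsm_def by (rule additive_lin_ext) (rule additive_scal_left)

lemma additive_gsm_right: "additive (gsm act c)"
  unfolding gsm_def lin_ext_def
  by (intro additive_sum additive_compose[OF additive_scal additive_push])

lemma gsm_single: "gsm act (single g n) v = scal n (push (act g) v)"
  unfolding gsm_def by (rule lin_ext_single) simp

lemma gsm_free_on:
  assumes "c \<in> free_on S" "v \<in> free_on E" "\<And>g x. g \<in> S \<Longrightarrow> x \<in> E \<Longrightarrow> act g x \<in> Y"
  shows "gsm act c v \<in> free_on Y"
  unfolding gsm_def
  by (rule lin_ext_in_free[OF assms(1)])
    (auto intro!: scal_free_on push_free_on[OF assms(2)] assms(3))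

text \<open>Covers associativity of the monoid ring (\<open>act\<close> equal to \<open>mul\<close>)
  as well as the module axiom for permutation modules.\<close>

lemma gsm_assoc:
  assumes c: "c \<in> free_on S" and d: "d \<in> free_on S" and v: "v \<in> free_on E"
    and act: "\<And>g h x. g \<in> S \<Longrightarrow> h \<in> S \<Longrightarrow> x \<in> E \<Longrightarrow> act (mul g h) x = act g (act h x)"
  shows "gsm act (gsm mul c d) v = gsm act c (gsm act d v)"
proof (rule additive_eq_on_free[OF _ _ c])
  show "additive (\<lambda>c. gsm act (gsm mul c d) v)" "additive (\<lambda>c. gsm act c (gsm act d v))"
    by (auto intro: additive_compose additive_gsm_left additive_gsm_right)
  fix g n assume g: "g \<in> S"
  show "gsm act (gsm mul (single g n) d) v
      = gsm act (single g n) (gsm act d v)"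
  proof (rule additive_eq_on_free[OF _ _ d])
    show "additive (\<lambda>d. gsm act (gsm mul (single g n) d) v)"
      by (rule additive_compose[OF additive_gsm_left additive_gsm_right])
    show "additive (\<lambda>d. gsm act (single g n) (gsm act d v))"
      by (rule additive_compose[OF additive_gsm_right additive_gsm_left])
    fix h m assume h: "h \<in> S"
    show "gsm act (gsm mul (single g n) (single h m)) v
        = gsm act (single g n) (gsm act (single h m) v)"
      using push_cong[OF v, of "act (mul g h)" "\<lambda>x. act g (act h x)"] act[OF g h]
      by (simp add: gsm_single push_scal scal_scal push_push)
  qed
qed

section \<open>Cyclic quotients of permutation modules\<close>

text \<open>Models right translation by \<open>a\<close> on the cosets of \<open>N\<close> that meet
  the half space, with \<open>p\<close> the passage to the larger subgroup. The map
  \<open>\<alpha>\<close> need not be onto, because for \<open>\<chi>(a) > 0\<close> there may be no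
  way back inside the half space; fibres of \<open>p\<close> are therefore described by forward
  iterates from either point.\<close>

locale orbit_map =
  fixes E :: "'x set" and Y :: "'y set" and \<alpha> :: "'x \<Rightarrow> 'x" and p :: "'x \<Rightarrow> 'y"
  assumes \<alpha>_in: "x \<in> E \<Longrightarrow> \<alpha> x \<in> E"
    and \<alpha>_inj: "inj_on \<alpha> E"
    and p_onto: "p ` E = Y"
    and p_eq_iff: "x \<in> E \<Longrightarrow> x' \<in> E \<Longrightarrow>
      p x = p x' \<longleftrightarrow> (\<exists>k. x' = (\<alpha> ^^ k) x \<or> x = (\<alpha> ^^ k) x')"
begin

lemma \<alpha>_pow_in: "x \<in> E \<Longrightarrow> (\<alpha> ^^ k) x \<in> E"
  by (induction k) (auto intro: \<alpha>_in)

lemma p_\<alpha>: "x \<in> E \<Longrightarrow> p (\<alpha> x) = p x"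
  using p_eq_iff[of "\<alpha> x" x] \<alpha>_in by (metis funpow_0 funpow_simps_right(2) comp_apply)

lemma p_\<alpha>_pow: "x \<in> E \<Longrightarrow> p ((\<alpha> ^^ k) x) = p x"
  by (induction k) (auto simp: p_\<alpha> \<alpha>_pow_in)

definition sec :: "'y \<Rightarrow> 'x" where
  "sec y = (SOME x. x \<in> E \<and> p x = y)"

lemma sec: "y \<in> Y \<Longrightarrow> sec y \<in> E \<and> p (sec y) = y"
  unfolding sec_def by (rule someI_ex) (use p_onto in auto)

definition shift_im :: "('x \<Rightarrow>\<^sub>0 'k::ab_group_add) set" where
  "shift_im = (\<lambda>d. d - push \<alpha> d) ` free_on E"

lemma shift_im_add:
  assumes "c \<in> shift_im" "d \<in> shift_im"
  shows "c + d \<in> shift_im"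
proof -
  obtain c' d' where "c' \<in> free_on E" "c = c' - push \<alpha> c'" "d' \<in> free_on E" "d = d' - push \<alpha> d'"
    using assms by (auto simp: shift_im_def)
  then show ?thesis
    unfolding shift_im_def by (intro image_eqI[where x = "c' + d'"]) simp_all
qed

lemma shift_im_uminus:
  assumes "c \<in> shift_im"
  shows "- c \<in> shift_im"
proof -
  obtain d where "d \<in> free_on E" "c = d - push \<alpha> d" using assms by (auto simp: shift_im_def)
  then show ?thesis unfolding shift_im_def by (intro image_eqI[where x = "- d"]) auto
qed

lemma zero_shift_im: "0 \<in> shift_im"
  unfolding shift_im_def by (rule image_eqI[where x = 0]) auto

text \<open>Telescoping along the iterates of \<open>\<alpha>\<close>.\<close>

lemma single_pow_shift_im:
  "x \<in> E \<Longrightarrow> single x k - single ((\<alpha> ^^ j) x) k \<in> shift_im"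
proof (induction j)
  case 0
  then show ?case by (simp add: zero_shift_im)
next
  case (Suc j)
  let ?d = "single ((\<alpha> ^^ j) x) k"
  have "?d - push \<alpha> ?d \<in> shift_im"
    unfolding shift_im_def by (rule imageI) (simp add: \<alpha>_pow_in Suc.prems)
  from shift_im_add[OF Suc.IH[OF Suc.prems] this] show ?case by simp
qed

lemma push_p_shift_im:
  assumes "d \<in> shift_im"
  shows "push p (d :: 'x \<Rightarrow>\<^sub>0 'k::ab_group_add) = 0"
proof -
  obtain e where e: "e \<in> free_on E" "d = e - push \<alpha> e" using assms by (auto simp: shift_im_def)
  have "push p (push \<alpha> e) = push p e"
    unfolding push_push by (rule push_cong[OF e(1)]) (rule p_\<alpha>)
  then show ?thesis by (simp add: e(2))
qed

text \<open>Modulo the image of \<open>1 - \<alpha>\<close> every point equals the chosen point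
  \<open>sec\<close> of its fibre, so \<open>c\<close> is congruent to
  \<open>push sec (push p c)\<close>, which is 0 for \<open>c\<close> in the kernel.\<close>

lemma ker_push_p: "{c \<in> free_on E. push p c = 0} = (shift_im :: ('x \<Rightarrow>\<^sub>0 'k::ab_group_add) set)"
proof (intro equalityI subsetI)
  fix c :: "'x \<Rightarrow>\<^sub>0 'k" assume "c \<in> {c \<in> free_on E. push p c = 0}"
  then have c: "c \<in> free_on E" "push p c = 0" by auto
  have "c - push sec (push p c) \<in> shift_im"
    using c(1)
  proof (induction rule: free_on_induct)
    case zero
    show ?case by (simp add: zero_shift_im)
  next
    case (single x k)
    have s: "sec (p x) \<in> E" "p (sec (p x)) = p x" using sec p_onto single by auto
    then obtain j where "sec (p x) = (\<alpha> ^^ j) x \<or> x = (\<alpha> ^^ j) (sec (p x))"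
      using p_eq_iff[OF single s(1)] by auto
    then show ?case
    proof
      assume "sec (p x) = (\<alpha> ^^ j) x"
      then show ?thesis using single_pow_shift_im[OF single] by simp
    next
      assume "x = (\<alpha> ^^ j) (sec (p x))"
      then show ?thesis
        using shift_im_uminus[OF single_pow_shift_im[OF s(1), of k j]] by simp
    qed
  next
    case (add c d)
    from shift_im_add[OF this] show ?case by (simp add: algebra_simps)
  qed
  then show "c \<in> shift_im" using c(2) by simp
next
  fix c :: "'x \<Rightarrow>\<^sub>0 'k" assume c: "c \<in> shift_im"
  then show "c \<in> {c \<in> free_on E. push p c = 0}"
    by (auto simp: push_p_shift_im)
      (auto simp: shift_im_def intro!: minus_free_on push_free_on[where E = E] \<alpha>_in)
qed

lemma push_p_onto: "push p ` free_on E = (free_on Y :: ('y \<Rightarrow>\<^sub>0 'k::ab_group_add) set)"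
proof (intro equalityI subsetI)
  fix d :: "'y \<Rightarrow>\<^sub>0 'k" assume d: "d \<in> free_on Y"
  have "push p (push sec d) = d"
    unfolding push_push using push_cong[OF d, of "\<lambda>y. p (sec y)" "\<lambda>y. y"] sec by (simp add: push_id)
  then show "d \<in> push p ` free_on E"
    using push_free_on[OF d, of sec E] sec by (metis image_eqI)
qed (use p_onto in \<open>auto intro!: push_free_on\<close>)

text \<open>The support of an invariant sum is closed under \<open>\<alpha>\<close>; with one point
  it would contain an infinite forward orbit.\<close>

lemma push_\<alpha>_inj_infinite:
  fixes c :: "'x \<Rightarrow>\<^sub>0 'k::ab_group_add"
  assumes inf: "\<And>x k. x \<in> E \<Longrightarrow> k > 0 \<Longrightarrow> (\<alpha> ^^ k) x \<noteq> x"
    and c: "c \<in> free_on E" "push \<alpha> c = c"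
  shows "c = 0"
proof (rule ccontr)
  assume "c \<noteq> 0"
  then obtain x where x: "x \<in> keys c"
    by (metis ex_in_conv in_keys_iff lookup_zero poly_mapping_eqI)
  then have xX: "x \<in> E" using c by (auto simp: free_on_def)
  have "(\<alpha> ^^ k) x \<in> keys c" for k
  proof (induction k)
    case (Suc k)
    then show ?case
      using lookup_push_inj[OF \<alpha>_inj c(1) \<alpha>_pow_in[OF xX, of k]] c(2) by (simp add: in_keys_iff)
  qed (use x in simp)
  then have "finite (range (\<lambda>k. (\<alpha> ^^ k) x))"
    by (meson finite_keys finite_subset image_subsetI)
  then obtain i j where ij: "i < j" "(\<alpha> ^^ i) x = (\<alpha> ^^ j) x"
    by (metis (mono_tags, lifting) finite_imageD infinite_UNIV_nat injI linorder_neqE_nat)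
  have "(\<alpha> ^^ (j - i)) ((\<alpha> ^^ i) x) = (\<alpha> ^^ i) x"
    using ij by (metis add_diff_cancel_right' comp_apply funpow_add le_add_diff_inverse2 less_imp_le)
  then show False using inf[OF \<alpha>_pow_in[OF xX, of i], of "j - i"] ij by simp
qed

end

text \<open>All orbits have exactly \<open>m\<close> points. On a shorter orbit, of length dividing
  \<open>m\<close>, the norm would count points several times and the periodic resolution would not
  be exact.\<close>

locale finite_orbit_map = orbit_map E Y \<alpha> p
  for E :: "'x set" and Y :: "'y set" and \<alpha> :: "'x \<Rightarrow> 'x" and p :: "'x \<Rightarrow> 'y" +
  fixes m :: nat
  assumes m_pos: "m > 0"
    and pow_m: "x \<in> E \<Longrightarrow> (\<alpha> ^^ m) x = x"
    and pow_less: "x \<in> E \<Longrightarrow> 0 < k \<Longrightarrow> k < m \<Longrightarrow> (\<alpha> ^^ k) x \<noteq> x"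
begin

text \<open>The norm \<open>1 + \<alpha> + ... + \<alpha>^(m-1)\<close>, which alternates with
  \<open>1 - \<alpha>\<close> in the periodic resolution of a finite cyclic group.\<close>

definition norm_map :: "('x \<Rightarrow>\<^sub>0 'k::ab_group_add) \<Rightarrow> ('x \<Rightarrow>\<^sub>0 'k)" where
  "norm_map d = (\<Sum>j<m. push (\<alpha> ^^ j) d)"

lemma additive_norm_map: "additive norm_map"
  unfolding norm_map_def by (intro additive_sum additive_push)

lemma norm_map_free_on: "d \<in> free_on E \<Longrightarrow> norm_map d \<in> free_on E"
  unfolding norm_map_def by (auto intro!: sum_free_on push_free_on \<alpha>_pow_in)

lemma pow_mod: "x \<in> E \<Longrightarrow> (\<alpha> ^^ k) x = (\<alpha> ^^ (k mod m)) x"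
proof -
  assume x: "x \<in> E"
  have "(\<alpha> ^^ (m * q)) x = x" for q
    by (induction q) (use x pow_m in \<open>auto simp: funpow_add\<close>)
  then have "(\<alpha> ^^ (k mod m + m * (k div m))) x = (\<alpha> ^^ (k mod m)) x"
    by (simp only: funpow_add comp_apply)
  then show ?thesis by simp
qed

lemma orbit_unique:
  assumes "x \<in> E" "x' \<in> E" "p x = p x'"
  shows "\<exists>!j. j < m \<and> x' = (\<alpha> ^^ j) x"
proof -
  obtain k where "x' = (\<alpha> ^^ k) x \<or> x = (\<alpha> ^^ k) x'" using p_eq_iff assms by blast
  \<comment> \<open>If \<open>x\<close> lies ahead of \<open>x'\<close>, completing the cycle leads
    back to \<open>x'\<close>. The exponent equals \<open>m\<close> when \<open>m\<close> divides
    \<open>k\<close>; the reduction modulo \<open>m\<close> below takes care of that.\<close>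
  moreover have "x' = (\<alpha> ^^ ((m - k mod m))) x" if "x = (\<alpha> ^^ k) x'"
  proof -
    have "(\<alpha> ^^ (m - k mod m)) ((\<alpha> ^^ (k mod m)) x') = (\<alpha> ^^ m) x'"
      using m_pos mod_less_divisor[OF m_pos, of k]
      by (metis comp_apply funpow_add le_add_diff_inverse2 less_imp_le)
    then show ?thesis using that pow_mod[OF assms(2)] pow_m[OF assms(2)] by simp
  qed
  ultimately obtain k' where "x' = (\<alpha> ^^ k') x" by blast
  then have ex: "k' mod m < m \<and> x' = (\<alpha> ^^ (k' mod m)) x" 
    using pow_mod[OF assms(1), of k'] m_pos by (metis mod_less_divisor)
  have "False" if "i < j" "j < m" "(\<alpha> ^^ i) x = (\<alpha> ^^ j) x" for i j
  proof -
    have "(\<alpha> ^^ (j - i)) ((\<alpha> ^^ i) x) = (\<alpha> ^^ i) x"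
      using that by (metis comp_apply funpow_add le_add_diff_inverse2 less_imp_le)
    then show False using pow_less[OF \<alpha>_pow_in[OF assms(1), of i], of "j - i"] that
      by (metis less_imp_diff_less zero_less_diff)
  qed
  then show ?thesis using ex by (metis linorder_neqE_nat)
qed

text \<open>By \<open>orbit_unique\<close> each point of the fibre of \<open>x\<close> contributes
  its coefficient once, so the norm spreads fibre sums over the fibres. Kernel and image of the norm
  thereby reduce to statements about \<open>push p\<close>.\<close>

lemma lookup_norm_map:
  fixes c :: "'x \<Rightarrow>\<^sub>0 'k::ab_group_add"
  assumes "c \<in> free_on E" "x \<in> E"
  shows "lookup (norm_map c) x = lookup (push p c) (p x)"
proof (rule additive_eq_on_free[OF _ _ assms(1)])
  show "additive (\<lambda>c. lookup (norm_map c) x)"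
    "additive (\<lambda>c. lookup (push p c) (p x))"
    by (auto intro: additive_compose[OF additive_lookup] additive_norm_map additive_push)
  fix x' :: 'x and k :: 'k assume x': "x' \<in> E"
  have "lookup (norm_map (single x' k)) x
      = (\<Sum>j<m. if (\<alpha> ^^ j) x' = x then k else 0)"
    by (simp add: norm_map_def lookup_sum lookup_single when_def)
  also have "\<dots> = (if p x' = p x then k else 0)"
  proof (cases "p x' = p x")
    case True
    then obtain j where j: "j < m" "x = (\<alpha> ^^ j) x'" "\<And>i. i < m \<Longrightarrow> x = (\<alpha> ^^ i) x' \<Longrightarrow> i = j"
      using orbit_unique[OF x' assms(2)] by blast
    have "(\<Sum>j<m. if (\<alpha> ^^ j) x' = x then k else 0) = (\<Sum>i<m. if i = j then k else 0)"
      by (rule sum.cong) (use j in auto)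
    then show ?thesis using True j(1) by simp
  next
    case False
    then have "(\<alpha> ^^ j) x' \<noteq> x" for j using p_\<alpha>_pow[OF x', of j] by metis
    then show ?thesis using False by simp
  qed
  finally show "lookup (norm_map (single x' k)) x
      = lookup (push p (single x' k)) (p x)"
    by (simp add: lookup_single when_def)
qed

lemma eq_on_free:
  assumes "c \<in> free_on E" "d \<in> free_on E"
    "\<And>x. x \<in> E \<Longrightarrow> lookup c x = lookup d x"
  shows "c = d"
  using assms by (intro poly_mapping_eqI) (metis free_on_def in_keys_iff mem_Collect_eq subset_iff)

lemma ker_norm_map:
  "{c \<in> free_on E. norm_map c = 0} = (shift_im :: ('x \<Rightarrow>\<^sub>0 'k::ab_group_add) set)"
  unfolding ker_push_p[symmetric]
proof (intro Collect_cong conj_cong refl)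
  fix c :: "'x \<Rightarrow>\<^sub>0 'k" assume c: "c \<in> free_on E"
  have Y: "push p c \<in> free_on Y" using push_free_on[OF c] p_onto by blast
  have "push p c = 0" if "norm_map c = 0"
  proof (rule poly_mapping_eqI)
    fix y
    show "lookup (push p c) y = lookup 0 y"
    proof (cases "y \<in> Y")
      case True
      then show ?thesis using lookup_norm_map[OF c, of "sec y"] sec that by simp
    next
      case False
      then show ?thesis using Y by (auto simp: free_on_def in_keys_iff)
    qed
  qed
  moreover have "norm_map c = 0" if "push p c = 0"
    by (rule eq_on_free) (use lookup_norm_map[OF c] norm_map_free_on[OF c] that in auto)
  ultimately show "norm_map c = 0 \<longleftrightarrow> push p c = 0" by blast
qed

lemma norm_map_image:
  "norm_map ` free_on E = {c \<in> free_on E. c - push \<alpha> c = (0 :: 'x \<Rightarrow>\<^sub>0 'k::ab_group_add)}"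
proof (intro equalityI subsetI)
  fix c :: "'x \<Rightarrow>\<^sub>0 'k" assume "c \<in> norm_map ` free_on E"
  then obtain d where d: "d \<in> free_on E" "c = norm_map d" by auto
  have ad: "push \<alpha> d \<in> free_on E" using push_free_on[OF d(1)] \<alpha>_in by blast
  have "push \<alpha> c = norm_map (push \<alpha> d)"
    unfolding d(2) norm_map_def additive.sum[OF additive_push] push_push
    by (simp only: funpow_swap1[of \<alpha>])
  also have "\<dots> = c"
  proof (rule eq_on_free)
    fix x assume x: "x \<in> E"
    have "push p (push \<alpha> d) = push p d"
      unfolding push_push by (rule push_cong[OF d(1)]) (rule p_\<alpha>)
    then show "lookup (norm_map (push \<alpha> d)) x = lookup c x"
      unfolding d(2) by (simp add: lookup_norm_map[OF _ x] d(1) ad)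
  qed (auto intro: norm_map_free_on ad d simp: d(2))
  finally show "c \<in> {c \<in> free_on E. c - push \<alpha> c = 0}"
    using norm_map_free_on[OF d(1)] d(2) by simp
next
  fix c :: "'x \<Rightarrow>\<^sub>0 'k" assume "c \<in> {c \<in> free_on E. c - push \<alpha> c = 0}"
  then have c: "c \<in> free_on E" "push \<alpha> c = c" by auto
  have pow: "lookup c ((\<alpha> ^^ k) x) = lookup c x" if "x \<in> E" for x k
  proof (induction k)
    case (Suc k)
    then show ?case
      using lookup_push_inj[OF \<alpha>_inj c(1) \<alpha>_pow_in[OF that, of k]] c(2) by simp
  qed simp
  have const: "lookup c x = lookup c x'"
    if "x \<in> E" "x' \<in> E" "p x = p x'" for x x'
    using p_eq_iff[OF that(1,2)] that pow by metis
  \<comment> \<open>An invariant sum is constant on fibres, so keeping one point of each fibre that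
    meets the support gives a preimage under the norm.\<close>
  define d where
    "d = (\<Sum>y\<in>p ` keys c. single (sec y) (lookup c (sec y)))"
  have kX: "keys c \<subseteq> E" using c by (simp add: free_on_def)
  then have kY: "p ` keys c \<subseteq> Y" using p_onto by auto
  have d: "d \<in> free_on E" unfolding d_def
    by (rule sum_free_on) (use kY sec in auto)
  have "norm_map d = c"
  proof (rule eq_on_free[OF norm_map_free_on[OF d] c(1)])
    fix x assume x: "x \<in> E"
    have "lookup (norm_map d) x = lookup (push p d) (p x)"
      by (rule lookup_norm_map[OF d x])
    also have "push p d = (\<Sum>y\<in>p ` keys c. single y (lookup c (sec y)))"
      unfolding d_def by (simp, rule sum.cong) (use kY sec in auto)
    also have "lookup \<dots> (p x)
        = (if p x \<in> p ` keys c then lookup c (sec (p x)) else 0)"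
      by (simp add: lookup_sum lookup_single when_def)
    also have "\<dots> = lookup c x"
    proof (cases "p x \<in> p ` keys c")
      case True
      have "p x \<in> Y" using x p_onto by auto
      then show ?thesis using True const[of "sec (p x)" x] sec x by simp
    next
      case False
      then have "x \<notin> keys c" by auto
      then show ?thesis using False by (simp add: in_keys_iff)
    qed
    finally show "lookup (norm_map d) x = lookup c x" .
  qed
  then show "c \<in> norm_map ` free_on E" using d by blast
qed

end

section \<open>Central chains with cyclic factors\<close>

context group
begin

text \<open>With \<open>m_assoc\<close> and \<open>inv_mult_group\<close> these rules let the
  simplifier prove the word identities below.\<close>

lemma inv_cancel_left [simp]:
  "x \<in> carrier G \<Longrightarrow> y \<in> carrier G \<Longrightarrow> inv x \<otimes> (x \<otimes> y) = y"
  "x \<in> carrier G \<Longrightarrow> y \<in> carrier G \<Longrightarrow> x \<otimes> (inv x \<otimes> y) = y"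
  by (simp_all add: m_assoc[symmetric])

text \<open>A predicate on the top member instead of a list of subgroups: its rule induction is the
  induction along the chain. The commutator condition expresses centrality modulo \<open>N\<close>
  without a quotient group.\<close>

inductive cyc_chain :: "'a set \<Rightarrow> bool" where
  base: "cyc_chain {\<one>}"
| step: "cyc_chain N \<Longrightarrow> a \<in> carrier G \<Longrightarrow>
    (\<And>g. g \<in> carrier G \<Longrightarrow> g \<otimes> a \<otimes> inv g \<otimes> inv a \<in> N) \<Longrightarrow> cyc_chain (generate G (insert a N))"

lemma normal_conj:
  assumes "N \<lhd> G" "x \<in> carrier G" "n \<in> N"
  shows "x \<otimes> n \<otimes> inv x \<in> N"
  using assms by (simp add: normal.inv_op_closed2)

text \<open>Conjugation changes a generator \<open>t\<close> only by a commutator, which lies in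
  \<open>N\<close>.\<close>

lemma central_generate_normal:
  assumes N: "N \<lhd> G" and T: "T \<subseteq> carrier G"
    and comm: "\<And>g t. g \<in> carrier G \<Longrightarrow> t \<in> T \<Longrightarrow> g \<otimes> t \<otimes> inv g \<otimes> inv t \<in> N"
  shows "generate G (T \<union> N) \<lhd> G"
proof (rule normal_invI)
  have sub: "T \<union> N \<subseteq> carrier G" using T N normal_imp_subgroup subgroup.subset by blast
  show sg: "subgroup (generate G (T \<union> N)) G" by (rule generate_is_subgroup[OF sub])
  have conj: "x \<otimes> t \<otimes> inv x \<in> generate G (T \<union> N)" if "t \<in> T \<union> N" "x \<in> carrier G" for t x
  proof (cases "t \<in> N")
    case True
    then show ?thesis using normal_conj[OF N that(2)] by (intro generate.incl) auto
  next
    case False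
    then have t: "t \<in> T" "t \<in> carrier G" using that T by auto
    have "x \<otimes> t \<otimes> inv x = (x \<otimes> t \<otimes> inv x \<otimes> inv t) \<otimes> t"
      using t that by (simp add: m_assoc)
    then show ?thesis using comm[OF that(2) t(1)] t by (metis UnCI generate.eng generate.incl)
  qed
  fix x h assume x: "x \<in> carrier G" and h: "h \<in> generate G (T \<union> N)"
  from h show "x \<otimes> h \<otimes> inv x \<in> generate G (T \<union> N)"
  proof induction
    case one
    then show ?case using x by (simp add: generate.one)
  next
    case (incl h)
    then show ?case using conj x by blast
  next
    case (inv h)
    then have "x \<otimes> inv h \<otimes> inv x = inv (x \<otimes> h \<otimes> inv x)"
      using x sub by (auto simp: m_assoc inv_mult_group)
    then show ?case using conj[OF inv x] generate_m_inv_closed[OF sub] by metis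
  next
    case (eng h1 h2)
    then have "h1 \<in> carrier G" "h2 \<in> carrier G" using generate_in_carrier[OF sub] by auto
    then have "x \<otimes> (h1 \<otimes> h2) \<otimes> inv x = (x \<otimes> h1 \<otimes> inv x) \<otimes> (x \<otimes> h2 \<otimes> inv x)"
      using x by (simp add: m_assoc)
    then show ?case using eng generate.eng by metis
  qed
qed

lemma cyc_chain_normal: "cyc_chain N \<Longrightarrow> N \<lhd> G"
proof (induction rule: cyc_chain.induct)
  case (step N a)
  then show ?case using central_generate_normal[of N "{a}"] by simp
qed (rule one_is_normal)

text \<open>This set is the preimage of the centraliser of \<open>h\<close> in \<open>G/N\<close>.
  It allows commutators to be checked on generators only.\<close>

lemma commutator_subgroup:
  assumes N: "N \<lhd> G" and h: "h \<in> carrier G"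
  shows "subgroup {g \<in> carrier G. g \<otimes> h \<otimes> inv g \<otimes> inv h \<in> N} G"
proof
  have sub: "subgroup N G" by (rule normal_imp_subgroup[OF N])
  show "\<one> \<in> {g \<in> carrier G. g \<otimes> h \<otimes> inv g \<otimes> inv h \<in> N}"
    using h subgroup.one_closed[OF sub] by simp
  fix x assume x: "x \<in> {g \<in> carrier G. g \<otimes> h \<otimes> inv g \<otimes> inv h \<in> N}"
  then have "inv x \<otimes> inv (x \<otimes> h \<otimes> inv x \<otimes> inv h) \<otimes> inv (inv x) \<in> N"
    by (intro normal_conj[OF N] subgroup.m_inv_closed[OF sub]) auto
  also have "inv x \<otimes> inv (x \<otimes> h \<otimes> inv x \<otimes> inv h) \<otimes> inv (inv x)
      = inv x \<otimes> h \<otimes> inv (inv x) \<otimes> inv h"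
    using x h by (simp add: m_assoc inv_mult_group)
  finally show "inv x \<in> {g \<in> carrier G. g \<otimes> h \<otimes> inv g \<otimes> inv h \<in> N}" using x by simp
  fix y assume y: "y \<in> {g \<in> carrier G. g \<otimes> h \<otimes> inv g \<otimes> inv h \<in> N}"
  have "(x \<otimes> (y \<otimes> h \<otimes> inv y \<otimes> inv h) \<otimes> inv x) \<otimes> (x \<otimes> h \<otimes> inv x \<otimes> inv h) \<in> N"
    using x y by (intro subgroup.m_closed[OF sub, of "x \<otimes> (y \<otimes> h \<otimes> inv y \<otimes> inv h) \<otimes> inv x"]
        normal_conj[OF N]) auto
  also have "(x \<otimes> (y \<otimes> h \<otimes> inv y \<otimes> inv h) \<otimes> inv x) \<otimes> (x \<otimes> h \<otimes> inv x \<otimes> inv h)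
      = (x \<otimes> y) \<otimes> h \<otimes> inv (x \<otimes> y) \<otimes> inv h"
    using x y h by (simp add: m_assoc inv_mult_group)
  finally show "x \<otimes> y \<in> {g \<in> carrier G. g \<otimes> h \<otimes> inv g \<otimes> inv h \<in> N}" using x y by simp
qed auto

lemma commutator_swap:
  assumes N: "N \<lhd> G" and "g \<in> carrier G" "h \<in> carrier G" "g \<otimes> h \<otimes> inv g \<otimes> inv h \<in> N"
  shows "h \<otimes> g \<otimes> inv h \<otimes> inv g \<in> N"
proof -
  have "inv (g \<otimes> h \<otimes> inv g \<otimes> inv h) \<in> N"
    using subgroup.m_inv_closed[OF normal_imp_subgroup[OF N]] assms by blast
  then show ?thesis using assms by (simp add: m_assoc inv_mult_group)
qed

section \<open>The lower central series of a finitely generated group\<close>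

lemma lower_central_normal: "lower_central G n \<lhd> G"
proof (induction n)
  case 0
  then show ?case by (simp add: normal_self)
next
  case (Suc n)
  have c: "lower_central G n \<subseteq> carrier G"
    using Suc normal_imp_subgroup subgroup.subset by blast
  show ?case
    unfolding lower_central.simps
  proof (rule normal_generateI)
    show "{g \<otimes> h \<otimes> inv g \<otimes> inv h |g h. g \<in> carrier G \<and> h \<in> lower_central G n} \<subseteq> carrier G"
      using c by auto
    fix k x
    assume "k \<in> {g \<otimes> h \<otimes> inv g \<otimes> inv h |g h. g \<in> carrier G \<and> h \<in> lower_central G n}"
      and x: "x \<in> carrier G"
    then obtain g h where gh: "k = g \<otimes> h \<otimes> inv g \<otimes> inv h" "g \<in> carrier G" "h \<in> lower_central G n"
      by auto
    then have "h \<in> carrier G" using c by auto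
    \<comment> \<open>Conjugating a commutator conjugates its two entries, so the generating set
      itself is invariant.\<close>
    then have "x \<otimes> k \<otimes> inv x
        = (x \<otimes> g \<otimes> inv x) \<otimes> (x \<otimes> h \<otimes> inv x) \<otimes> inv (x \<otimes> g \<otimes> inv x) \<otimes> inv (x \<otimes> h \<otimes> inv x)"
      using gh x by (simp add: m_assoc inv_mult_group)
    then show "x \<otimes> k \<otimes> inv x
        \<in> {g \<otimes> h \<otimes> inv g \<otimes> inv h |g h. g \<in> carrier G \<and> h \<in> lower_central G n}"
      using gh x normal_conj[OF Suc x gh(3)] by blast
  qed
qed

lemma lower_central_subgroup: "subgroup (lower_central G n) G"
  by (rule normal_imp_subgroup[OF lower_central_normal])

lemma lower_central_carrier: "lower_central G n \<subseteq> carrier G"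
  by (rule subgroup.subset[OF lower_central_subgroup])

lemma lower_central_commutator:
  "g \<in> carrier G \<Longrightarrow> h \<in> lower_central G n \<Longrightarrow> g \<otimes> h \<otimes> inv g \<otimes> inv h \<in> lower_central G (Suc n)"
  unfolding lower_central.simps by (rule generate.incl) blast

lemma lower_central_Suc: "lower_central G (Suc n) \<subseteq> lower_central G n"
  unfolding lower_central.simps
proof (rule generate_subgroup_incl[OF _ lower_central_subgroup], safe)
  fix g h assume gh: "g \<in> carrier G" "h \<in> lower_central G n"
  then show "g \<otimes> h \<otimes> inv g \<otimes> inv h \<in> lower_central G n"
    using normal_conj[OF lower_central_normal gh] lower_central_subgroup
    by (meson subgroup.m_closed subgroup.m_inv_closed)
qed

text \<open>Modulo \<open>lower_central G (Suc (Suc n))\<close> the commutator is additive in each argument separately, so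
  finitely many commutators of generators suffice.\<close>

lemma lower_central_fin_gen:
  assumes S: "finite S" "S \<subseteq> carrier G" "generate G S = carrier G"
  shows "\<exists>T. finite T \<and> T \<subseteq> lower_central G n \<and>
    generate G (T \<union> lower_central G (Suc n)) = lower_central G n"
proof (induction n)
  case 0
  have "generate G S \<subseteq> generate G (S \<union> lower_central G (Suc 0))"
    by (rule mono_generate) simp
  moreover have "generate G (S \<union> lower_central G (Suc 0)) \<subseteq> carrier G"
    using generate_incl[of "S \<union> lower_central G (Suc 0)"] S lower_central_carrier[of "Suc 0"] by auto
  ultimately show ?case using S by auto
next
  case (Suc n)
  then obtain T where T: "finite T" "T \<subseteq> lower_central G n"
    "generate G (T \<union> lower_central G (Suc n)) = lower_central G n" by blast
  define T' where "T' = (\<lambda>(s, t). s \<otimes> t \<otimes> inv s \<otimes> inv t) ` (S \<times> T)"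
  define H where "H = generate G (T' \<union> lower_central G (Suc (Suc n)))"
  have T': "T' \<subseteq> lower_central G (Suc n)"
  proof
    fix x assume "x \<in> T'"
    then obtain s t where "s \<in> S" "t \<in> T" "x = s \<otimes> t \<otimes> inv s \<otimes> inv t" by (auto simp: T'_def)
    then show "x \<in> lower_central G (Suc n)"
      using lower_central_commutator[of s t n] S T by blast
  qed
  have H: "H \<lhd> G"
    unfolding H_def
  proof (rule central_generate_normal[OF lower_central_normal])
    show "T' \<subseteq> carrier G" using T' lower_central_carrier by blast
  qed (use T' lower_central_commutator in blast)
  have incl: "T' \<union> lower_central G (Suc (Suc n)) \<subseteq> H"
    unfolding H_def by (auto intro: generate.incl)
  have "generate G (T' \<union> lower_central G (Suc (Suc n))) \<subseteq> lower_central G (Suc n)"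
    by (rule generate_subgroup_incl[OF _ lower_central_subgroup])
      (use T' lower_central_Suc in blast)
  moreover have "lower_central G (Suc n) \<subseteq> H"
    unfolding lower_central.simps(2)[of G n]
  proof (rule generate_subgroup_incl[OF _ normal_imp_subgroup[OF H]], safe)
    fix g h assume g: "g \<in> carrier G" and h: "h \<in> lower_central G n"
    have hc: "h \<in> carrier G" if "h \<in> lower_central G n" for h
      using lower_central_carrier that by auto
    \<comment> \<open>The two arguments are reduced to generators in turn: here \<open>t\<close> is
      fixed and \<open>g\<close> varies in the centraliser of \<open>t\<close> modulo
      \<open>H\<close>; afterwards \<open>g\<close> is fixed and the second argument varies.\<close>
    have "g \<otimes> t \<otimes> inv g \<otimes> inv t \<in> H" if t: "t \<in> T" for t
    proof -
      have tc: "t \<in> carrier G" using t T hc by auto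
      have "generate G S \<subseteq> {g \<in> carrier G. g \<otimes> t \<otimes> inv g \<otimes> inv t \<in> H}"
        by (rule generate_subgroup_incl[OF _ commutator_subgroup[OF H tc]])
          (use S t incl in \<open>auto simp: T'_def\<close>)
      then show ?thesis using S g by auto
    qed
    moreover have "g \<otimes> t \<otimes> inv g \<otimes> inv t \<in> H" if t: "t \<in> lower_central G (Suc n)" for t
      using lower_central_commutator[OF g t] incl by blast
    ultimately have "T \<union> lower_central G (Suc n) \<subseteq> {h \<in> carrier G. h \<otimes> g \<otimes> inv h \<otimes> inv g \<in> H}"
      using commutator_swap[OF H g] T hc lower_central_Suc by blast
    then have "generate G (T \<union> lower_central G (Suc n)) \<subseteq> {h \<in> carrier G. h \<otimes> g \<otimes> inv h \<otimes> inv g \<in> H}"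
      by (rule generate_subgroup_incl[OF _ commutator_subgroup[OF H g]])
    then show "g \<otimes> h \<otimes> inv g \<otimes> inv h \<in> H"
      using T(3) h commutator_swap[OF H _ g] by blast
  qed
  ultimately show ?case using T' T(1) S(1) unfolding H_def T'_def
    by (intro exI[of _ T'] conjI) (auto simp: T'_def)
qed

text \<open>The elements of \<open>T\<close> are adjoined one at a time; being central modulo
  \<open>N\<close>, each is central modulo every larger member.\<close>

lemma cyc_chain_generate_finite:
  assumes "cyc_chain N" "finite T" "T \<subseteq> carrier G"
    and "\<And>g t. g \<in> carrier G \<Longrightarrow> t \<in> T \<Longrightarrow> g \<otimes> t \<otimes> inv g \<otimes> inv t \<in> N"
  shows "cyc_chain (generate G (T \<union> N))"
  using assms(2-4)
proof (induction T)
  case empty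
  have "generate G N = N"
    using cyc_chain_normal[OF assms(1)] normal_imp_subgroup
    by (metis generate_subgroup_incl generate.incl subset_antisym subsetI order_refl)
  then show ?case using assms(1) by simp
next
  case (insert t T)
  have Nc: "N \<subseteq> carrier G"
    using cyc_chain_normal[OF assms(1)] normal_imp_subgroup subgroup.subset by blast
  have "cyc_chain (generate G (insert t (generate G (T \<union> N))))"
    using insert by (intro cyc_chain.step) (auto intro: generate.incl)
  also have "generate G (insert t (generate G (T \<union> N))) = generate G (insert t T \<union> N)" (is "?L = ?R")
  proof
    have R: "subgroup ?R G" using insert.prems Nc by (intro generate_is_subgroup) auto
    have "generate G (T \<union> N) \<subseteq> ?R" by (rule mono_generate) auto
    then show "?L \<subseteq> ?R" by (intro generate_subgroup_incl[OF _ R]) (auto intro: generate.incl)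
    have "T \<union> N \<subseteq> generate G (T \<union> N)" by (auto intro: generate.incl)
    then show "?R \<subseteq> ?L" by (intro mono_generate) auto
  qed
  finally show ?case .
qed

lemma cyc_chain_carrier:
  assumes "fin_gen_group G" "nilpotent_group G"
  shows "cyc_chain (carrier G)"
proof -
  obtain S where S: "finite S" "S \<subseteq> carrier G" "generate G S = carrier G"
    using assms(1) by (auto simp: fin_gen_group_def)
  obtain c where c: "lower_central G c = {\<one>}"
    using assms(2) by (auto simp: nilpotent_group_def)
  \<comment> \<open>The series is climbed from its trivial member, index \<open>c\<close>, to
    \<open>G\<close>, index 0; from \<open>k = c\<close> on truncated subtraction keeps the index at
    0.\<close>
  have "cyc_chain (lower_central G (c - k))" for k
  proof (induction k)
    case 0
    then show ?case by (simp add: c base)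
  next
    case (Suc k)
    show ?case
    proof (cases "k < c")
      case True
      define n where "n = c - Suc k"
      have n: "c - k = Suc n" using True by (simp add: n_def)
      obtain T where T: "finite T" "T \<subseteq> lower_central G n"
        "generate G (T \<union> lower_central G (Suc n)) = lower_central G n"
        using lower_central_fin_gen[OF S] by blast
      have "cyc_chain (generate G (T \<union> lower_central G (Suc n)))"
        by (rule cyc_chain_generate_finite)
          (use Suc n T lower_central_carrier lower_central_commutator in \<open>auto simp del: lower_central.simps\<close>)
      then show ?thesis using T n_def by simp
    next
      case False
      then show ?thesis using Suc by simp
    qed
  qed
  from this[of c] show ?thesis by simp
qed

section \<open>Cosets, and the subgroup generated by a normal subgroup and one element\<close>

lemma lcos_eq_iff:
  assumes "subgroup N G" "x \<in> carrier G" "y \<in> carrier G"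
  shows "x <# N = y <# N \<longleftrightarrow> inv x \<otimes> y \<in> N"
proof
  assume "x <# N = y <# N"
  moreover have "y \<in> y <# N"
    using subgroup.one_closed[OF assms(1)] assms(3) by (force simp: l_coset_def)
  ultimately obtain n where "n \<in> N" "y = x \<otimes> n" by (auto simp: l_coset_def)
  then show "inv x \<otimes> y \<in> N" using assms subgroup.mem_carrier[OF assms(1)] by simp
next
  assume "inv x \<otimes> y \<in> N"
  then have "y \<in> x <# N" using assms by (force simp: l_coset_def)
  then show "x <# N = y <# N" using l_repr_independence assms by blast
qed

text \<open>Products keep this form because \<open>a^k n a^l n' = a^(k+l) (a^(-l) n a^l) n'\<close>
  and \<open>N\<close> is normal.\<close>

lemma generate_central_form:
  assumes N: "N \<lhd> G" and a: "a \<in> carrier G"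
    and x: "x \<in> generate G (insert a N)"
  shows "\<exists>k::int. \<exists>n\<in>N. x = a [^] k \<otimes> n"
proof -
  have sub: "subgroup N G" by (rule normal_imp_subgroup[OF N])
  note mem = subgroup.mem_carrier[OF sub]
  from x show ?thesis
  proof induction
    case one
    then show ?case using subgroup.one_closed[OF sub] by (intro exI[of _ "0::int"]) force
  next
    case (incl h)
    then show ?case
    proof
      assume "h = a"
      then show ?thesis using a subgroup.one_closed[OF sub] by (intro exI[of _ "1::int"]) force
    next
      assume "h \<in> N"
      then show ?thesis using a mem by (intro exI[of _ "0::int"]) force
    qed
  next
    case (inv h)
    then show ?case
    proof
      assume "h = a"
      then show ?thesis using a subgroup.one_closed[OF sub]
        by (intro exI[of _ "-1::int"] bexI[of _ \<one>]) (auto simp: int_pow_neg)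
    next
      assume "h \<in> N"
      then show ?thesis using a mem subgroup.m_inv_closed[OF sub]
        by (intro exI[of _ "0::int"] bexI[of _ "inv h"]) auto
    qed
  next
    case (eng x y)
    then obtain k l :: int and n n' where *: "n \<in> N" "n' \<in> N" "x = a [^] k \<otimes> n" "y = a [^] l \<otimes> n'"
      by blast
    have c: "a [^] k \<in> carrier G" "a [^] l \<in> carrier G" "n \<in> carrier G" "n' \<in> carrier G"
      using a * mem by auto
    have "inv (a [^] l) \<otimes> n \<otimes> inv (inv (a [^] l)) \<in> N" using c * by (intro normal_conj[OF N]) auto
    then have "(inv (a [^] l) \<otimes> n \<otimes> a [^] l) \<otimes> n' \<in> N"
      using c * subgroup.m_closed[OF sub] by simp
    moreover have "x \<otimes> y = a [^] (k + l) \<otimes> ((inv (a [^] l) \<otimes> n \<otimes> a [^] l) \<otimes> n')"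
      using a c * by (simp add: int_pow_mult m_assoc)
    ultimately show ?case by blast
  qed
qed

lemma lcos_rcos:
  assumes N: "N \<lhd> G" and "g \<in> carrier G" "h \<in> carrier G"
  shows "(g <# N) #> h = (g \<otimes> h) <# N"
proof -
  have sub: "N \<subseteq> carrier G" using normal_imp_subgroup[OF N] subgroup.subset by blast
  have "(g <# N) #> h = g <# (N #> h)"
    using assms sub by (auto simp: l_coset_def r_coset_def m_assoc subset_iff)
  also have "N #> h = h <# N" using N assms(3) by (simp add: normal.coset_eq)
  also have "g <# (h <# N) = (g \<otimes> h) <# N" using assms sub by (simp add: lcos_m_assoc)
  finally show ?thesis .
qed

end

section \<open>Permutation modules on cosets\<close>

text \<open>Modules are subsets of one type, so that kernels, images and the modules for all
  \<open>N\<close> can be arguments of the same predicate. Left translations by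
  \<open>\<Gamma>\<close> give the module structure; the right ones are kept for
  \<open>\<theta>\<close>. Supports inside \<open>Pow (carrier G)\<close> make translations
  compose.\<close>

definition bimod :: "('a, 'b) monoid_scheme \<Rightarrow> 'a set \<Rightarrow> ('a set \<Rightarrow>\<^sub>0 'k::comm_ring_1) set \<Rightarrow> bool" where
  "bimod G \<Gamma> V \<longleftrightarrow> V \<subseteq> free_on (Pow (carrier G)) \<and> 0 \<in> V \<and> (\<forall>v\<in>V. \<forall>w\<in>V. v + w \<in> V) \<and>
     (\<forall>k. \<forall>v\<in>V. scal k v \<in> V) \<and>
     (\<forall>h\<in>\<Gamma>. \<forall>v\<in>V. push (\<lambda>C. h <#\<^bsub>G\<^esub> C) v \<in> V \<and> push (\<lambda>C. C #>\<^bsub>G\<^esub> h) v \<in> V)"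

text \<open>Additivity is asked on the whole type, as \<open>coef_map\<close> wants it, equivariance
  only on \<open>V\<close>.\<close>

definition bimod_hom :: "('a, 'b) monoid_scheme \<Rightarrow> 'a set \<Rightarrow> ('a set \<Rightarrow>\<^sub>0 'k::comm_ring_1) set \<Rightarrow>
    ('a set \<Rightarrow>\<^sub>0 'k) set \<Rightarrow> (('a set \<Rightarrow>\<^sub>0 'k) \<Rightarrow> ('a set \<Rightarrow>\<^sub>0 'k)) \<Rightarrow> bool" where
  "bimod_hom G \<Gamma> V W f \<longleftrightarrow> additive f \<and> f ` V \<subseteq> W \<and> (\<forall>k. \<forall>v\<in>V. f (scal k v) = scal k (f v)) \<and>
     (\<forall>h\<in>\<Gamma>. \<forall>v\<in>V. f (push (\<lambda>C. h <#\<^bsub>G\<^esub> C) v) = push (\<lambda>C. h <#\<^bsub>G\<^esub> C) (f v) \<and>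
       f (push (\<lambda>C. C #>\<^bsub>G\<^esub> h) v) = push (\<lambda>C. C #>\<^bsub>G\<^esub> h) (f v))"

lemma bimod_uminus: "bimod G \<Gamma> V \<Longrightarrow> v \<in> V \<Longrightarrow> - v \<in> V"
proof -
  assume "bimod G \<Gamma> V" "v \<in> V"
  moreover have "- v = scal (- 1) v" by (rule poly_mapping_eqI) simp
  ultimately show ?thesis by (simp add: bimod_def)
qed

lemma bimod_minus: "bimod G \<Gamma> V \<Longrightarrow> v \<in> V \<Longrightarrow> w \<in> V \<Longrightarrow> v - w \<in> V"
  using bimod_uminus[of G \<Gamma> V w] unfolding diff_conv_add_uminus by (auto simp: bimod_def)

lemma bimod_zero: "bimod G \<Gamma> {0}"
  by (auto simp: bimod_def)

lemma bimod_hom_zero: "bimod_hom G \<Gamma> {0} {0} (\<lambda>_. 0)"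
  by (auto simp: bimod_hom_def additive_zero)

lemma bimod_kernel:
  assumes V: "bimod G \<Gamma> V" and f: "bimod_hom G \<Gamma> V W f"
  shows "bimod G \<Gamma> {v \<in> V. f v = 0}"
proof -
  interpret additive f using f by (simp add: bimod_hom_def)
  show ?thesis using V f unfolding bimod_def bimod_hom_def by (auto simp: zero add)
qed

lemma bimod_hom_restrict: "bimod_hom G \<Gamma> V W f \<Longrightarrow> f ` V \<subseteq> W' \<Longrightarrow> bimod_hom G \<Gamma> V W' f"
  by (simp add: bimod_hom_def)

text \<open>\<open>\<Gamma>\<close> stands for \<open>G_\<chi>\<close>, and for all of
  \<open>G\<close> on the homology side. The last axiom makes one of \<open>a\<close> and
  \<open>inv a\<close> available at each step of the chain.\<close>

locale half_space = group G for G :: "('a, 'b) monoid_scheme" (structure) +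
  fixes \<Gamma> :: "'a set"
  assumes \<Gamma>_carrier: "\<Gamma> \<subseteq> carrier G"
    and \<Gamma>_one: "\<one> \<in> \<Gamma>"
    and \<Gamma>_mult: "g \<in> \<Gamma> \<Longrightarrow> h \<in> \<Gamma> \<Longrightarrow> g \<otimes> h \<in> \<Gamma>"
    and \<Gamma>_inv: "g \<in> carrier G \<Longrightarrow> g \<in> \<Gamma> \<or> inv g \<in> \<Gamma>"
begin

definition cosets :: "'a set \<Rightarrow> 'a set set" where
  "cosets N = (\<lambda>g. g <# N) ` \<Gamma>"

lemma \<Gamma>_in: "g \<in> \<Gamma> \<Longrightarrow> g \<in> carrier G"
  using \<Gamma>_carrier by auto

lemma cosetsE:
  assumes "C \<in> cosets N"
  obtains g where "g \<in> \<Gamma>" "g \<in> carrier G" "C = g <# N"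
  using assms \<Gamma>_carrier by (auto simp: cosets_def)

lemma cosets_left:
  assumes "N \<subseteq> carrier G" "C \<in> cosets N" "h \<in> \<Gamma>"
  shows "h <# C \<in> cosets N"
  using assms by (auto simp: cosets_def lcos_m_assoc \<Gamma>_in \<Gamma>_mult)

lemma cosets_right:
  assumes "N \<lhd> G" "C \<in> cosets N" "h \<in> \<Gamma>"
  shows "C #> h \<in> cosets N"
  using assms by (auto simp: cosets_def lcos_rcos \<Gamma>_in \<Gamma>_mult)

lemma lcos_carrier: "g \<in> carrier G \<Longrightarrow> g <# carrier G = carrier G"
  using coset_join2 [of g "carrier G"] normal.coset_eq[OF normal_self] subgroup_self by metis

lemma cosets_carrier: "cosets (carrier G) = {carrier G}"
  using \<Gamma>_one lcos_carrier \<Gamma>_in by (auto simp: cosets_def)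

lemma bimod_cosets:
  assumes N: "N \<lhd> G"
  shows "bimod G \<Gamma> (free_on (cosets N))"
proof -
  have sub: "N \<subseteq> carrier G" using normal_imp_subgroup[OF N] subgroup.subset by blast
  then have "cosets N \<subseteq> Pow (carrier G)"
    using l_coset_subset_G \<Gamma>_in by (auto simp: cosets_def)
  then show ?thesis
    unfolding bimod_def
    by (auto intro: free_on_mono scal_free_on push_free_on cosets_left[OF sub] cosets_right[OF N])
qed

end

text \<open>Membership of \<open>a\<close> in \<open>\<Gamma>\<close> makes right translation by
  \<open>a\<close> map \<open>cosets N\<close> into itself.\<close>

locale central_step = half_space G \<Gamma> for G :: "('a, 'b) monoid_scheme" (structure) and \<Gamma> +
  fixes N :: "'a set" and a :: 'a
  assumes N: "N \<lhd> G" and a_in: "a \<in> \<Gamma>"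
    and a_central: "g \<in> carrier G \<Longrightarrow> g \<otimes> a \<otimes> inv g \<otimes> inv a \<in> N"
begin

abbreviation "N' \<equiv> generate G (insert a N)"

lemma a: "a \<in> carrier G"
  by (rule \<Gamma>_in[OF a_in])

lemma N_sub: "subgroup N G"
  by (rule normal_imp_subgroup[OF N])

lemma N_carrier: "N \<subseteq> carrier G"
  by (rule subgroup.subset[OF N_sub])

lemma N'_normal: "N' \<lhd> G"
  using central_generate_normal[OF N, of "{a}"] a a_central by simp

lemma N'_sub: "subgroup N' G"
  by (rule normal_imp_subgroup[OF N'_normal])

lemma N'_carrier: "N' \<subseteq> carrier G"
  by (rule subgroup.subset[OF N'_sub])

definition shift :: "'a set \<Rightarrow> 'a set" where
  "shift C = C #> a"

text \<open>Sends \<open>g <# N\<close> to \<open>g <# N'\<close> without choosing a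
  representative.\<close>

definition collapse :: "'a set \<Rightarrow> 'a set" where
  "collapse C = C <#> N'"

lemma shift_lcos: "g \<in> carrier G \<Longrightarrow> shift (g <# N) = (g \<otimes> a) <# N"
  unfolding shift_def by (rule lcos_rcos[OF N _ a])

lemma shift_pow_lcos: "g \<in> carrier G \<Longrightarrow> (shift ^^ k) (g <# N) = (g \<otimes> a [^] k) <# N"
  by (induction k) (use a in \<open>auto simp: shift_lcos m_assoc\<close>)

lemma collapse_lcos: "g \<in> carrier G \<Longrightarrow> collapse (g <# N) = g <# N'"
proof -
  assume g: "g \<in> carrier G"
  have "N <#> N' = N'"
  proof
    have NN': "N \<subseteq> N'" by (auto intro: generate.incl)
    then show "N <#> N' \<subseteq> N'"
      using subgroup.m_closed[OF N'_sub] by (auto simp: set_mult_def)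
    show "N' \<subseteq> N <#> N'"
    proof
      fix x assume "x \<in> N'"
      moreover from this have "x = \<one> \<otimes> x" using N'_carrier by auto
      ultimately show "x \<in> N <#> N'"
        using subgroup.one_closed[OF N_sub] unfolding set_mult_def by blast
    qed
  qed
  then show ?thesis
    unfolding collapse_def using setmult_lcos_assoc[OF N_carrier N'_carrier g] by simp
qed

sublocale orbit_map "cosets N" "cosets N'" shift collapse
proof
  fix C assume "C \<in> cosets N"
  then show "shift C \<in> cosets N"
    by (auto simp: cosets_def shift_lcos \<Gamma>_in \<Gamma>_mult a_in)
next
  show "inj_on shift (cosets N)"
  proof (rule inj_onI)
    fix C D assume "C \<in> cosets N" "D \<in> cosets N" and eq: "shift C = shift D"
    then obtain g h where gh: "g \<in> carrier G" "h \<in> carrier G" "C = g <# N" "D = h <# N"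
      by (meson cosetsE)
    have "inv (g \<otimes> a) \<otimes> (h \<otimes> a) \<in> N"
      using eq gh a by (simp add: shift_lcos lcos_eq_iff[OF N_sub])
    then have "a \<otimes> (inv (g \<otimes> a) \<otimes> (h \<otimes> a)) \<otimes> inv a \<in> N"
      by (rule normal_conj[OF N a])
    also have "a \<otimes> (inv (g \<otimes> a) \<otimes> (h \<otimes> a)) \<otimes> inv a = inv g \<otimes> h"
      using gh a by (simp add: m_assoc inv_mult_group)
    finally show "C = D" using gh by (simp add: lcos_eq_iff[OF N_sub])
  qed
next
  have "(\<lambda>g. collapse (g <# N)) ` \<Gamma> = (\<lambda>g. g <# N') ` \<Gamma>"
    by (rule image_cong) (auto simp: collapse_lcos \<Gamma>_in)
  then show "collapse ` cosets N = cosets N'" by (simp add: cosets_def image_image)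
next
  fix C D assume "C \<in> cosets N" "D \<in> cosets N"
  then obtain g h where gh: "g \<in> carrier G" "h \<in> carrier G" "C = g <# N" "D = h <# N"
    by (meson cosetsE)
  show "collapse C = collapse D \<longleftrightarrow> (\<exists>k. D = (shift ^^ k) C \<or> C = (shift ^^ k) D)" (is "?L \<longleftrightarrow> ?R")
  proof
    assume ?L
    then have "inv g \<otimes> h \<in> N'" using gh by (simp add: collapse_lcos lcos_eq_iff[OF N'_sub])
    then obtain k :: int and n where k: "n \<in> N" "inv g \<otimes> h = a [^] k \<otimes> n"
      using generate_central_form[OF N a] by blast
    have n: "n \<in> carrier G" using k N_carrier by auto
    have "h = g \<otimes> (inv g \<otimes> h)" using gh by simp
    then have h: "h = g \<otimes> (a [^] k \<otimes> n)" using k by simp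
    \<comment> \<open>The sign of the exponent tells which coset lies ahead: \<open>D\<close> is
      reached from \<open>C\<close> for \<open>k \<ge> 0\<close>, and \<open>C\<close> from
      \<open>D\<close> otherwise.\<close>
    show ?R
    proof (cases "k \<ge> 0")
      case True
      define j where "j = nat k"
      have j: "a [^] k = a [^] j" using True by (simp add: j_def int_pow_def nat_pow_def)
      have "inv (g \<otimes> a [^] j) \<otimes> h = n" unfolding h j using gh a n by (simp add: m_assoc inv_mult_group)
      then have "(shift ^^ j) C = D"
        using gh a k by (simp add: shift_pow_lcos lcos_eq_iff[OF N_sub])
      then show ?thesis by blast
    next
      case False
      define j where "j = nat (- k)"
      have "k = - int j" using False by (simp add: j_def)
      then have j: "a [^] k = inv (a [^] j)" using a by (simp add: int_pow_neg int_pow_int)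
      have aj: "a [^] j \<in> carrier G" using a by simp
      have "inv (a [^] j) \<otimes> inv n \<otimes> inv (inv (a [^] j)) \<in> N"
        using k aj subgroup.m_inv_closed[OF N_sub] by (intro normal_conj[OF N]) auto
      moreover have "inv (h \<otimes> a [^] j) \<otimes> g = inv (a [^] j) \<otimes> inv n \<otimes> inv (inv (a [^] j))"
        unfolding h j using gh aj n by (simp add: m_assoc inv_mult_group)
      ultimately have "(shift ^^ j) D = C"
        using gh aj by (simp add: shift_pow_lcos lcos_eq_iff[OF N_sub])
      then show ?thesis by blast
    qed
  next
    assume ?R
    have "a [^] k \<in> N'" for k :: nat
      by (induction k) (auto intro: generate.incl generate.eng generate.one)
    then have "collapse ((shift ^^ k) (x <# N)) = collapse (x <# N)" if "x \<in> carrier G" for x and k :: nat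
      using that a N'_carrier
      by (simp add: shift_pow_lcos collapse_lcos lcos_eq_iff[OF N'_sub] inv_mult_group m_assoc
          subgroup.m_inv_closed[OF N'_sub])
    then show ?L using \<open>?R\<close> gh by metis
  qed
qed

lemma shift_left: "C \<in> cosets N \<Longrightarrow> h \<in> \<Gamma> \<Longrightarrow> shift (h <# C) = h <# shift C"
  using N_carrier a by (auto simp: cosets_def shift_lcos lcos_m_assoc \<Gamma>_in m_assoc)

text \<open>Associativity settles the left translations but not these: \<open>g h a\<close> and
  \<open>g a h\<close> lie in one coset of \<open>N\<close> because \<open>a\<close> is central
  modulo \<open>N\<close>.\<close>

lemma shift_right: "C \<in> cosets N \<Longrightarrow> h \<in> \<Gamma> \<Longrightarrow> shift (C #> h) = shift C #> h"
proof -
  assume C: "C \<in> cosets N" and h: "h \<in> \<Gamma>"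
  then obtain g where g: "g \<in> carrier G" "C = g <# N" by (meson cosetsE)
  have hc: "h \<in> carrier G" using h \<Gamma>_in by simp
  have "inv h \<otimes> a \<otimes> inv (inv h) \<otimes> inv a \<in> N" using a_central hc by blast
  then have "inv a \<otimes> (inv h \<otimes> a \<otimes> inv (inv h) \<otimes> inv a) \<otimes> inv (inv a) \<in> N"
    using a by (intro normal_conj[OF N]) auto
  moreover have "inv (g \<otimes> h \<otimes> a) \<otimes> (g \<otimes> a \<otimes> h)
      = inv a \<otimes> (inv h \<otimes> a \<otimes> inv (inv h) \<otimes> inv a) \<otimes> inv (inv a)"
    using g hc a by (simp add: m_assoc inv_mult_group)
  ultimately show ?thesis
    using g hc a by (simp add: shift_lcos lcos_rcos[OF N] lcos_eq_iff[OF N_sub])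
qed

lemma collapse_left: "C \<in> cosets N \<Longrightarrow> h \<in> \<Gamma> \<Longrightarrow> collapse (h <# C) = h <# collapse C"
  using N_carrier N'_carrier by (auto simp: cosets_def collapse_lcos lcos_m_assoc \<Gamma>_in)

lemma collapse_right: "C \<in> cosets N \<Longrightarrow> h \<in> \<Gamma> \<Longrightarrow> collapse (C #> h) = collapse C #> h"
  by (auto simp: cosets_def collapse_lcos lcos_rcos[OF N] lcos_rcos[OF N'_normal] \<Gamma>_in)

lemma bimod_hom_collapse:
  "bimod_hom G \<Gamma> (free_on (cosets N)) (free_on (cosets N') :: ('a set \<Rightarrow>\<^sub>0 'k::comm_ring_1) set) (push collapse)"
proof -
  have "push collapse (push (\<lambda>C. h <# C) v) = push (\<lambda>C. h <# C) (push collapse v)"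
    "push collapse (push (\<lambda>C. C #> h) v) = push (\<lambda>C. C #> h) (push collapse v)"
    if "h \<in> \<Gamma>" "v \<in> free_on (cosets N)" for h and v :: "'a set \<Rightarrow>\<^sub>0 'k"
    by (rule push_commute[OF that(2)], simp add: collapse_left collapse_right that(1))+
  then show ?thesis unfolding bimod_hom_def push_p_onto by (simp add: additive_push push_scal)
qed

lemma bimod_hom_shift_pow:
  "bimod_hom G \<Gamma> (free_on (cosets N)) (free_on (cosets N) :: ('a set \<Rightarrow>\<^sub>0 'k::comm_ring_1) set) (push (shift ^^ j))"
proof -
  have l: "(shift ^^ j) (h <# C) = h <# (shift ^^ j) C"
    and r: "(shift ^^ j) (C #> h) = (shift ^^ j) C #> h" if "C \<in> cosets N" "h \<in> \<Gamma>" for C h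
    by (induction j) (use that in \<open>auto simp: shift_left shift_right \<alpha>_pow_in\<close>)
  have "push (shift ^^ j) (push (\<lambda>C. h <# C) v) = push (\<lambda>C. h <# C) (push (shift ^^ j) v)"
    "push (shift ^^ j) (push (\<lambda>C. C #> h) v) = push (\<lambda>C. C #> h) (push (shift ^^ j) v)"
    if "h \<in> \<Gamma>" "v \<in> free_on (cosets N)" for h and v :: "'a set \<Rightarrow>\<^sub>0 'k"
    by (rule push_commute[OF that(2)], simp add: l r that(1))+
  moreover have "push (shift ^^ j) v \<in> free_on (cosets N)"
    if "v \<in> free_on (cosets N)" for v :: "'a set \<Rightarrow>\<^sub>0 'k"
    by (rule push_free_on[OF that \<alpha>_pow_in])
  ultimately show ?thesis unfolding bimod_hom_def by (auto simp: additive_push push_scal)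
qed

lemma bimod_hom_minus_shift:
  "bimod_hom G \<Gamma> (free_on (cosets N)) (free_on (cosets N) :: ('a set \<Rightarrow>\<^sub>0 'k::comm_ring_1) set)
     (\<lambda>d. d - push shift d)"
  using bimod_hom_shift_pow[of 1, where 'k = 'k] unfolding bimod_hom_def
  by (auto simp: additive_minus additive_id intro!: minus_free_on)

text \<open>With \<open>s\<close> the right multiplication by \<open>a\<close>, the modules \<open>M' = k[\<Gamma>N'/N']\<close>, \<open>K = (1 - s)M\<close> and
  \<open>K' = ker (1 - s)\<close> are images of good modules with kernels among these three: \<open>M'\<close> and \<open>K\<close> are
  quotients of \<open>M\<close> by \<open>K\<close> and \<open>K'\<close>, while \<open>K'\<close> is \<open>0\<close> if \<open>a\<close> has infinite order modulo \<open>N\<close>, and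
  otherwise the image of the norm map, whose kernel is \<open>K\<close>.\<close>

theorem good_step:
  fixes Good :: "('a set \<Rightarrow>\<^sub>0 'k::comm_ring_1) set \<Rightarrow> bool"
  assumes zero: "Good {0}"
    and resolve: "\<And>\<Q>. (\<And>Q. Q \<in> \<Q> \<Longrightarrow> bimod G \<Gamma> Q \<and> (\<exists>C f. bimod G \<Gamma> C \<and> Good C \<and>
        bimod_hom G \<Gamma> C Q f \<and> f ` C = Q \<and> {v \<in> C. f v = 0} \<in> \<Q>)) \<Longrightarrow> \<forall>Q\<in>\<Q>. Good Q"
    and good: "Good (free_on (cosets N))"
  shows "Good (free_on (cosets N'))"
proof -
  let ?M = "free_on (cosets N) :: ('a set \<Rightarrow>\<^sub>0 'k) set"
  let ?M' = "free_on (cosets N') :: ('a set \<Rightarrow>\<^sub>0 'k) set"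
  let ?K = "shift_im :: ('a set \<Rightarrow>\<^sub>0 'k) set"
  let ?K' = "{c \<in> ?M. c - push shift c = 0}"
  have M: "bimod G \<Gamma> ?M" by (rule bimod_cosets[OF N])
  have M': "bimod G \<Gamma> ?M'" by (rule bimod_cosets[OF N'_normal])
  have K: "bimod G \<Gamma> ?K"
    using bimod_kernel[OF M bimod_hom_collapse] by (simp add: ker_push_p)
  have K': "bimod G \<Gamma> ?K'" by (rule bimod_kernel[OF M bimod_hom_minus_shift])
  have covM': "\<exists>C f. bimod G \<Gamma> C \<and> Good C \<and> bimod_hom G \<Gamma> C ?M' f \<and> f ` C = ?M' \<and>
      {v \<in> C. f v = 0} \<in> {?M', ?K, ?K'}"
    using M good bimod_hom_collapse[where 'k = 'k] push_p_onto[where 'k = 'k] ker_push_p[where 'k = 'k]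
    by blast
  have "bimod_hom G \<Gamma> ?M ?K (\<lambda>d. d - push shift d)"
    by (rule bimod_hom_restrict[OF bimod_hom_minus_shift]) (simp add: shift_im_def)
  moreover have "(\<lambda>d. d - push shift d) ` ?M = ?K" by (simp add: shift_im_def)
  ultimately have covK: "\<exists>C f. bimod G \<Gamma> C \<and> Good C \<and> bimod_hom G \<Gamma> C ?K f \<and> f ` C = ?K \<and>
      {v \<in> C. f v = 0} \<in> {?M', ?K, ?K'}"
    using M good by blast
  have covK': "\<exists>C f. bimod G \<Gamma> C \<and> Good C \<and> bimod_hom G \<Gamma> C ?K' f \<and> f ` C = ?K' \<and>
      {v \<in> C. f v = 0} \<in> {?M', ?K, ?K'}"
  proof (cases "\<exists>m>0. a [^] (m::nat) \<in> N")
    case True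
    define m where "m = (LEAST m::nat. m > 0 \<and> a [^] m \<in> N)"
    have m: "m > 0 \<and> a [^] m \<in> N" unfolding m_def by (rule LeastI_ex) (use True in auto)
    have m_least: "a [^] k \<notin> N" if "0 < k" "k < m" for k :: nat
      using not_less_Least[of k "\<lambda>m. m > 0 \<and> a [^] m \<in> N"] that by (auto simp: m_def)
    \<comment> \<open>The condition on \<open>k\<close> does not involve \<open>g\<close>, so every
      orbit of the translation has length \<open>m\<close>, the order of \<open>a\<close> modulo
      \<open>N\<close>.\<close>
    have pow: "(shift ^^ k) (g <# N) = g <# N \<longleftrightarrow> a [^] k \<in> N" if "g \<in> carrier G" for g and k :: nat
    proof -
      have "(shift ^^ k) (g <# N) = g <# N \<longleftrightarrow> g <# N = (g \<otimes> a [^] k) <# N"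
        using that by (auto simp: shift_pow_lcos)
      then show ?thesis using that a by (simp add: lcos_eq_iff[OF N_sub])
    qed
    interpret fin: finite_orbit_map "cosets N" "cosets N'" shift collapse m
    proof (intro finite_orbit_map.intro orbit_map_axioms finite_orbit_map_axioms.intro)
      show "m > 0" using m by simp
      show "(shift ^^ m) C = C" if "C \<in> cosets N" for C
        using that m pow by (metis cosetsE)
      show "(shift ^^ k) C \<noteq> C" if "C \<in> cosets N" "0 < k" "k < m" for C k
        using that m_least pow by (metis cosetsE)
    qed
    have eq: "fin.norm_map ` ?M = ?K'" by (rule fin.norm_map_image)
    have norm: "bimod_hom G \<Gamma> ?M ?K' fin.norm_map"
    proof (rule bimod_hom_restrict)
      show "bimod_hom G \<Gamma> ?M ?M fin.norm_map"
        using bimod_hom_shift_pow[where 'k = 'k] unfolding bimod_hom_def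
        by (auto simp: fin.additive_norm_map fin.norm_map_free_on)
          (auto simp: fin.norm_map_def)
    qed (use eq in simp)
    then show ?thesis using M good eq fin.ker_norm_map[where 'k = 'k] by blast
  next
    case False
    have "?K' = {0}"
    proof (intro equalityI subsetI)
      fix c assume c: "c \<in> ?K'"
      have "c = 0"
      proof (rule push_\<alpha>_inj_infinite)
        fix C and k :: nat assume "C \<in> cosets N" and k: "k > 0"
        then obtain g where g: "g \<in> carrier G" "C = g <# N" by (meson cosetsE)
        have "a [^] k \<notin> N" using False k by metis
        then have "g <# N \<noteq> (g \<otimes> a [^] k) <# N"
          using g(1) a by (simp add: lcos_eq_iff[OF N_sub])
        then show "(shift ^^ k) C \<noteq> C" using g by (simp add: shift_pow_lcos)
      qed (use c in auto)
      then show "c \<in> {0}" by simp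
    qed simp
    then show ?thesis using bimod_zero bimod_hom_zero zero
      by (intro exI[of _ "{0}"] exI[of _ "\<lambda>_. 0"]) auto
  qed
  have "\<forall>Q\<in>{?M', ?K, ?K'}. Good Q"
    by (rule resolve) (use M' K K' covM' covK covK' in blast)
  then show ?thesis by blast
qed

end

text \<open>The hypothesis \<open>resolve\<close> makes \<open>Good\<close> hold for modules with a
  possibly infinite resolution by good ones: unrolling the condition on \<open>\<Q>\<close> yields a
  cover, then a cover of its kernel, and so on. It is applied with \<open>mr.fp\<close> and with
  \<open>nil_homology\<close> in all degrees as \<open>Good\<close>.\<close>

theorem (in half_space) good_cyc_chain:
  fixes Good :: "('a set \<Rightarrow>\<^sub>0 'k::comm_ring_1) set \<Rightarrow> bool"
  assumes "cyc_chain N"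
    and zero: "Good {0}"
    and resolve: "\<And>\<Q>. (\<And>Q. Q \<in> \<Q> \<Longrightarrow> bimod G \<Gamma> Q \<and> (\<exists>C f. bimod G \<Gamma> C \<and> Good C \<and>
        bimod_hom G \<Gamma> C Q f \<and> f ` C = Q \<and> {v \<in> C. f v = 0} \<in> \<Q>)) \<Longrightarrow> \<forall>Q\<in>\<Q>. Good Q"
    and start: "Good (free_on (cosets {\<one>}))"
  shows "Good (free_on (cosets N))"
  using assms(1)
proof (induction rule: cyc_chain.induct)
  case (step N a)
  have N: "N \<lhd> G" by (rule cyc_chain_normal[OF step(1)])
  show ?case
  proof (cases "a \<in> \<Gamma>")
    case True
    interpret central_step G \<Gamma> N a
      by (intro central_step.intro central_step_axioms.intro half_space_axioms)
        (use True N step in blast)+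
    show ?thesis by (rule good_step[OF zero resolve step.IH])
  next
    case False
    \<comment> \<open>Swapping the commutator puts \<open>a\<close> into the argument that runs
      through a subgroup, the centraliser of \<open>g\<close> modulo \<open>N\<close>, and this
      contains \<open>inv a\<close> along with \<open>a\<close>.\<close>
    have comm: "g \<otimes> inv a \<otimes> inv g \<otimes> inv (inv a) \<in> N" if g: "g \<in> carrier G" for g
    proof -
      have "inv a \<otimes> g \<otimes> inv (inv a) \<otimes> inv g \<in> N"
        using subgroup.m_inv_closed[OF commutator_subgroup[OF N g], of a] commutator_swap[OF N g]
          step g by blast
      then show ?thesis using commutator_swap[OF N _ g] step by blast
    qed
    interpret central_step G \<Gamma> N "inv a"
      by (intro central_step.intro central_step_axioms.intro half_space_axioms)
        (use False N step \<Gamma>_inv comm in blast)+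
    have sub: "N \<subseteq> carrier G" using normal_imp_subgroup[OF N] subgroup.subset by blast
    have "generate G (insert (inv a) N) = generate G (insert a N)"
    proof (rule subset_antisym)
      show "generate G (insert (inv a) N) \<subseteq> generate G (insert a N)"
        by (rule generate_subgroup_incl) (use step sub in \<open>auto intro: generate.incl generate.inv generate_is_subgroup\<close>)
      have "a \<in> generate G (insert (inv a) N)"
        using generate.inv[of "inv a" "insert (inv a) N" G] step by simp
      then show "generate G (insert a N) \<subseteq> generate G (insert (inv a) N)"
        by (intro generate_subgroup_incl) (use step sub in \<open>auto intro: generate.incl generate_is_subgroup\<close>)
    qed
    then show ?thesis using good_step[OF zero resolve step.IH] by simp
  qed
qed (rule start)

section \<open>The bar complex\<close>

definition coef_map :: "('v \<Rightarrow> 'w) \<Rightarrow> ('x \<Rightarrow>\<^sub>0 'v::ab_group_add) \<Rightarrow> ('x \<Rightarrow>\<^sub>0 'w::ab_group_add)" where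
  "coef_map f = lin_ext (\<lambda>x m. single x (f m))"

text \<open>Chains with coefficients in a subset \<open>V\<close> of the type, so that one bar
  boundary serves all submodules.\<close>

definition free_in :: "'x set \<Rightarrow> 'v::zero set \<Rightarrow> ('x \<Rightarrow>\<^sub>0 'v) set" where
  "free_in E V = {c \<in> free_on E. \<forall>x. lookup c x \<in> V}"

lemma free_in_induct [consumes 1, case_names zero single add]:
  fixes c :: "'x \<Rightarrow>\<^sub>0 'v::comm_monoid_add"
  assumes c: "c \<in> free_in E V" and zero: "P 0"
    and s: "\<And>x m. x \<in> E \<Longrightarrow> m \<in> V \<Longrightarrow> P (single x m)"
    and a: "\<And>c d. P c \<Longrightarrow> P d \<Longrightarrow> P (c + d)"
  shows "P c"
proof -
  have "P (\<Sum>x\<in>S. single x (lookup c x))"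
    if "finite S" "S \<subseteq> E" for S
    using that
  proof (induction S)
    case (insert x S)
    then show ?case using c by (simp add: a s free_in_def)
  qed (simp add: zero)
  from this[OF finite_keys[of c]] show ?thesis
    using c by (simp add: free_in_def free_on_def sum_single_lookup)
qed

lemma additive_eq_on_free_in:
  assumes "additive f" "additive g" "c \<in> free_in E V"
    and "\<And>x m. x \<in> E \<Longrightarrow> m \<in> V \<Longrightarrow> f (single x m) = g (single x m)"
  shows "f c = g c"
  using assms(3)
proof (induction rule: free_in_induct)
  case zero
  show ?case using assms(1,2) by (simp add: additive.zero)
next
  case (add c d)
  then show ?case using assms(1,2) by (simp add: additive.add)
qed (use assms in auto)

lemma additive_coef_map: "additive f \<Longrightarrow> additive (coef_map f)"
  unfolding coef_map_def
  by (rule additive_lin_ext) (rule additive_compose[OF additive_single])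

lemma coef_map_single [simp]: "additive f \<Longrightarrow> coef_map f (single x m) = single x (f m)"
  unfolding coef_map_def by (rule lin_ext_single) (simp add: additive.zero)

lemma lookup_coef_map:
  assumes f: "additive f"
  shows "lookup (coef_map f c) x = f (lookup c x)"
proof (rule additive_eq_on_free[where E = UNIV and c = c])
  show "additive (\<lambda>c. lookup (coef_map f c) x)"
    by (rule additive_compose[OF additive_lookup additive_coef_map[OF f]])
  show "additive (\<lambda>c. f (lookup c x))"
    by (rule additive_compose[OF f additive_lookup])
qed (auto simp: free_on_def f lookup_single when_def additive.zero[OF f])

lemma coef_map_coef_map:
  "additive f \<Longrightarrow> additive g \<Longrightarrow> coef_map f (coef_map g c) = coef_map (\<lambda>m. f (g m)) c"
  by (rule poly_mapping_eqI) (simp add: lookup_coef_map additive_compose)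

lemma coef_map_cong:
  assumes "additive f" "additive g" "c \<in> free_in E V" "\<And>m. m \<in> V \<Longrightarrow> f m = g m"
  shows "coef_map f c = coef_map g c"
  using assms(3) by (intro poly_mapping_eqI) (simp add: lookup_coef_map free_in_def assms)

lemma coef_map_free_in:
  assumes "additive f" "c \<in> free_in E V" "\<And>m. m \<in> V \<Longrightarrow> f m \<in> W"
  shows "coef_map f c \<in> free_in E W"
  using assms additive.zero[OF assms(1)]
  by (auto simp: free_in_def free_on_def lookup_coef_map in_keys_iff subset_iff) metis

text \<open>Together with \<open>coef_map_kernel\<close> this is exactness of the chain groups in
  the coefficients, the input for the connecting homomorphism.\<close>

lemma coef_map_lift:
  assumes f: "additive f" "f ` V = W" and V: "0 \<in> V" "\<And>v w. v \<in> V \<Longrightarrow> w \<in> V \<Longrightarrow> v + w \<in> V"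
    and c: "c \<in> free_in E W"
  shows "\<exists>b \<in> free_in E V. coef_map f b = c"
  using c
proof (induction rule: free_in_induct)
  case zero
  show ?case by (rule bexI[of _ 0]) (auto simp: additive.zero[OF additive_coef_map[OF f(1)]] free_in_def V)
next
  case (single x m)
  then obtain v where "v \<in> V" "f v = m" using f by auto
  then show ?case using single f V
    by (intro bexI[of _ "single x v"]) (auto simp: free_in_def lookup_single when_def)
next
  case (add c d)
  then obtain b b' where "b \<in> free_in E V" "coef_map f b = c" "b' \<in> free_in E V" "coef_map f b' = d"
    by auto
  then show ?case using V
    by (intro bexI[of _ "b + b'"]) (auto simp: free_in_def lookup_add additive.add[OF additive_coef_map[OF f(1)]])
qed

lemma coef_map_kernel:
  assumes "additive f" "c \<in> free_in E V" "coef_map f c = 0"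
  shows "c \<in> free_in E {v \<in> V. f v = 0}"
  using assms lookup_coef_map[OF assms(1), of c] by (auto simp: free_in_def)

lemma free_in_minus:
  fixes c d :: "'x \<Rightarrow>\<^sub>0 'v::ab_group_add"
  assumes "c \<in> free_in E V" "d \<in> free_in E V" "\<And>v w. v \<in> V \<Longrightarrow> w \<in> V \<Longrightarrow> v - w \<in> V"
  shows "c - d \<in> free_in E V"
  using assms by (auto simp: free_in_def lookup_minus)

section \<open>Faces of tuples and the simplicial identity\<close>

definition tuples :: "('a, 'b) monoid_scheme \<Rightarrow> nat \<Rightarrow> 'a list set" where
  "tuples G n = {xs. length xs = n \<and> set xs \<subseteq> carrier G}"

lemma bar_chains_eq: "bar_chains G n = free_in (tuples G n) UNIV"
  by (auto simp: bar_chains_def free_in_def free_on_def tuples_def)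

text \<open>Numbers the terms of the boundary uniformly, so that its square can be computed by a
  simplicial identity. Only face 0 touches the coefficient, through \<open>face_act\<close>.\<close>

definition face :: "('a, 'b) monoid_scheme \<Rightarrow> nat \<Rightarrow> 'a list \<Rightarrow> 'a list" where
  "face G i xs = (if i = 0 then tl xs else if i < length xs then bar_merge G i xs else butlast xs)"

definition face_act :: "('a, 'b) monoid_scheme \<Rightarrow> ('a \<Rightarrow> 'v \<Rightarrow> 'v) \<Rightarrow> nat \<Rightarrow> 'a list \<Rightarrow> 'v \<Rightarrow> 'v" where
  "face_act G act i xs m = (if i = 0 then act (inv\<^bsub>G\<^esub> (hd xs)) m else m)"

definition sgn_pow :: "nat \<Rightarrow> 'v \<Rightarrow> 'v::ab_group_add" where
  "sgn_pow i m = (if even i then m else - m)"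

lemma additive_sgn_pow: "additive (sgn_pow i)"
  by (simp add: sgn_pow_def additive_def)

lemma bar_boundary_basis_faces:
  assumes "xs \<noteq> []"
  shows "bar_boundary_basis G act xs m =
    (\<Sum>i\<le>length xs. single (face G i xs) (sgn_pow i (face_act G act i xs m)))"
proof -
  obtain n where n: "length xs = Suc n" using assms by (cases xs) auto
  let ?T = "\<lambda>i. single (face G i xs) (sgn_pow i (face_act G act i xs m))"
  have "(\<Sum>i\<le>length xs. ?T i) = ?T 0 + (\<Sum>i\<in>{1..Suc n}. ?T i)"
  proof -
    have "{..length xs} = insert 0 {1..Suc n}" by (auto simp: n)
    then show ?thesis by (simp only: sum.insert finite_atLeastAtMost) simp
  qed
  also have "(\<Sum>i\<in>{1..Suc n}. ?T i) = (\<Sum>i\<in>{1..<Suc n}. ?T i) + ?T (Suc n)"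
  proof -
    have "{1..Suc n} = insert (Suc n) {1..<Suc n}" by auto
    then show ?thesis by (simp only: sum.insert finite_atLeastLessThan) (simp add: add.commute)
  qed
  also have "(\<Sum>i\<in>{1..<Suc n}. ?T i)
      = (\<Sum>i\<in>{1..<Suc n}. single (bar_merge G i xs) (if even i then m else - m))"
    by (rule sum.cong) (auto simp: face_def face_act_def sgn_pow_def n)
  finally show ?thesis
    using assms by (simp add: bar_boundary_basis_def n face_def face_act_def sgn_pow_def add.assoc)
qed

lemma length_bar_merge: "0 < i \<Longrightarrow> i < length xs \<Longrightarrow> length (bar_merge G i xs) = length xs - 1"
  by (auto simp: bar_merge_def)

lemma length_face: "xs \<noteq> [] \<Longrightarrow> length (face G i xs) = length xs - 1"
  by (auto simp: face_def length_bar_merge)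

lemma nth_bar_merge:
  assumes "0 < i" "i < length xs" "k < length xs - 1"
  shows "bar_merge G i xs ! k =
    (if k < i - 1 then xs ! k else if k = i - 1 then xs ! (i - 1) \<otimes>\<^bsub>G\<^esub> xs ! i else xs ! Suc k)"
  using assms by (auto simp: bar_merge_def nth_append nth_Cons split: nat.split intro!: arg_cong[of _ _ "(!) xs"])

text \<open>One formula for the three kinds of faces turns \<open>face_face\<close> into a
  comparison of entries.\<close>

lemma nth_face:
  assumes "xs \<noteq> []" "i \<le> length xs" "k < length xs - 1"
  shows "face G i xs ! k =
    (if Suc k < i then xs ! k else if Suc k = i then xs ! k \<otimes>\<^bsub>G\<^esub> xs ! Suc k else xs ! Suc k)"
  using assms by (auto simp: face_def nth_bar_merge nth_tl nth_butlast)

context group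
begin

lemma face_tuples:
  assumes "xs \<in> tuples G (Suc n)" "i \<le> Suc n"
  shows "face G i xs \<in> tuples G n"
proof -
  have xs: "length xs = Suc n" "xs \<noteq> []" using assms by (auto simp: tuples_def)
  have nth: "xs ! k \<in> carrier G" if "k < Suc n" for k
    using assms that by (auto simp: tuples_def)
  have "face G i xs ! k \<in> carrier G" if "k < n" for k
    using nth_face[of xs i k G] xs assms(2) that nth[of k] nth[of "Suc k"] by auto
  then show ?thesis
    using length_face[OF xs(2), of G i] xs by (auto simp: tuples_def in_set_conv_nth)
qed

text \<open>Only for \<open>i = j + 1\<close> do the two faces meet in one product, and there the
  identity is associativity.\<close>

lemma face_face:
  assumes xs: "xs \<in> tuples G (Suc (Suc n))" and "j < i" "i \<le> Suc (Suc n)"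
  shows "face G j (face G i xs) = face G (i - 1) (face G j xs)"
proof (rule nth_equalityI)
  have l: "length xs = Suc (Suc n)" "xs \<noteq> []" using xs by (auto simp: tuples_def)
  have ne: "face G i xs \<noteq> []" "face G j xs \<noteq> []"
    using length_face[OF l(2), of G i] length_face[OF l(2), of G j] l by auto
  show "length (face G j (face G i xs)) = length (face G (i - 1) (face G j xs))"
    by (simp add: length_face ne l)
  fix k assume "k < length (face G j (face G i xs))"
  then have k: "k < n" by (simp add: length_face ne l)
  have nth: "xs ! k \<in> carrier G" if "k < Suc (Suc n)" for k
    using xs that by (auto simp: tuples_def)
  have c: "xs ! k \<in> carrier G" "xs ! Suc k \<in> carrier G" "xs ! Suc (Suc k) \<in> carrier G"
    using nth k by auto
  show "face G j (face G i xs) ! k = face G (i - 1) (face G j xs) ! k"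
    using assms k c l by (auto simp: nth_face ne length_face m_assoc)
qed

end

locale bar_coeff = group G for G :: "('a, 'b) monoid_scheme" (structure) +
  fixes act :: "'a \<Rightarrow> 'v \<Rightarrow> 'v::ab_group_add" and V :: "'v set"
  assumes act_additive: "additive (act g)"
    and V_zero: "0 \<in> V"
    and V_add: "v \<in> V \<Longrightarrow> w \<in> V \<Longrightarrow> v + w \<in> V"
    and V_uminus: "v \<in> V \<Longrightarrow> - v \<in> V"
    and act_in: "g \<in> carrier G \<Longrightarrow> v \<in> V \<Longrightarrow> act g v \<in> V"
    and act_mult: "g \<in> carrier G \<Longrightarrow> h \<in> carrier G \<Longrightarrow> v \<in> V \<Longrightarrow> act (g \<otimes> h) v = act g (act h v)"
begin

abbreviation "bd \<equiv> bar_boundary G act"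

definition chains :: "nat \<Rightarrow> ('a list \<Rightarrow>\<^sub>0 'v) set" where
  "chains n = free_in (tuples G n) V"

lemma additive_face_act: "additive (face_act G act i xs)"
  by (cases "i = 0") (simp_all add: face_act_def[abs_def] act_additive additive_id)

lemma additive_basis: "additive (bar_boundary_basis G act xs)"
proof (cases "xs = []")
  case False
  have "additive (\<lambda>m. \<Sum>i\<le>length xs. single (face G i xs) (sgn_pow i (face_act G act i xs m)))"
    by (intro additive_sum additive_compose[OF additive_single] additive_compose[OF additive_sgn_pow]
        additive_face_act)
  moreover have "bar_boundary_basis G act xs
      = (\<lambda>m. \<Sum>i\<le>length xs. single (face G i xs) (sgn_pow i (face_act G act i xs m)))"
    by (rule ext) (rule bar_boundary_basis_faces[OF False])
  ultimately show ?thesis by simp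
qed (simp add: bar_boundary_basis_def additive_def)

lemma boundary_lin_ext: "bd = lin_ext (bar_boundary_basis G act)"
  by (simp add: fun_eq_iff bar_boundary_def lin_ext_def)

lemma additive_boundary: "additive bd"
  unfolding boundary_lin_ext by (rule additive_lin_ext) (rule additive_basis)

lemma boundary_single: "bd (single xs m) = bar_boundary_basis G act xs m"
  unfolding boundary_lin_ext by (rule lin_ext_single) (rule additive.zero[OF additive_basis])

lemma boundary_single_faces:
  "xs \<in> tuples G (Suc n) \<Longrightarrow> bd (single xs m) =
    (\<Sum>i\<le>Suc n. single (face G i xs) (sgn_pow i (face_act G act i xs m)))"
proof -
  assume "xs \<in> tuples G (Suc n)"
  then have "length xs = Suc n" "xs \<noteq> []" by (auto simp: tuples_def)
  then show ?thesis using bar_boundary_basis_faces[OF \<open>xs \<noteq> []\<close>, of G act m]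
    by (simp only: boundary_single)
qed

lemma face_act_in: "xs \<in> tuples G (Suc n) \<Longrightarrow> m \<in> V \<Longrightarrow> face_act G act i xs m \<in> V"
  by (cases xs) (auto simp: face_act_def tuples_def intro: act_in)

lemma sgn_pow_in: "m \<in> V \<Longrightarrow> sgn_pow i m \<in> V"
  by (auto simp: sgn_pow_def V_uminus)

lemma chains_zero: "0 \<in> chains n"
  by (simp add: chains_def free_in_def V_zero)

lemma chains_add: "c \<in> chains n \<Longrightarrow> d \<in> chains n \<Longrightarrow> c + d \<in> chains n"
  by (simp add: chains_def free_in_def V_add lookup_add)

lemma chains_single: "xs \<in> tuples G n \<Longrightarrow> m \<in> V \<Longrightarrow> single xs m \<in> chains n"
  by (simp add: chains_def free_in_def lookup_single when_def V_zero)

lemma chains_sum: "(\<And>i. i \<in> I \<Longrightarrow> f i \<in> chains n) \<Longrightarrow> sum f I \<in> chains n"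
  by (induction I rule: infinite_finite_induct) (auto simp: chains_zero chains_add)

lemma boundary_chains: "c \<in> chains (Suc n) \<Longrightarrow> bd c \<in> chains n"
  unfolding chains_def[of "Suc n"]
proof (induction rule: free_in_induct)
  case zero
  show ?case by (simp add: additive.zero[OF additive_boundary] chains_zero)
next
  case (single xs m)
  then show ?case
    by (simp only: boundary_single_faces)
      (intro chains_sum chains_single face_tuples sgn_pow_in face_act_in; simp)
next
  case (add c d)
  then show ?case by (simp add: additive.add[OF additive_boundary] chains_add)
qed

lemma boundary_chains_0: "c \<in> chains 0 \<Longrightarrow> bd c = 0"
  unfolding chains_def
proof (induction rule: free_in_induct)
  case (single xs m)
  then show ?case by (simp add: boundary_single tuples_def bar_boundary_basis_def)
qed (auto simp: additive.zero[OF additive_boundary] additive.add[OF additive_boundary])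

text \<open>The coefficient part of the simplicial identity. The case with content is
  \<open>j = 0\<close>, \<open>i = 1\<close>, where \<open>inv (x \<otimes> y)\<close> acts as
  \<open>inv y\<close> after \<open>inv x\<close>.\<close>

lemma face_act_face_act:
  assumes xs: "xs \<in> tuples G (Suc (Suc n))" and "j < i" "i \<le> Suc (Suc n)" "m \<in> V"
  shows "face_act G act j (face G i xs) (face_act G act i xs m)
    = face_act G act (i - 1) (face G j xs) (face_act G act j xs m)"
proof (cases "j = 0")
  case True
  obtain x y ys where xy: "xs = x # y # ys" using xs
    by (auto simp: tuples_def length_Suc_conv)
  then have c: "x \<in> carrier G" "y \<in> carrier G" using xs by (auto simp: tuples_def)
  show ?thesis
  proof (cases "i = 1")
    case True
    then have "face G i xs = (x \<otimes> y) # ys" by (simp add: face_def xy bar_merge_def)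
    then show ?thesis
      using True \<open>j = 0\<close> c assms(4) act_mult[of "inv y" "inv x" m]
      by (simp add: face_act_def face_def xy inv_mult_group)
  next
    case False
    have "face G i xs \<noteq> []" using length_face[of xs G i] by (auto simp: xy)
    then have "hd (face G i xs) = face G i xs ! 0" by (rule hd_conv_nth)
    also have "\<dots> = x"
      using False assms(2,3) \<open>j = 0\<close> nth_face[of xs i 0 G] by (simp add: xy)
        (use xs in \<open>auto simp: tuples_def xy\<close>)
    finally have "hd (face G i xs) = x" .
    then show ?thesis using False assms(2) \<open>j = 0\<close> by (simp add: face_act_def xy)
  qed
qed (use assms in \<open>auto simp: face_act_def\<close>)

lemma boundary_boundary: "c \<in> chains n \<Longrightarrow> bd (bd c) = 0"
\<comment> \<open>Degrees 0 and 1 are treated apart because the expansion into faces is available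
  only for non-empty tuples.\<close>
proof (cases n)
  case 0
  then show "c \<in> chains n \<Longrightarrow> bd (bd c) = 0"
    by (simp add: boundary_chains_0 additive.zero[OF additive_boundary])
next
  case (Suc n')
  assume c: "c \<in> chains n"
  show ?thesis
  proof (cases n')
    case 0
    then show ?thesis using c Suc boundary_chains boundary_chains_0 by simp
  next
    case (Suc k)
    then have "c \<in> free_in (tuples G (Suc (Suc k))) V" using c \<open>n = Suc n'\<close> by (simp add: chains_def)
    then show ?thesis
    proof (induction rule: free_in_induct)
      case (single xs m)
      define T where "T = (\<lambda>(i, j). single (face G j (face G i xs))
        (sgn_pow (i + j) (face_act G act j (face G i xs) (face_act G act i xs m))))"
      have sgn: "sgn_pow j (face_act G act l ys (sgn_pow i v)) = sgn_pow (i + j) (face_act G act l ys v)"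
        for i j l ys v
        by (auto simp: sgn_pow_def face_act_def additive.minus[OF act_additive])
      have "bd (bd (single xs m))
          = (\<Sum>i\<le>Suc (Suc k). bd (single (face G i xs) (sgn_pow i (face_act G act i xs m))))"
        by (simp only: boundary_single_faces[OF single(1)] additive.sum[OF additive_boundary])
      also have "\<dots> = (\<Sum>i\<le>Suc (Suc k). \<Sum>j\<le>Suc k. T (i, j))"
        by (rule sum.cong[OF refl])
          (simp only: boundary_single_faces[OF face_tuples[OF single(1)]] atMost_iff T_def sgn prod.case)
      also have "\<dots> = (\<Sum>p\<in>{..Suc (Suc k)} \<times> {..Suc k}. T p)"
        by (simp only: sum.cartesian_product case_prod_eta)
      also have "\<dots> = (\<Sum>p\<in>{(i, j). i \<le> Suc (Suc k) \<and> j < i}. T p) + (\<Sum>p\<in>{(i, j). j \<le> Suc k \<and> i \<le> j}. T p)"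
      proof (subst sum.union_disjoint[symmetric])
        have "{..Suc (Suc k)} \<times> {..Suc k}
            = {(i, j). i \<le> Suc (Suc k) \<and> j < i} \<union> {(i, j). j \<le> Suc k \<and> i \<le> j}" by auto
        then show "(\<Sum>p\<in>{..Suc (Suc k)} \<times> {..Suc k}. T p)
            = (\<Sum>p\<in>{(i, j). i \<le> Suc (Suc k) \<and> j < i} \<union> {(i, j). j \<le> Suc k \<and> i \<le> j}. T p)"
          by (rule arg_cong)
        show "finite {(i, j). i \<le> Suc (Suc k) \<and> j < i}"
          by (rule finite_subset[of _ "{..Suc (Suc k)} \<times> {..Suc k}"]) auto
        show "finite {(i, j). j \<le> Suc k \<and> i \<le> j}"
          by (rule finite_subset[of _ "{..Suc (Suc k)} \<times> {..Suc k}"]) auto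
      qed auto
      also have "(\<Sum>p\<in>{(i, j). i \<le> Suc (Suc k) \<and> j < i}. T p)
          = (\<Sum>p\<in>{(i, j). j \<le> Suc k \<and> i \<le> j}. - T p)"
      \<comment> \<open>The term \<open>(i, j)\<close> with \<open>j < i\<close> cancels the term
        \<open>(j, i - 1)\<close>: the faces agree and the signs are opposite.\<close>
      proof (rule sum.reindex_bij_witness[where j = "\<lambda>(i, j). (j, i - 1)" and i = "\<lambda>(i, j). (Suc j, i)"])
        fix p assume "p \<in> {(i, j). i \<le> Suc (Suc k) \<and> j < i}"
        then obtain i j where p: "p = (i, j)" "i \<le> Suc (Suc k)" "j < i" by auto
        have "sgn_pow (i + j) v = - sgn_pow (j + (i - 1)) v" for v :: 'v
          using p(3) by (auto simp: sgn_pow_def)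
        then have "T (i, j) = - T (j, i - 1)"
          unfolding T_def prod.case face_face[OF single(1) p(3,2)]
            face_act_face_act[OF single(1) p(3,2) single(2)]
          by (simp only: single_uminus)
        then show "- T (case p of (i, j) \<Rightarrow> (j, i - 1)) = T p" by (simp add: p(1))
      qed auto
      finally show ?case by (simp add: sum_negf)
    qed (auto simp: additive.zero[OF additive_boundary] additive.add[OF additive_boundary])
  qed
qed

lemma boundary_natural:
  assumes f: "additive f" and act': "\<And>g. additive (act' g)"
    and eq: "\<And>g v. g \<in> carrier G \<Longrightarrow> v \<in> V \<Longrightarrow> f (act g v) = act' g (f v)"
    and c: "c \<in> chains n"
  shows "bar_boundary G act' (coef_map f c) = coef_map f (bd c)"
proof -
  \<comment> \<open>The zero module satisfies the axioms for any additive action, and additivity of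
    the boundary and its expansion into faces hold on all formal sums.\<close>
  interpret B': bar_coeff G act' "{0}"
    by unfold_locales (auto simp: additive.add[OF act'] additive.zero[OF act'])
  note ad = additive.zero[OF B'.additive_boundary] additive.add[OF B'.additive_boundary]
    additive.zero[OF additive_boundary] additive.add[OF additive_boundary]
    additive.zero[OF additive_coef_map[OF f]] additive.add[OF additive_coef_map[OF f]]
  from c show ?thesis
    unfolding chains_def
  proof (induction rule: free_in_induct)
    case (single xs m)
    show ?case
    proof (cases n)
      case 0
      then show ?thesis using single f
        by (simp add: boundary_single B'.boundary_single tuples_def bar_boundary_basis_def ad)
    next
      case (Suc k)
      then have xs: "xs \<in> tuples G (Suc k)" using single by simp
      have "f (sgn_pow i (face_act G act i xs m)) = sgn_pow i (face_act G act' i xs (f m))" for i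
        using xs single(2) eq[of "inv (hd xs)" m]
        by (cases xs) (auto simp: sgn_pow_def face_act_def additive.minus[OF f] tuples_def)
      then show ?thesis
        by (simp only: boundary_single_faces[OF xs] B'.boundary_single_faces[OF xs]
            coef_map_single[OF f] additive.sum[OF additive_coef_map[OF f]])
    qed
  qed (auto simp: ad)
qed

end

section \<open>Vanishing of homology with non-trivial rank one coefficients\<close>

text \<open>One power of \<open>\<theta>\<close> kills all of \<open>H_n(G, V)\<close>; phrased with
  cycles and boundaries, it needs no quotient group.\<close>

definition nil_homology ::
  "('a, 'b) monoid_scheme \<Rightarrow> ('a \<Rightarrow> 'v \<Rightarrow> 'v) \<Rightarrow> ('v \<Rightarrow> 'v) \<Rightarrow> nat \<Rightarrow> 'v::ab_group_add set \<Rightarrow> bool" where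
  "nil_homology G act \<theta> n V \<longleftrightarrow> (\<exists>K. \<forall>c \<in> free_in (tuples G n) V. bar_boundary G act c = 0 \<longrightarrow>
     coef_map (\<theta> ^^ K) c \<in> bar_boundary G act ` free_in (tuples G (Suc n)) V)"

lemma additive_funpow: "additive (\<theta> :: 'v::ab_group_add \<Rightarrow> 'v) \<Longrightarrow> additive (\<theta> ^^ K)"
  by (induction K) (auto simp: additive_def)

lemma free_in_mono: "V \<subseteq> W \<Longrightarrow> c \<in> free_in E V \<Longrightarrow> c \<in> free_in E W"
  by (auto simp: free_in_def)

lemma funpow_in: "\<theta> ` V \<subseteq> V \<Longrightarrow> v \<in> V \<Longrightarrow> (\<theta> ^^ K) v \<in> V"
  by (induction K) auto

text \<open>Comes from the piece \<open>H_n(B) \<rightarrow> H_n(C) \<rightarrow> H_(n-1)(A)\<close>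
  of the long exact sequence, \<open>A\<close> being the kernel of \<open>p\<close>: if
  \<open>\<theta>^L\<close> kills the left end and \<open>\<theta>^K\<close> the right end, then
  \<open>\<theta>^(L+K)\<close> kills the middle. The proof chases one cycle.\<close>

lemma nil_homology_quotient:
  fixes G :: "('a, 'b) monoid_scheme" and act :: "'a \<Rightarrow> 'v \<Rightarrow> 'v::ab_group_add"
  assumes B: "bar_coeff G act B" and Cc: "bar_coeff G act C"
    and \<theta>: "additive \<theta>" "\<theta> ` B \<subseteq> B" "\<theta> ` C \<subseteq> C"
    and \<theta>_act: "\<And>g v. g \<in> carrier G \<Longrightarrow> v \<in> B \<union> C \<Longrightarrow> \<theta> (act g v) = act g (\<theta> v)"
    and p: "additive p" "p ` B = C"
    and p_act: "\<And>g v. g \<in> carrier G \<Longrightarrow> v \<in> B \<Longrightarrow> p (act g v) = act g (p v)"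
    and p_\<theta>: "\<And>v. v \<in> B \<Longrightarrow> p (\<theta> v) = \<theta> (p v)"
    and nilB: "nil_homology G act \<theta> n B"
    and nilA: "\<And>m. n = Suc m \<Longrightarrow> nil_homology G act \<theta> m {v \<in> B. p v = 0}"
  shows "nil_homology G act \<theta> n C"
proof -
  interpret B: bar_coeff G act B by fact
  interpret C: bar_coeff G act C by fact
  let ?A = "{v \<in> B. p v = 0}"
  let ?bd = "bar_boundary G act"
  note ad\<theta> = additive_funpow[OF \<theta>(1)]
  have pow_act: "(\<theta> ^^ K) (act g v) = act g ((\<theta> ^^ K) v)"
    if "g \<in> carrier G" "v \<in> V" "V = B \<or> V = C" for K g v V
    by (induction K) (use that \<theta>_act funpow_in[of \<theta> V v] \<theta> in auto)
  have p_pow: "p ((\<theta> ^^ K) v) = (\<theta> ^^ K) (p v)" if "v \<in> B" for K v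
    by (induction K) (use that p_\<theta> funpow_in[OF \<theta>(2)] in auto)
  have natB: "?bd (coef_map (\<theta> ^^ K) c) = coef_map (\<theta> ^^ K) (?bd c)" if "c \<in> free_in (tuples G k) B" for K k c
    by (rule B.boundary_natural[OF ad\<theta> B.act_additive pow_act]) (use that in \<open>auto simp: B.chains_def\<close>)
  have nat_p: "?bd (coef_map p c) = coef_map p (?bd c)" if "c \<in> free_in (tuples G k) B" for k c
    by (rule B.boundary_natural[OF p(1) B.act_additive p_act]) (use that in \<open>auto simp: B.chains_def\<close>)
  have p_pow_map: "coef_map p (coef_map (\<theta> ^^ K) c) = coef_map (\<theta> ^^ K) (coef_map p c)"
    if "c \<in> free_in E B" for K c and E :: "'a list set"
    unfolding coef_map_coef_map[OF p(1) ad\<theta>] coef_map_coef_map[OF ad\<theta> p(1)]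
    by (rule coef_map_cong[OF _ _ that]) (auto intro: additive_compose p(1) ad\<theta> p_pow)
  have powB: "coef_map (\<theta> ^^ K) c \<in> free_in E B" if "c \<in> free_in E B" for K c and E :: "'a list set"
    by (rule coef_map_free_in[OF ad\<theta> that funpow_in[OF \<theta>(2)]])
  have \<theta>\<theta>: "coef_map (\<theta> ^^ L) (coef_map (\<theta> ^^ K) c) = coef_map (\<theta> ^^ (L + K)) c" for L K and c :: "'a list \<Rightarrow>\<^sub>0 'v"
    by (simp add: coef_map_coef_map ad\<theta> funpow_add comp_def)
  obtain L where L: "\<And>e. e \<in> free_in (tuples G n) B \<Longrightarrow> ?bd e = 0 \<Longrightarrow>
      coef_map (\<theta> ^^ L) e \<in> ?bd ` free_in (tuples G (Suc n)) B"
    using nilB by (auto simp: nil_homology_def)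
  \<comment> \<open>If \<open>b\<close> lifts a cycle of \<open>C\<close>, its boundary is a cycle
    of the kernel, representing the connecting image. In degree 0 it is 0 and exponent 0
    works.\<close>
  obtain K where K: "\<And>b. b \<in> free_in (tuples G n) B \<Longrightarrow> coef_map p (?bd b) = 0 \<Longrightarrow>
      \<exists>a \<in> free_in (tuples G n) ?A. coef_map (\<theta> ^^ K) (?bd b) = ?bd a"
  proof (cases n)
    case 0
    have "\<exists>a \<in> free_in (tuples G n) ?A. coef_map (\<theta> ^^ 0) (?bd b) = ?bd a"
      if "b \<in> free_in (tuples G n) B" for b
    proof (rule bexI)
      have "?bd b = 0" using that B.boundary_chains_0 by (simp add: 0 B.chains_def)
      then show "coef_map (\<theta> ^^ 0) (?bd b) = ?bd 0"
        by (simp add: additive.zero[OF additive_coef_map[OF ad\<theta>[of 0, simplified]]]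
            additive.zero[OF B.additive_boundary] additive.zero[OF additive_coef_map] additive_def id_def)
      show "0 \<in> free_in (tuples G n) ?A"
        by (simp add: free_in_def B.V_zero additive.zero[OF p(1)])
    qed
    then show thesis using that by blast
  next
    case (Suc m)
    obtain K where K: "\<And>c. c \<in> free_in (tuples G m) ?A \<Longrightarrow> ?bd c = 0 \<Longrightarrow>
        coef_map (\<theta> ^^ K) c \<in> ?bd ` free_in (tuples G (Suc m)) ?A"
      using nilA[OF Suc] by (auto simp: nil_homology_def)
    show thesis
    proof (rule that[of K])
      fix b assume b: "b \<in> free_in (tuples G n) B" "coef_map p (?bd b) = 0"
      have "?bd b \<in> free_in (tuples G m) B"
        using B.boundary_chains[of b m] b Suc by (simp add: B.chains_def)
      then have "?bd b \<in> free_in (tuples G m) ?A" by (rule coef_map_kernel[OF p(1) _ b(2)])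
      moreover have "?bd (?bd b) = 0" using B.boundary_boundary[of b n] b by (simp add: B.chains_def)
      ultimately show "\<exists>a \<in> free_in (tuples G n) ?A. coef_map (\<theta> ^^ K) (?bd b) = ?bd a"
        using K[of "?bd b"] Suc by auto
    qed
  qed
  have "coef_map (\<theta> ^^ (L + K)) c \<in> ?bd ` free_in (tuples G (Suc n)) C"
    if c: "c \<in> free_in (tuples G n) C" "?bd c = 0" for c
  proof -
    obtain b where b: "b \<in> free_in (tuples G n) B" "coef_map p b = c"
      using coef_map_lift[OF p B.V_zero B.V_add c(1)] by blast
    have "coef_map p (?bd b) = 0" using nat_p[OF b(1)] b c by simp
    then obtain a where a: "a \<in> free_in (tuples G n) ?A" "coef_map (\<theta> ^^ K) (?bd b) = ?bd a"
      using K b(1) by blast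
    have aB: "a \<in> free_in (tuples G n) B" by (rule free_in_mono[OF _ a(1)]) auto
    \<comment> \<open>Subtracting \<open>a\<close> turns \<open>\<theta>^K b\<close> into a cycle of
      \<open>B\<close> that still lifts \<open>\<theta>^K c\<close>.\<close>
    let ?e = "coef_map (\<theta> ^^ K) b - a"
    have e: "?e \<in> free_in (tuples G n) B"
      by (rule free_in_minus[OF powB[OF b(1)] aB]) (metis B.V_add B.V_uminus diff_conv_add_uminus)
    have "?bd ?e = 0"
      by (simp add: additive.diff[OF B.additive_boundary] natB[OF b(1)] a(2))
    then obtain b' where b': "b' \<in> free_in (tuples G (Suc n)) B" "coef_map (\<theta> ^^ L) ?e = ?bd b'"
      using L[OF e] by blast
    have pa: "coef_map p a = 0"
      by (rule poly_mapping_eqI) (use a in \<open>auto simp: lookup_coef_map[OF p(1)] free_in_def\<close>)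
    have "?bd (coef_map p b') = coef_map p (coef_map (\<theta> ^^ L) ?e)"
      using nat_p[OF b'(1)] b'(2) by simp
    also have "\<dots> = coef_map (\<theta> ^^ L) (coef_map p ?e)" by (rule p_pow_map[OF e])
    also have "coef_map p ?e = coef_map (\<theta> ^^ K) c"
      by (simp add: additive.diff[OF additive_coef_map[OF p(1)]] p_pow_map[OF b(1)] b(2) pa)
    finally have "coef_map (\<theta> ^^ (L + K)) c = ?bd (coef_map p b')" by (simp add: \<theta>\<theta>)
    moreover have "coef_map p b' \<in> free_in (tuples G (Suc n)) C"
      by (rule coef_map_free_in[OF p(1) b'(1)]) (use p in auto)
    ultimately show ?thesis by blast
  qed
  then show ?thesis unfolding nil_homology_def by blast
qed

locale rank_one = group G for G :: "('a, 'b) monoid_scheme" (structure) +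
  fixes \<rho> :: "'a \<Rightarrow> complex" and h :: 'a
  assumes \<rho>_nz: "g \<in> carrier G \<Longrightarrow> \<rho> g \<noteq> 0"
    and \<rho>_mult: "g \<in> carrier G \<Longrightarrow> g' \<in> carrier G \<Longrightarrow> \<rho> (g \<otimes> g') = \<rho> g * \<rho> g'"
    and h: "h \<in> carrier G"
begin

sublocale half_space G "carrier G"
  by unfold_locales auto

text \<open>The diagonal action on \<open>\<complex>\<^sub>\<rho> \<otimes> V\<close>.\<close>

definition twist :: "'a \<Rightarrow> ('a set \<Rightarrow>\<^sub>0 complex) \<Rightarrow> ('a set \<Rightarrow>\<^sub>0 complex)" where
  "twist g v = scal (\<rho> g) (push (\<lambda>C. g <# C) v)"

text \<open>Right translation by \<open>h\<close> commutes with the diagonal left action and with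
  every \<open>bimod_hom\<close>. The subtracted scalar is its eigenvalue on \<open>H_0\<close> of
  the regular module.\<close>

definition \<theta> :: "('a set \<Rightarrow>\<^sub>0 complex) \<Rightarrow> ('a set \<Rightarrow>\<^sub>0 complex)" where
  "\<theta> v = push (\<lambda>C. C #> h) v - scal (inverse (\<rho> h)) v"

lemma additive_twist: "additive (twist g)"
  unfolding twist_def by (rule additive_compose[OF additive_scal additive_push])

lemma additive_\<theta>: "additive \<theta>"
  unfolding \<theta>_def by (rule additive_minus[OF additive_push additive_scal])

lemma \<rho>_one: "\<rho> \<one> = 1"
  using \<rho>_mult[of \<one> \<one>] \<rho>_nz[of \<one>] by simp

lemma \<rho>_inv: "g \<in> carrier G \<Longrightarrow> \<rho> (inv g) = inverse (\<rho> g)"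
  using \<rho>_mult[of g "inv g"] \<rho>_one inverse_unique[of "\<rho> g" "\<rho> (inv g)"] by simp

lemma bar_coeff_bimod:
  assumes "bimod G (carrier G) V"
  shows "bar_coeff G twist V"
proof (intro bar_coeff.intro bar_coeff_axioms.intro)
  show "group G" by (rule is_group)
  show "- v \<in> V" if "v \<in> V" for v by (rule bimod_uminus[OF assms that])
  show "twist (g \<otimes> g') v = twist g (twist g' v)"
    if "g \<in> carrier G" "g' \<in> carrier G" "v \<in> V" for g g' v
  proof -
    have v: "v \<in> free_on (Pow (carrier G))" using assms that by (auto simp: bimod_def)
    have "push (\<lambda>C. (g \<otimes> g') <# C) v = push (\<lambda>C. g <# (g' <# C)) v"
      by (rule push_cong[OF v]) (use that in \<open>simp add: lcos_m_assoc\<close>)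
    then show ?thesis using that by (simp add: twist_def push_scal scal_scal push_push \<rho>_mult)
  qed
qed (use assms in \<open>auto simp: bimod_def additive_twist twist_def\<close>)

lemma \<theta>_bimod: "bimod G (carrier G) V \<Longrightarrow> \<theta> ` V \<subseteq> V"
  using h by (auto simp: \<theta>_def intro!: bimod_minus) (auto simp: bimod_def)

lemma \<theta>_twist:
  assumes "bimod G (carrier G) V" "g \<in> carrier G" "v \<in> V"
  shows "\<theta> (twist g v) = twist g (\<theta> v)"
proof -
  have v: "v \<in> free_on (Pow (carrier G))" using assms by (auto simp: bimod_def)
  have "push (\<lambda>C. C #> h) (push (\<lambda>C. g <# C) v) = push (\<lambda>C. g <# C) (push (\<lambda>C. C #> h) v)"
  proof (rule push_commute[OF v])
    fix C assume "C \<in> Pow (carrier G)"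
    then show "(g <# C) #> h = g <# (C #> h)"
      using assms(2) h by (auto simp: l_coset_def r_coset_def m_assoc subset_iff)
  qed
  then show ?thesis
    by (simp add: \<theta>_def twist_def push_scal scal_scal mult.commute)
qed

text \<open>Dimension shifting: degree \<open>n\<close> of \<open>Q\<close> is controlled by degree
  \<open>n\<close> of the good module \<open>C\<close> and degree \<open>n - 1\<close> of the
  kernel, which lies in \<open>\<Q>\<close> again. The falling degree ends the induction although
  the resolution need not end.\<close>

lemma nil_homology_resolve:
  assumes \<Q>: "\<And>Q. Q \<in> \<Q> \<Longrightarrow> bimod G (carrier G) Q \<and> (\<exists>C f. bimod G (carrier G) C \<and>
      (\<forall>n. nil_homology G twist \<theta> n C) \<and> bimod_hom G (carrier G) C Q f \<and> f ` C = Q \<and> {v \<in> C. f v = 0} \<in> \<Q>)"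
    and Q: "Q \<in> \<Q>"
  shows "nil_homology G twist \<theta> n Q"
  using Q
proof (induction n arbitrary: Q rule: less_induct)
  case (less n)
  obtain C f where *: "bimod G (carrier G) Q" "bimod G (carrier G) C" "\<forall>n. nil_homology G twist \<theta> n C"
    "bimod_hom G (carrier G) C Q f" "f ` C = Q" "{v \<in> C. f v = 0} \<in> \<Q>"
    using \<Q>[OF less.prems] by blast
  have f: "additive f" using * by (simp add: bimod_hom_def)
  show ?case
  proof (rule nil_homology_quotient[where B = C and p = f])
    show "bar_coeff G twist C" "bar_coeff G twist Q" using * bar_coeff_bimod by auto
    show "\<theta> ` C \<subseteq> C" "\<theta> ` Q \<subseteq> Q" using * \<theta>_bimod by auto
    show "\<theta> (twist g v) = twist g (\<theta> v)" if "g \<in> carrier G" "v \<in> C \<union> Q" for g v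
      using that * \<theta>_twist by blast
    show "f (twist g v) = twist g (f v)" if "g \<in> carrier G" "v \<in> C" for g v
      using that *(2,4) by (simp add: twist_def bimod_hom_def bimod_def)
    show "f (\<theta> v) = \<theta> (f v)" if "v \<in> C" for v
      using that *(2,4) h by (simp add: \<theta>_def additive.diff[OF f] bimod_hom_def bimod_def)
    show "nil_homology G twist \<theta> m {v \<in> C. f v = 0}" if "n = Suc m" for m
      using less.IH[of m] that *(6) by simp
  qed (use * f additive_\<theta> in auto)
qed

lemma nil_homology_zero: "nil_homology G twist \<theta> n {0}"
  unfolding nil_homology_def
proof (intro exI ballI impI)
  interpret B: bar_coeff G twist "{0}" by (rule bar_coeff_bimod[OF bimod_zero])
  fix c :: "'a list \<Rightarrow>\<^sub>0 ('a set \<Rightarrow>\<^sub>0 complex)" assume "c \<in> free_in (tuples G n) {0}"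
  then have "c = 0" by (intro poly_mapping_eqI) (auto simp: free_in_def)
  then show "coef_map (\<theta> ^^ 0) c \<in> bar_boundary G twist ` free_in (tuples G (Suc n)) {0}"
    by (intro image_eqI[where x = 0])
      (auto simp: additive.zero[OF B.additive_boundary] free_in_def
        additive.zero[OF additive_coef_map[OF additive_funpow[OF additive_\<theta>, of 0]]] simp del: funpow.simps)
qed

text \<open>The module \<open>\<complex>[G] \<otimes> \<complex>\<^sub>\<rho>\<close> is induced from the trivial subgroup; this is the resulting contraction of
  its bar complex.\<close>

definition contraction :: "('a list \<Rightarrow>\<^sub>0 ('a set \<Rightarrow>\<^sub>0 complex)) \<Rightarrow> ('a list \<Rightarrow>\<^sub>0 ('a set \<Rightarrow>\<^sub>0 complex))" where
  "contraction = lin_ext (\<lambda>xs. lin_ext (\<lambda>C k.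
     single (inv (the_elem C) # xs) (single {\<one>} (k * inverse (\<rho> (the_elem C))))))"

lemma additive_contraction_basis: "additive (lin_ext (\<lambda>C k.
     single (inv (the_elem C) # xs)
       (single {\<one>} (k * inverse (\<rho> (the_elem C))))))"
  by (rule additive_lin_ext) (simp add: additive_def distrib_right single_add)

lemma additive_contraction: "additive contraction"
  unfolding contraction_def by (rule additive_lin_ext) (rule additive_contraction_basis)

lemma contraction_single:
  "contraction (single xs (single {g} k))
    = single (inv g # xs) (single {\<one>} (k * inverse (\<rho> g)))"
  unfolding contraction_def
  by (subst lin_ext_single, rule additive.zero[OF additive_contraction_basis], subst lin_ext_single) auto

section \<open>The homology of the regular module\<close>

abbreviation "reg \<equiv> free_on (cosets {\<one>})"

lemma cosets_one: "cosets {\<one>} = (\<lambda>g. {g}) ` carrier G"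
  unfolding cosets_def by (rule image_cong) (auto simp: l_coset_def)

lemma reg_bimod: "bimod G (carrier G) reg"
  by (rule bimod_cosets[OF one_is_normal])

lemma additive_eq_on_reg_chains:
  fixes f f' :: "('x \<Rightarrow>\<^sub>0 ('a set \<Rightarrow>\<^sub>0 complex)) \<Rightarrow> 'm::ab_group_add"
  assumes "additive f" "additive f'" "c \<in> free_in E reg"
    and "\<And>x g k. x \<in> E \<Longrightarrow> g \<in> carrier G \<Longrightarrow>
      f (single x (single {g} k)) = f' (single x (single {g} k))"
  shows "f c = f' c"
proof (rule additive_eq_on_free_in[OF assms(1-3)])
  fix x and m :: "'a set \<Rightarrow>\<^sub>0 complex" assume x: "x \<in> E" and m: "m \<in> reg"
  show "f (single x m) = f' (single x m)"
    by (rule additive_eq_on_free[OF additive_compose[OF assms(1) additive_single]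
          additive_compose[OF assms(2) additive_single] m])
      (use assms(4) x cosets_one in auto)
qed

lemma twist_single: "g \<in> carrier G \<Longrightarrow> x \<in> carrier G \<Longrightarrow>
    twist g (single {x} k) = single {g \<otimes> x} (\<rho> g * k)"
  by (simp add: twist_def l_coset_def)

lemma contraction_chains:
  assumes "c \<in> free_in (tuples G n) reg"
  shows "contraction c \<in> free_in (tuples G (Suc n)) reg"
proof -
  interpret B: bar_coeff G twist reg by (rule bar_coeff_bimod[OF reg_bimod])
  from assms show ?thesis
  proof (induction rule: free_in_induct)
    case zero
    then show ?case using B.chains_zero by (simp add: additive.zero[OF additive_contraction] B.chains_def)
  next
    case (single xs m)
    have "contraction (single xs m) \<in> B.chains (Suc n)"
      using single(2)
    proof (induction rule: free_on_induct)
      case zero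
      then show ?case by (simp add: additive.zero[OF additive_contraction] B.chains_zero)
    next
      case (single C k)
      then obtain g where g: "g \<in> carrier G" "C = {g}" by (auto simp: cosets_one)
      show ?case
        unfolding g(2) contraction_single
        by (rule B.chains_single) (use g \<open>xs \<in> tuples G n\<close> in \<open>auto simp: tuples_def cosets_one\<close>)
    next
      case (add c d)
      then show ?case
        by (simp add: single_add additive.add[OF additive_contraction] B.chains_add)
    qed
    then show ?case by (simp add: B.chains_def)
  next
    case (add c d)
    then show ?case using B.chains_add by (simp add: additive.add[OF additive_contraction] B.chains_def)
  qed
qed

text \<open>Face 0 of the contracted tuple restores the original term, and face \<open>Suc i\<close>
  cancels against the contraction of face \<open>i\<close>.\<close>

lemma contraction_homotopy:
  assumes "c \<in> free_in (tuples G (Suc n)) reg"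
  shows "bar_boundary G twist (contraction c) + contraction (bar_boundary G twist c) = c"
proof -
  interpret B: bar_coeff G twist reg by (rule bar_coeff_bimod[OF reg_bimod])
  note ad = B.additive_boundary additive_contraction
  show ?thesis
  proof (rule additive_eq_on_reg_chains[OF _ additive_id assms])
    show "additive (\<lambda>c. bar_boundary G twist (contraction c) + contraction (bar_boundary G twist c))"
      by (simp add: additive_def additive.add[OF ad(1)] additive.add[OF ad(2)])
    fix xs g k assume xs: "xs \<in> tuples G (Suc n)" and g: "g \<in> carrier G"
    obtain x ys where xy: "xs = x # ys" using xs by (cases xs) (auto simp: tuples_def)
    have x: "x \<in> carrier G" and len: "length xs = Suc n" using xs by (auto simp: tuples_def xy)
    have gx: "inv g # xs \<in> tuples G (Suc (Suc n))" using xs g by (auto simp: tuples_def)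
    define w where "w = single {\<one>} (k * inverse (\<rho> g))"
    define v where "v = single {g} k"
    define T where "T i = single (face G (Suc i) (inv g # xs)) (sgn_pow (Suc i) w)" for i
    have "bar_boundary G twist (contraction (single xs v))
        = (\<Sum>i\<le>Suc (Suc n). single (face G i (inv g # xs))
            (sgn_pow i (face_act G twist i (inv g # xs) w)))"
      unfolding v_def contraction_single w_def[symmetric] by (rule B.boundary_single_faces[OF gx])
    also have "\<dots> = single xs (twist g w) + (\<Sum>i\<le>Suc n. T i)"
      using g by (subst sum.atMost_Suc_shift)
        (simp add: face_def[of _ 0] face_act_def sgn_pow_def[of 0] T_def del: sum.atMost_Suc)
    also have "twist g w = v"
      using g \<rho>_nz[OF g] by (simp add: w_def v_def twist_single field_simps)
    finally have 1: "bar_boundary G twist (contraction (single xs v))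
        = single xs v + (\<Sum>i\<le>Suc n. T i)" .
    have T: "contraction (single (face G i xs) (sgn_pow i (face_act G twist i xs v))) = - T i"
      if "i \<le> Suc n" for i
    proof (cases "i = 0")
      case True
      \<comment> \<open>Face 1 of the contracted tuple merges \<open>inv g\<close> with
        \<open>x\<close>; the result is the inverse of \<open>inv x \<otimes> g\<close>, the point
        to which face 0 of \<open>xs\<close> moves \<open>g\<close>.\<close>
      have "contraction (single ys (single {inv x \<otimes> g} (\<rho> (inv x) * k)))
          = single ((inv g \<otimes> x) # ys) w"
        using x g \<rho>_nz[OF x] \<rho>_nz[OF g]
        by (simp add: contraction_single w_def inv_mult_group \<rho>_mult \<rho>_inv field_simps)
      then show ?thesis
        using True x g by (simp add: xy T_def v_def face_def face_act_def sgn_pow_def twist_single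
            bar_merge_def single_uminus)
    next
      case False
      have f: "inv g # face G i xs = face G (Suc i) (inv g # xs)"
      proof (cases "i < Suc n")
        case True
        then obtain j where "i = Suc j" using False by (cases i) auto
        then show ?thesis using True len by (simp add: face_def bar_merge_def)
      next
        case False
        then show ?thesis using \<open>i \<noteq> 0\<close> len by (simp add: face_def xy)
      qed
      have s: "sgn_pow i v = single {g} (sgn_pow i k)"
        by (simp add: sgn_pow_def v_def single_uminus)
      have "contraction (single (face G i xs) (sgn_pow i v))
          = single (face G (Suc i) (inv g # xs)) (single {\<one>} (sgn_pow i k * inverse (\<rho> g)))"
        unfolding s contraction_single f ..
      also have "single {\<one>} (sgn_pow i k * inverse (\<rho> g)) = - sgn_pow (Suc i) w"
        by (simp add: sgn_pow_def w_def single_uminus)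
      finally show ?thesis using False by (simp add: face_act_def T_def single_uminus)
    qed
    have "contraction (bar_boundary G twist (single xs v))
        = (\<Sum>i\<le>Suc n. contraction (single (face G i xs) (sgn_pow i (face_act G twist i xs v))))"
      by (simp only: B.boundary_single_faces[OF xs] additive.sum[OF additive_contraction])
    also have "\<dots> = (\<Sum>i\<le>Suc n. - T i)"
      by (rule sum.cong) (use T in auto)
    finally show "bar_boundary G twist (contraction (single xs (single {g} k)))
        + contraction (bar_boundary G twist (single xs (single {g} k)))
        = single xs (single {g} k)"
      using 1 by (simp add: sum_negf v_def del: sum.atMost_Suc)
  qed
qed

text \<open>In degree 0 the homotopy leaves an error: the boundary of the contraction of a point
  \<open>x\<close> is \<open>x\<close> minus \<open>\<rho>(x)\<inverse>\<close> times the point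
  \<open>\<one>\<close>. The errors of the two terms of \<open>\<theta>\<close> agree because
  \<open>\<rho>(g h)\<inverse> = \<rho>(h)\<inverse> \<rho>(g)\<inverse>\<close>.\<close>

lemma contraction_degree_zero:
  assumes c: "c \<in> free_in (tuples G 0) reg"
  shows "bar_boundary G twist (contraction (coef_map \<theta> c)) = coef_map \<theta> c"
proof -
  interpret B: bar_coeff G twist reg by (rule bar_coeff_bimod[OF reg_bimod])
  show ?thesis
  proof (rule additive_eq_on_reg_chains[OF _ _ c])
    show "additive (\<lambda>c. bar_boundary G twist (contraction (coef_map \<theta> c)))"
      by (intro additive_compose[OF B.additive_boundary] additive_compose[OF additive_contraction]
          additive_coef_map additive_\<theta>)
    show "additive (coef_map \<theta>)" by (rule additive_coef_map[OF additive_\<theta>])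
    fix xs g k assume "xs \<in> tuples G 0" and g: "g \<in> carrier G"
    then have xs: "xs = []" by (auto simp: tuples_def)
    have bc: "bar_boundary G twist (contraction (single [] (single {x} l)))
        = single [] (single {x} l)
          - single [] (single {\<one>} (l * inverse (\<rho> x)))"
      if "x \<in> carrier G" for x l
      using that \<rho>_nz[OF that]
      by (simp add: contraction_single B.boundary_single bar_boundary_basis_def twist_single single_uminus
          field_simps)
    have t: "\<theta> (single {g} k)
        = single {g \<otimes> h} k - single {g} (inverse (\<rho> h) * k)"
      by (simp add: \<theta>_def r_coset_def)
    have "single ([] :: 'a list) (single {\<one>} (k * inverse (\<rho> (g \<otimes> h))))
        = single [] (single {\<one>} (inverse (\<rho> h) * k * inverse (\<rho> g)))"
      using \<rho>_mult[OF g h] by (simp add: mult.assoc mult.commute mult.left_commute)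
    then show "bar_boundary G twist (contraction (coef_map \<theta> (single xs (single {g} k))))
        = coef_map \<theta> (single xs (single {g} k))"
      unfolding xs coef_map_single[OF additive_\<theta>] t single_diff additive.diff[OF additive_contraction]
        additive.diff[OF B.additive_boundary]
      using g h by (simp only: bc m_closed) simp
  qed
qed

text \<open>Degree 0 takes one factor \<open>\<theta>\<close>; in positive degrees the regular
  module is acyclic and exponent 0 works.\<close>

lemma nil_homology_reg: "nil_homology G twist \<theta> n reg"
proof (cases n)
  case 0
  have "coef_map (\<theta> ^^ 1) c \<in> bar_boundary G twist ` free_in (tuples G (Suc n)) reg"
    if "c \<in> free_in (tuples G n) reg" for c
  proof (rule image_eqI)
    show "coef_map (\<theta> ^^ 1) c = bar_boundary G twist (contraction (coef_map \<theta> c))"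
      using contraction_degree_zero that 0 by simp
    show "contraction (coef_map \<theta> c) \<in> free_in (tuples G (Suc n)) reg"
      by (intro contraction_chains coef_map_free_in[OF additive_\<theta> that]) (use \<theta>_bimod[OF reg_bimod] in auto)
  qed
  then show ?thesis unfolding nil_homology_def by blast
next
  case (Suc m)
  have "coef_map (\<theta> ^^ 0) c \<in> bar_boundary G twist ` free_in (tuples G (Suc n)) reg"
    if c: "c \<in> free_in (tuples G n) reg" "bar_boundary G twist c = 0" for c
  proof (rule image_eqI)
    have "coef_map (\<theta> ^^ 0) c = c"
      by (rule poly_mapping_eqI) (simp add: lookup_coef_map additive_def)
    then show "coef_map (\<theta> ^^ 0) c = bar_boundary G twist (contraction c)"
      using contraction_homotopy[of c m] c Suc by (simp add: additive.zero[OF additive_contraction])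
  qed (rule contraction_chains[OF c(1)])
  then show ?thesis unfolding nil_homology_def by blast
qed

text \<open>At the end of the chain the module is \<open>\<complex>\<^sub>\<rho>\<close>, where \<open>\<theta>\<close> is multiplication by \<open>1 - \<rho>(h)\<inverse>\<close>: it is
  both invertible and nilpotent on homology.\<close>

lemma bar_acyclic:
  assumes chain: "cyc_chain (carrier G)" and nt: "\<rho> h \<noteq> 1"
    and c: "c \<in> bar_chains G n" "bar_boundary G (\<lambda>g m. \<rho> g * m) c = 0"
  shows "c \<in> bar_boundary G (\<lambda>g m. \<rho> g * m) ` bar_chains G (Suc n)"
proof -
  have "\<forall>n. nil_homology G twist \<theta> n (free_on (cosets (carrier G)))"
    by (rule good_cyc_chain[OF chain, where Good = "\<lambda>V. \<forall>n. nil_homology G twist \<theta> n V"])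
      (use nil_homology_zero nil_homology_resolve nil_homology_reg in blast)+
  then obtain K where K: "\<And>c. c \<in> free_in (tuples G n) (free_on {carrier G}) \<Longrightarrow> bar_boundary G twist c = 0 \<Longrightarrow>
      coef_map (\<theta> ^^ K) c \<in> bar_boundary G twist ` free_in (tuples G (Suc n)) (free_on {carrier G})"
    unfolding nil_homology_def cosets_carrier by blast
  let ?act = "\<lambda>g m. \<rho> g * m"
  interpret A: bar_coeff G ?act UNIV
    by unfold_locales (auto simp: distrib_left \<rho>_mult mult.assoc)
  interpret B: bar_coeff G twist "free_on {carrier G}"
    using bar_coeff_bimod[OF bimod_cosets[OF normal_self]] by (simp add: cosets_carrier)
  \<comment> \<open>\<open>\<iota>\<close> and \<open>\<pi>\<close> identify
    \<open>\<complex>\<^sub>\<rho>\<close> with the module on the single coset \<open>G\<close>. The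
    cycle is sent there, becomes a boundary under \<open>\<theta> ^^ K\<close>, and is brought back,
    where \<open>\<theta> ^^ K\<close> is the scalar \<open>q ^ K\<close>.\<close>
  define \<iota> :: "complex \<Rightarrow> 'a set \<Rightarrow>\<^sub>0 complex" where "\<iota> = single (carrier G)"
  define \<pi> :: "('a set \<Rightarrow>\<^sub>0 complex) \<Rightarrow> complex" where "\<pi> v = lookup v (carrier G)" for v
  define q where "q = 1 - inverse (\<rho> h)"
  have ad: "additive \<iota>" "additive \<pi>"
    unfolding \<iota>_def \<pi>_def by (rule additive_single) (rule additive_lookup)
  have pt': "g <# carrier G = carrier G" "carrier G #> g = carrier G" if "g \<in> carrier G" for g
    using lcos_carrier[OF that] normal.coset_eq[OF normal_self] that by auto
  have \<iota>_act: "\<iota> (\<rho> g * m) = twist g (\<iota> m)" if "g \<in> carrier G" for g m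
    using that by (simp add: \<iota>_def twist_def pt')
  have \<pi>_act: "\<pi> (twist g v) = \<rho> g * \<pi> v" if "g \<in> carrier G" "v \<in> free_on {carrier G}" for g v
  proof (rule additive_eq_on_free[OF _ _ that(2)])
    show "additive (\<lambda>v. \<pi> (twist g v))" by (rule additive_compose[OF ad(2) additive_twist])
    show "additive (\<lambda>v. \<rho> g * \<pi> v)" by (rule additive_compose[OF additive_mult ad(2)])
  qed (use that in \<open>auto simp: \<pi>_def twist_def pt'\<close>)
  have \<theta>\<iota>: "(\<theta> ^^ K) (\<iota> m) = \<iota> (q ^ K * m)" for K m
  proof (induction K)
    case (Suc K)
    have "\<theta> (\<iota> m) = \<iota> (q * m)" for m
      using h by (simp add: \<theta>_def \<iota>_def pt' q_def left_diff_distrib single_diff)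
    then show ?case using Suc by (simp add: mult.assoc)
  qed simp
  have q: "q \<noteq> 0" using nt \<rho>_nz[OF h] by (auto simp: q_def)
  have cU: "c \<in> free_in (tuples G n) UNIV" using c by (simp add: bar_chains_eq)
  have "bar_boundary G twist (coef_map \<iota> c) = coef_map \<iota> (bar_boundary G ?act c)"
    by (rule A.boundary_natural[OF ad(1) additive_twist \<iota>_act]) (use cU in \<open>auto simp: A.chains_def\<close>)
  then have "bar_boundary G twist (coef_map \<iota> c) = 0"
    by (simp add: c additive.zero[OF additive_coef_map[OF ad(1)]])
  moreover have "coef_map \<iota> c \<in> free_in (tuples G n) (free_on {carrier G})"
    by (rule coef_map_free_in[OF ad(1) cU]) (simp add: \<iota>_def)
  ultimately obtain d where d: "d \<in> free_in (tuples G (Suc n)) (free_on {carrier G})"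
    "coef_map (\<theta> ^^ K) (coef_map \<iota> c) = bar_boundary G twist d"
    using K by blast
  have "bar_boundary G ?act (coef_map \<pi> d) = coef_map \<pi> (bar_boundary G twist d)"
    by (rule B.boundary_natural[OF ad(2) additive_mult \<pi>_act]) (use d in \<open>auto simp: B.chains_def\<close>)
  also have "\<dots> = coef_map (\<lambda>m. q ^ K * m) c"
    unfolding d(2)[symmetric]
    by (rule poly_mapping_eqI)
      (simp add: lookup_coef_map ad additive_funpow[OF additive_\<theta>] additive_mult \<theta>\<iota> \<pi>_def,
        simp add: \<iota>_def)
  finally have qd: "bar_boundary G ?act (coef_map \<pi> d) = coef_map (\<lambda>m. q ^ K * m) c" .
  \<comment> \<open>Division by \<open>q ^ K\<close> commutes with the boundary, so \<open>c\<close>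
    itself is a boundary.\<close>
  let ?r = "\<lambda>m::complex. inverse (q ^ K) * m"
  have \<pi>d: "coef_map \<pi> d \<in> free_in (tuples G (Suc n)) UNIV"
    by (rule coef_map_free_in[OF ad(2) d(1)]) simp
  have "bar_boundary G ?act (coef_map ?r (coef_map \<pi> d)) = coef_map ?r (bar_boundary G ?act (coef_map \<pi> d))"
    by (rule A.boundary_natural[OF additive_mult additive_mult]) (use \<pi>d in \<open>auto simp: A.chains_def\<close>)
  also have "\<dots> = c"
    unfolding qd by (rule poly_mapping_eqI) (use q in \<open>simp add: lookup_coef_map additive_mult\<close>)
  finally have "c = bar_boundary G ?act (coef_map ?r (coef_map \<pi> d))" by simp
  moreover have "coef_map ?r (coef_map \<pi> d) \<in> bar_chains G (Suc n)"
    unfolding bar_chains_eq by (rule coef_map_free_in[OF additive_mult \<pi>d]) simp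
  ultimately show ?thesis by blast
qed

end

section \<open>Modules with a resolution by finitely generated free modules\<close>

text \<open>A ring on a subset of a type whose addition is that of the type, as for the monoid ring
  of a half space: sums are then ordinary ones. The passage to records is postponed to
  \<open>base_ring\<close>.\<close>

locale car_ring =
  fixes A :: "'r::ab_group_add set" and mul :: "'r \<Rightarrow> 'r \<Rightarrow> 'r" (infixl "\<star>" 70) and e :: 'r
  assumes A_zero: "0 \<in> A" and A_add: "a \<in> A \<Longrightarrow> b \<in> A \<Longrightarrow> a + b \<in> A"
    and A_uminus: "a \<in> A \<Longrightarrow> - a \<in> A"
    and A_mul: "a \<in> A \<Longrightarrow> b \<in> A \<Longrightarrow> a \<star> b \<in> A" and A_one: "e \<in> A"
    and mul_add_left: "a \<in> A \<Longrightarrow> b \<in> A \<Longrightarrow> c \<in> A \<Longrightarrow> (a + b) \<star> c = a \<star> c + b \<star> c"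
    and mul_add_right: "a \<in> A \<Longrightarrow> b \<in> A \<Longrightarrow> c \<in> A \<Longrightarrow> a \<star> (b + c) = a \<star> b + a \<star> c"
    and mul_assoc: "a \<in> A \<Longrightarrow> b \<in> A \<Longrightarrow> c \<in> A \<Longrightarrow> a \<star> b \<star> c = a \<star> (b \<star> c)"
    and mul_one_left: "a \<in> A \<Longrightarrow> e \<star> a = a" and mul_one_right: "a \<in> A \<Longrightarrow> a \<star> e = a"
begin

definition is_mod :: "('r \<Rightarrow> 'm \<Rightarrow> 'm) \<Rightarrow> 'm::ab_group_add set \<Rightarrow> bool" where
  "is_mod sm V \<longleftrightarrow> 0 \<in> V \<and> (\<forall>v\<in>V. \<forall>w\<in>V. v + w \<in> V) \<and> (\<forall>v\<in>V. - v \<in> V) \<and>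
     (\<forall>a\<in>A. \<forall>v\<in>V. sm a v \<in> V) \<and>
     (\<forall>a\<in>A. \<forall>b\<in>A. \<forall>v\<in>V. sm (a + b) v = sm a v + sm b v \<and> sm (a \<star> b) v = sm a (sm b v)) \<and>
     (\<forall>a\<in>A. \<forall>v\<in>V. \<forall>w\<in>V. sm a (v + w) = sm a v + sm a w) \<and> (\<forall>v\<in>V. sm e v = v)"

definition lin :: "('r \<Rightarrow> 'm \<Rightarrow> 'm) \<Rightarrow> 'm::ab_group_add set \<Rightarrow> ('r \<Rightarrow> 'n \<Rightarrow> 'n) \<Rightarrow> 'n::ab_group_add set \<Rightarrow>
    ('m \<Rightarrow> 'n) \<Rightarrow> bool" where
  "lin sm V sm' W f \<longleftrightarrow> (\<forall>v\<in>V. f v \<in> W) \<and> (\<forall>v\<in>V. \<forall>w\<in>V. f (v + w) = f v + f w) \<and>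
     (\<forall>a\<in>A. \<forall>v\<in>V. f (sm a v) = sm' a (f v))"

text \<open>All finite ranks share one type, the one on which \<open>type_FP\<close> wants its
  resolutions; padding by 0 makes \<open>free k\<close> a subset of
  \<open>free (k + l)\<close>.\<close>

definition free :: "nat \<Rightarrow> (nat \<Rightarrow> 'r) set" where
  "free k = {x. (\<forall>i. x i \<in> A) \<and> (\<forall>i\<ge>k. x i = 0)}"

definition fsm :: "'r \<Rightarrow> (nat \<Rightarrow> 'r) \<Rightarrow> (nat \<Rightarrow> 'r)" where
  "fsm a x = (\<lambda>i. a \<star> x i)"

definition unit_vec :: "nat \<Rightarrow> nat \<Rightarrow> 'r" where
  "unit_vec i = (\<lambda>j. if j = i then e else 0)"

lemma is_modD:
  assumes "is_mod sm V"
  shows "0 \<in> V" "v \<in> V \<Longrightarrow> w \<in> V \<Longrightarrow> v + w \<in> V" "v \<in> V \<Longrightarrow> - v \<in> V"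
    "v \<in> V \<Longrightarrow> w \<in> V \<Longrightarrow> v - w \<in> V"
    "a \<in> A \<Longrightarrow> v \<in> V \<Longrightarrow> sm a v \<in> V"
    "a \<in> A \<Longrightarrow> b \<in> A \<Longrightarrow> v \<in> V \<Longrightarrow> sm (a + b) v = sm a v + sm b v"
    "a \<in> A \<Longrightarrow> b \<in> A \<Longrightarrow> v \<in> V \<Longrightarrow> sm (a \<star> b) v = sm a (sm b v)"
    "a \<in> A \<Longrightarrow> v \<in> V \<Longrightarrow> w \<in> V \<Longrightarrow> sm a (v + w) = sm a v + sm a w"
    "v \<in> V \<Longrightarrow> sm e v = v"
proof -
  show "v - w \<in> V" if "v \<in> V" "w \<in> V"
    using assms that unfolding is_mod_def diff_conv_add_uminus[of v w] by blast
qed (use assms in \<open>auto simp: is_mod_def\<close>)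

lemma is_mod_sum: "is_mod sm V \<Longrightarrow> (\<And>i. i \<in> I \<Longrightarrow> f i \<in> V) \<Longrightarrow> sum f I \<in> V"
  by (induction I rule: infinite_finite_induct) (auto simp: is_modD)

lemma sm_zero: "is_mod sm V \<Longrightarrow> a \<in> A \<Longrightarrow> sm a 0 = 0"
  using is_modD(8)[of sm V a 0 0] is_modD(1)[of sm V] by simp

lemma linD:
  assumes "lin sm V sm' W f"
  shows "v \<in> V \<Longrightarrow> f v \<in> W" "v \<in> V \<Longrightarrow> w \<in> V \<Longrightarrow> f (v + w) = f v + f w"
    "a \<in> A \<Longrightarrow> v \<in> V \<Longrightarrow> f (sm a v) = sm' a (f v)"
  using assms by (auto simp: lin_def)

lemma lin_zero: "lin sm V sm' W f \<Longrightarrow> is_mod sm V \<Longrightarrow> f 0 = 0"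
  using linD(2)[of sm V sm' W f 0 0] is_modD(1)[of sm V] by simp

lemma lin_uminus: "lin sm V sm' W f \<Longrightarrow> is_mod sm V \<Longrightarrow> v \<in> V \<Longrightarrow> f (- v) = - f v"
  using linD(2)[of sm V sm' W f v "- v"] is_modD(3)[of sm V v] lin_zero[of sm V sm' W f]
  by (simp add: eq_neg_iff_add_eq_0 add.commute)

lemma lin_diff: "lin sm V sm' W f \<Longrightarrow> is_mod sm V \<Longrightarrow> v \<in> V \<Longrightarrow> w \<in> V \<Longrightarrow> f (v - w) = f v - f w"
  using linD(2)[of sm V sm' W f v "- w"] is_modD(3)[of sm V w] lin_uminus[of sm V sm' W f w] by simp

lemma lin_sum:
  assumes "lin sm V sm' W f" "is_mod sm V"
  shows "(\<And>i. i \<in> I \<Longrightarrow> g i \<in> V) \<Longrightarrow> f (sum g I) = (\<Sum>i\<in>I. f (g i))"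
proof (induction I rule: infinite_finite_induct)
  case (insert x F)
  then show ?case using linD(2)[OF assms(1)] is_mod_sum[OF assms(2), of F g] by simp
qed (auto simp: lin_zero[OF assms])

lemma is_mod_kernel:
  assumes f: "lin sm V sm' W f" and V: "is_mod sm V" and W: "is_mod sm' W"
  shows "is_mod sm {v \<in> V. f v = 0}"
  unfolding is_mod_def
  using is_modD[OF V] linD[OF f] lin_zero[OF f V] lin_uminus[OF f V] sm_zero[OF W] by simp

lemma lin_subset: "lin sm V sm' W f \<Longrightarrow> U \<subseteq> V \<Longrightarrow> (\<And>v. v \<in> U \<Longrightarrow> f v \<in> W') \<Longrightarrow> lin sm U sm' W' f"
  by (auto simp: lin_def subset_iff)

lemma lin_compose: "lin sm U sm' V f \<Longrightarrow> lin sm' V sm'' W g \<Longrightarrow> lin sm U sm'' W (\<lambda>x. g (f x))"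
  by (auto simp: lin_def)

section \<open>Free modules of finite rank\<close>

lemma mul_zero: "a \<in> A \<Longrightarrow> a \<star> 0 = 0"
  using mul_add_right[of a 0 0] A_zero by simp

lemma free_mod: "is_mod fsm (free k)"
  unfolding is_mod_def free_def fsm_def
  by (auto simp: A_zero A_add A_uminus A_mul mul_zero mul_add_left mul_add_right mul_assoc mul_one_left fun_eq_iff)

lemma free_in: "x \<in> free k \<Longrightarrow> x i \<in> A"
  by (simp add: free_def)

lemma unit_vec_free: "i < k \<Longrightarrow> unit_vec i \<in> free k"
  by (auto simp: unit_vec_def free_def A_zero A_one)

lemma free_expand: "x \<in> free k \<Longrightarrow> x = (\<Sum>i<k. fsm (x i) (unit_vec i))"
proof
  fix j assume x: "x \<in> free k"
  have app: "(\<Sum>i\<in>I. f i) j = (\<Sum>i\<in>I. f i j)" for f :: "nat \<Rightarrow> nat \<Rightarrow> 'r" and I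
    by (induction I rule: infinite_finite_induct) auto
  have "(\<Sum>i<k. fsm (x i) (unit_vec i)) j = (\<Sum>i<k. if i = j then x j else 0)"
    unfolding app
    by (rule sum.cong) (use free_in[OF x] in \<open>auto simp: fsm_def unit_vec_def mul_one_right mul_zero\<close>)
  also have "\<dots> = x j" using x by (auto simp: free_def)
  finally show "x j = (\<Sum>i<k. fsm (x i) (unit_vec i)) j" by simp
qed

lemma lin_free_expand:
  assumes "lin fsm (free k) sm V f" "x \<in> free k"
  shows "f x = (\<Sum>i<k. sm (x i) (f (unit_vec i)))"
proof -
  have "f x = f (\<Sum>i<k. fsm (x i) (unit_vec i))" using free_expand[OF assms(2)] by simp
  also have "\<dots> = (\<Sum>i<k. f (fsm (x i) (unit_vec i)))"
    by (rule lin_sum[OF assms(1) free_mod])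
      (simp add: is_modD(5)[OF free_mod] unit_vec_free free_in[OF assms(2)])
  finally show ?thesis
    by (simp add: linD(3)[OF assms(1)] unit_vec_free free_in[OF assms(2)])
qed

lemma free_universal:
  assumes V: "is_mod sm V" and m: "\<And>i. i < k \<Longrightarrow> m i \<in> V"
  shows "lin fsm (free k) sm V (\<lambda>x. \<Sum>i<k. sm (x i) (m i))"
proof -
  have "(\<Sum>i<k. sm (x i) (m i)) \<in> V" if "x \<in> free k" for x
    by (rule is_mod_sum[OF V]) (simp add: is_modD(5)[OF V] free_in[OF that] m)
  moreover have "(\<Sum>i<k. sm ((x + y) i) (m i)) = (\<Sum>i<k. sm (x i) (m i)) + (\<Sum>i<k. sm (y i) (m i))"
    if "x \<in> free k" "y \<in> free k" for x y
    by (simp add: sum.distrib[symmetric] is_modD(6)[OF V] free_in[OF that(1)] free_in[OF that(2)] m)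
  moreover have "(\<Sum>i<k. sm (fsm a x i) (m i)) = sm a (\<Sum>i<k. sm (x i) (m i))"
    if "a \<in> A" "x \<in> free k" for a x
  proof -
    have "sm a (sum f I) = (\<Sum>i\<in>I. sm a (f i))" if "\<And>i. i \<in> I \<Longrightarrow> f i \<in> V" for f and I :: "nat set"
      using that
      by (induction I rule: infinite_finite_induct)
        (auto simp: sm_zero[OF V] is_modD(8)[OF V] is_mod_sum[OF V] \<open>a \<in> A\<close>)
    from this[of "{..<k}"] have "sm a (\<Sum>i<k. sm (x i) (m i)) = (\<Sum>i<k. sm a (sm (x i) (m i)))"
      by (simp add: is_modD(5)[OF V] free_in[OF that(2)] m)
    then show ?thesis using that by (simp add: fsm_def is_modD(7)[OF V] free_in m)
  qed
  ultimately show ?thesis by (simp add: lin_def)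
qed

lemma free_lift:
  assumes V: "is_mod sm V" and p: "lin sm V sm' W p" "p ` V = W" and f: "lin fsm (free k) sm' W f"
  shows "\<exists>g. lin fsm (free k) sm V g \<and> (\<forall>x\<in>free k. p (g x) = f x)"
proof -
  have "\<exists>m. i < k \<longrightarrow> m \<in> V \<and> p m = f (unit_vec i)" for i
    using p(2) linD(1)[OF f, of "unit_vec i"] unit_vec_free[of i k] by force
  then obtain m where m: "\<And>i. i < k \<Longrightarrow> m i \<in> V \<and> p (m i) = f (unit_vec i)" by metis
  have "p (\<Sum>i<k. sm (x i) (m i)) = f x" if x: "x \<in> free k" for x
  proof -
    have "p (\<Sum>i<k. sm (x i) (m i)) = (\<Sum>i<k. p (sm (x i) (m i)))"
      by (rule lin_sum[OF p(1) V]) (simp add: is_modD(5)[OF V] free_in[OF x] m)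
    also have "\<dots> = (\<Sum>i<k. sm' (x i) (f (unit_vec i)))"
      by (rule sum.cong) (simp_all add: linD(3)[OF p(1)] free_in[OF x] m)
    finally show ?thesis using lin_free_expand[OF f x] by simp
  qed
  then show ?thesis using free_universal[OF V, of k m] m by blast
qed

text \<open>Coinductively: \<open>K\<close> has an infinite resolution by finitely generated free modules.\<close>

coinductive fp_kernel :: "(nat \<Rightarrow> 'r) set \<Rightarrow> bool" where
  "is_mod fsm K \<Longrightarrow> lin fsm (free k) fsm K f \<Longrightarrow> f ` free k = K \<Longrightarrow>
    fp_kernel {x \<in> free k. f x = 0} \<Longrightarrow> fp_kernel K"

text \<open>\<open>V\<close> may live on any type, but its syzygies are submodules of some
  \<open>free k\<close>; the coinductive part is confined to these, where the type stays
  fixed.\<close>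

definition fp :: "('r \<Rightarrow> 'm \<Rightarrow> 'm) \<Rightarrow> 'm::ab_group_add set \<Rightarrow> bool" where
  "fp sm V \<longleftrightarrow> is_mod sm V \<and> (\<exists>k f. lin fsm (free k) sm V f \<and> f ` free k = V \<and>
     fp_kernel {x \<in> free k. f x = 0})"

lemma fp_kernel_iff: "fp_kernel K \<longleftrightarrow> fp fsm K"
  unfolding fp_def by (subst fp_kernel.simps) auto

text \<open>One storey of the horseshoe lemma: the cover of the quotient is lifted to
  \<open>V\<close> and added to the cover of the kernel. The kernel of the sum is an extension of
  \<open>ker f2\<close> by \<open>ker f1\<close>, which is what the coinductions below feed
  on.\<close>

lemma horseshoe:
  assumes V: "is_mod sm V" and W: "is_mod sm' W" and p: "lin sm V sm' W p" "p ` V = W"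
    and f1: "lin fsm (free k) sm {v \<in> V. p v = 0} f1" "f1 ` free k = {v \<in> V. p v = 0}"
    and f2: "lin fsm (free l) sm' W f2" "f2 ` free l = W"
  shows "\<exists>\<phi> q. lin fsm (free (k + l)) sm V \<phi> \<and> \<phi> ` free (k + l) = V \<and>
    lin fsm {x \<in> free (k + l). \<phi> x = 0} fsm {y \<in> free l. f2 y = 0} q \<and>
    q ` {x \<in> free (k + l). \<phi> x = 0} = {y \<in> free l. f2 y = 0} \<and>
    {x \<in> {x \<in> free (k + l). \<phi> x = 0}. q x = 0} = {x \<in> free k. f1 x = 0}"
proof -
  obtain g where g: "lin fsm (free l) sm V g" "\<And>y. y \<in> free l \<Longrightarrow> p (g y) = f2 y"
    using free_lift[OF V p f2(1)] by blast
  \<comment> \<open>The first \<open>k\<close> and the last \<open>l\<close> coordinates;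
    \<open>j\<close> below puts them together again.\<close>
  define t :: "(nat \<Rightarrow> 'r) \<Rightarrow> nat \<Rightarrow> 'r" where "t x = (\<lambda>i. if i < k then x i else 0)" for x
  define q :: "(nat \<Rightarrow> 'r) \<Rightarrow> nat \<Rightarrow> 'r" where "q x = (\<lambda>i. x (i + k))" for x
  define \<phi> where "\<phi> x = f1 (t x) + g (q x)" for x
  define j :: "(nat \<Rightarrow> 'r) \<Rightarrow> (nat \<Rightarrow> 'r) \<Rightarrow> nat \<Rightarrow> 'r"
    where "j x y = (\<lambda>i. if i < k then x i else y (i - k))" for x y
  have t: "lin fsm (free (k + l)) fsm (free k) t"
    unfolding lin_def t_def free_def fsm_def by (auto simp: A_zero mul_zero fun_eq_iff)
  have q: "lin fsm (free (k + l)) fsm (free l) q"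
    unfolding lin_def q_def free_def fsm_def by (auto simp: fun_eq_iff)
  have f1V: "lin fsm (free k) sm V f1"
    using f1(1) by (auto simp: lin_def)
  have f1p: "p (f1 x) = 0" if "x \<in> free k" for x using f1(2) that by auto
  have \<phi>: "lin fsm (free (k + l)) sm V \<phi>"
    using lin_compose[OF t f1V] lin_compose[OF q g(1)] is_modD[OF V]
    by (simp add: lin_def \<phi>_def)
  have j: "j x y \<in> free (k + l)" "t (j x y) = x" "q (j x y) = y" if "x \<in> free k" "y \<in> free l" for x y
    using that by (auto simp: j_def t_def q_def free_def fun_eq_iff)
  have p\<phi>: "p (\<phi> x) = f2 (q x)" if "x \<in> free (k + l)" for x
    using that linD(2)[OF p(1)] linD(1)[OF f1V] linD(1)[OF g(1)] linD(1)[OF t] linD(1)[OF q]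
    by (simp add: \<phi>_def f1p g(2))
  \<comment> \<open>Used twice: for arbitrary \<open>v\<close> it shows that \<open>\<phi>\<close>
    is onto, for \<open>v = 0\<close> that \<open>q\<close> maps \<open>ker \<phi>\<close> onto
    \<open>ker f2\<close>.\<close>
  have onto: "\<exists>x. x \<in> free (k + l) \<and> \<phi> x = v \<and> q x = y" if "v \<in> V" "y \<in> free l" "p v = f2 y" for v y
  proof -
    have "p (v - g y) = 0" using that lin_diff[OF p(1) V] linD(1)[OF g(1)] g(2) by simp
    then have "v - g y \<in> f1 ` free k"
      using f1(2) that linD(1)[OF g(1)] is_modD(4)[OF V] by auto
    then obtain x where x: "x \<in> free k" "f1 x = v - g y" by (metis imageE)
    show ?thesis by (rule exI[of _ "j x y"]) (use j x that in \<open>simp add: \<phi>_def\<close>)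
  qed
  have "\<phi> ` free (k + l) = V"
  proof (intro equalityI subsetI)
    fix v assume v: "v \<in> V"
    then obtain y where "y \<in> free l" "p v = f2 y" using linD(1)[OF p(1)] f2(2) by (metis imageE)
    then show "v \<in> \<phi> ` free (k + l)" using onto[OF v] by blast
  qed (use linD(1)[OF \<phi>] in auto)
  moreover have "lin fsm {x \<in> free (k + l). \<phi> x = 0} fsm {y \<in> free l. f2 y = 0} q"
  proof (rule lin_subset[OF q])
    show "q x \<in> {y \<in> free l. f2 y = 0}" if "x \<in> {x \<in> free (k + l). \<phi> x = 0}" for x
      using that p\<phi>[of x] linD(1)[OF q] lin_zero[OF p(1) V] by auto
  qed auto
  moreover have "q ` {x \<in> free (k + l). \<phi> x = 0} = {y \<in> free l. f2 y = 0}"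
  proof (intro equalityI subsetI)
    fix y assume "y \<in> {y \<in> free l. f2 y = 0}"
    then obtain x where "x \<in> free (k + l)" "\<phi> x = 0" "q x = y"
      using onto[OF is_modD(1)[OF V], of y] lin_zero[OF p(1) V] by auto
    then show "y \<in> q ` {x \<in> free (k + l). \<phi> x = 0}" by blast
  next
    fix y assume "y \<in> q ` {x \<in> free (k + l). \<phi> x = 0}"
    then show "y \<in> {y \<in> free l. f2 y = 0}"
      using linD(1)[OF q] lin_zero[OF p(1) V] by (auto simp flip: p\<phi>)
  qed
  moreover have "{x \<in> {x \<in> free (k + l). \<phi> x = 0}. q x = 0} = {x \<in> free k. f1 x = 0}"
  proof -
    have fr: "x \<in> free (k + l) \<and> q x = 0 \<longleftrightarrow> x \<in> free k" for x
    proof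
      assume "x \<in> free (k + l) \<and> q x = 0"
      then have x: "\<forall>i. x i \<in> A" "\<And>i. x (i + k) = 0" by (auto simp: free_def q_def fun_eq_iff)
      have "x i = 0" if "i \<ge> k" for i using x(2)[of "i - k"] that by simp
      then show "x \<in> free k" using x(1) by (simp add: free_def)
    qed (auto simp: free_def q_def fun_eq_iff)
    have \<phi>f1: "\<phi> x = f1 x" if "x \<in> free k" for x
    proof -
      have "t x = x" "q x = 0" using that by (auto simp: t_def q_def free_def fun_eq_iff)
      then show ?thesis using that lin_zero[OF g(1) free_mod] by (simp add: \<phi>_def)
    qed
    show ?thesis
    proof (rule Set.set_eqI)
      fix x show "x \<in> {x \<in> {x \<in> free (k + l). \<phi> x = 0}. q x = 0} \<longleftrightarrow> x \<in> {x \<in> free k. f1 x = 0}"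
        using fr[of x] \<phi>f1[of x] by auto
    qed
  qed
  ultimately show ?thesis using \<phi> by blast
qed

text \<open>By \<open>horseshoe\<close> a syzygy of an extension is an extension of the syzygies of
  its two ends, so coinduction applies to the class of all such extensions.\<close>

lemma fp_kernel_extension:
  assumes "is_mod fsm K" "lin fsm K fsm W p" "p ` K = W" "fp fsm W" "fp fsm {x \<in> K. p x = 0}"
  shows "fp_kernel K"
proof -
  define P where "P K \<longleftrightarrow> is_mod fsm K \<and> (\<exists>W p. lin fsm K fsm W p \<and> p ` K = W \<and> fp fsm W \<and>
    fp fsm {x \<in> K. p x = 0})" for K :: "(nat \<Rightarrow> 'r) set"
  have "P K" using assms unfolding P_def by blast
  then show ?thesis
  proof (coinduction arbitrary: K rule: fp_kernel.coinduct)
    case fp_kernel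
    then obtain W p where p: "is_mod fsm K" "lin fsm K fsm W p" "p ` K = W" "fp fsm W"
      "fp fsm {x \<in> K. p x = 0}" unfolding P_def by blast
    obtain k f1 where f1: "lin fsm (free k) fsm {x \<in> K. p x = 0} f1" "f1 ` free k = {x \<in> K. p x = 0}"
      "fp_kernel {x \<in> free k. f1 x = 0}" using p(5) unfolding fp_def by blast
    obtain l f2 where f2: "is_mod fsm W" "lin fsm (free l) fsm W f2" "f2 ` free l = W"
      "fp_kernel {x \<in> free l. f2 x = 0}" using p(4) unfolding fp_def by blast
    obtain \<phi> q where \<phi>: "lin fsm (free (k + l)) fsm K \<phi>" "\<phi> ` free (k + l) = K"
      and q: "lin fsm {x \<in> free (k + l). \<phi> x = 0} fsm {y \<in> free l. f2 y = 0} q"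
        "q ` {x \<in> free (k + l). \<phi> x = 0} = {y \<in> free l. f2 y = 0}"
        "{x \<in> {x \<in> free (k + l). \<phi> x = 0}. q x = 0} = {x \<in> free k. f1 x = 0}"
      using horseshoe[OF p(1) f2(1) p(2,3) f1(1,2) f2(2,3)] by blast
    have "P {x \<in> free (k + l). \<phi> x = 0}"
      unfolding P_def
      using is_mod_kernel[OF \<phi>(1) free_mod p(1)] q f1(3) f2(4) unfolding fp_kernel_iff
      by (intro conjI exI[of _ "{y \<in> free l. f2 y = 0}"] exI[of _ q]) simp_all
    then show ?case
      by (intro exI[of _ K] exI[of _ "k + l"] exI[of _ \<phi>]) (simp add: p(1) \<phi>)
  qed
qed

text \<open>Coinduction on the modules that are extensions of a member of \<open>\<Q>\<close> by a module with a finitely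
  generated free resolution; the first syzygy of such a module is again of this form.\<close>

theorem fp_resolve:
  assumes \<Q>: "\<And>Q. Q \<in> \<Q> \<Longrightarrow> is_mod sm Q \<and> (\<exists>C f. fp sm C \<and> lin sm C sm Q f \<and> f ` C = Q \<and>
      {v \<in> C. f v = 0} \<in> \<Q>)"
    and Q: "Q \<in> \<Q>"
  shows "fp sm Q"
proof -
  define P where "P L \<longleftrightarrow> is_mod fsm L \<and> (\<exists>Q\<in>\<Q>. \<exists>p. lin fsm L sm Q p \<and> p ` L = Q \<and>
    fp fsm {x \<in> L. p x = 0})" for L :: "(nat \<Rightarrow> 'r) set"
  \<comment> \<open>A free cover of \<open>C\<close> followed by \<open>f\<close> covers
    \<open>Q\<close>. Its kernel maps onto the kernel of \<open>f\<close>, the next member of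
    \<open>\<Q>\<close>, and what is killed is the kernel of the free cover.\<close>
  have cover: "\<exists>l g. lin fsm (free l) sm Q g \<and> g ` free l = Q \<and>
      (\<exists>r. \<exists>Q'\<in>\<Q>. lin fsm {x \<in> free l. g x = 0} sm Q' r \<and> r ` {x \<in> free l. g x = 0} = Q' \<and>
        fp fsm {x \<in> {x \<in> free l. g x = 0}. r x = 0})" if "Q \<in> \<Q>" for Q
  proof -
    obtain C f where f: "is_mod sm Q" "fp sm C" "lin sm C sm Q f" "f ` C = Q" "{v \<in> C. f v = 0} \<in> \<Q>"
      using \<Q>[OF \<open>Q \<in> \<Q>\<close>] by blast
    obtain l r where r: "is_mod sm C" "lin fsm (free l) sm C r" "r ` free l = C"
      "fp_kernel {x \<in> free l. r x = 0}" using f(2) unfolding fp_def by blast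
    define g where "g x = f (r x)" for x
    have g: "lin fsm (free l) sm Q g" "g ` free l = Q"
      using lin_compose[OF r(2) f(3)] r(3) f(4) unfolding g_def by (auto simp: image_image[symmetric])
    have "lin fsm {x \<in> free l. g x = 0} sm {v \<in> C. f v = 0} r"
      by (rule lin_subset[OF r(2)]) (use linD(1)[OF r(2)] in \<open>auto simp: g_def\<close>)
    moreover have "r ` {x \<in> free l. g x = 0} = {v \<in> C. f v = 0}"
      using r(3) by (auto simp: g_def)
    moreover have "{x \<in> {x \<in> free l. g x = 0}. r x = 0} = {x \<in> free l. r x = 0}"
      using lin_zero[OF f(3) r(1)] by (auto simp: g_def)
    ultimately have "lin fsm {x \<in> free l. g x = 0} sm {v \<in> C. f v = 0} r \<and>
        r ` {x \<in> free l. g x = 0} = {v \<in> C. f v = 0} \<and> fp fsm {x \<in> {x \<in> free l. g x = 0}. r x = 0}"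
      using r(4) by (simp add: fp_kernel_iff)
    then show ?thesis using g f(5) by blast
  qed
  have P: "fp_kernel L" if "P L" for L
    using that
  proof (coinduction arbitrary: L rule: fp_kernel.coinduct)
    case fp_kernel
    then obtain Q p where p: "is_mod fsm L" "Q \<in> \<Q>" "lin fsm L sm Q p" "p ` L = Q"
      "fp fsm {x \<in> L. p x = 0}" unfolding P_def by blast
    obtain k f1 where f1: "lin fsm (free k) fsm {x \<in> L. p x = 0} f1" "f1 ` free k = {x \<in> L. p x = 0}"
      "fp_kernel {x \<in> free k. f1 x = 0}" using p(5) unfolding fp_def by blast
    obtain l g r Q' where g: "lin fsm (free l) sm Q g" "g ` free l = Q" and Q': "Q' \<in> \<Q>"
      and r: "lin fsm {x \<in> free l. g x = 0} sm Q' r" "r ` {x \<in> free l. g x = 0} = Q'"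
        "fp fsm {x \<in> {x \<in> free l. g x = 0}. r x = 0}"
      using cover[OF p(2)] by blast
    have Qm: "is_mod sm Q" using \<Q>[OF p(2)] by blast
    obtain \<phi> q where \<phi>: "lin fsm (free (k + l)) fsm L \<phi>" "\<phi> ` free (k + l) = L"
      and q: "lin fsm {x \<in> free (k + l). \<phi> x = 0} fsm {y \<in> free l. g y = 0} q"
        "q ` {x \<in> free (k + l). \<phi> x = 0} = {y \<in> free l. g y = 0}"
        "{x \<in> {x \<in> free (k + l). \<phi> x = 0}. q x = 0} = {x \<in> free k. f1 x = 0}"
      using horseshoe[OF p(1) Qm p(3,4) f1(1,2) g] by blast
    let ?K = "{x \<in> free (k + l). \<phi> x = 0}" and ?Kg = "{y \<in> free l. g y = 0}"
    have K: "is_mod fsm ?K" by (rule is_mod_kernel[OF \<phi>(1) free_mod p(1)])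
    have Kg: "is_mod fsm ?Kg" by (rule is_mod_kernel[OF g(1) free_mod Qm])
    have rq: "lin fsm ?K sm Q' (\<lambda>x. r (q x))" by (rule lin_compose[OF q(1) r(1)])
    have rq_im: "(\<lambda>x. r (q x)) ` ?K = Q'" using q(2) r(2) by (metis image_image)
    \<comment> \<open>The new syzygy \<open>?K\<close> maps onto \<open>Q'\<close>. The part killed
      by this map is an extension of \<open>ker r\<close> by \<open>ker f1\<close>, hence
      resolvable.\<close>
    let ?K2 = "{x \<in> ?K. r (q x) = 0}"
    have "is_mod fsm ?K2" using is_mod_kernel[OF rq K] \<Q>[OF Q'] by blast
    moreover have "lin fsm ?K2 fsm {y \<in> ?Kg. r y = 0} q"
      by (rule lin_subset[OF q(1)]) (use linD(1)[OF q(1)] in auto)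
    moreover have "q ` ?K2 = {y \<in> ?Kg. r y = 0}"
      unfolding q(2)[symmetric] by auto
    moreover have "{x \<in> ?K2. q x = 0} = {x \<in> free k. f1 x = 0}"
      using lin_zero[OF r(1) Kg] unfolding q(3)[symmetric] by auto
    ultimately have "fp_kernel ?K2"
      using fp_kernel_extension[of ?K2 "{y \<in> ?Kg. r y = 0}" q] r(3) f1(3) by (simp add: fp_kernel_iff)
    then have "P ?K" unfolding P_def using K Q' rq rq_im by (auto simp: fp_kernel_iff)
    then show ?case
      by (intro exI[of _ L] exI[of _ "k + l"] exI[of _ \<phi>]) (simp add: p(1) \<phi>)
  qed
  obtain l g r Q' where g: "lin fsm (free l) sm Q g" "g ` free l = Q" and Q': "Q' \<in> \<Q>"
    and r: "lin fsm {x \<in> free l. g x = 0} sm Q' r" "r ` {x \<in> free l. g x = 0} = Q'"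
      "fp fsm {x \<in> {x \<in> free l. g x = 0}. r x = 0}"
    using cover[OF Q] by blast
  have Qm: "is_mod sm Q" using \<Q>[OF Q] by blast
  have "P {x \<in> free l. g x = 0}"
    unfolding P_def using is_mod_kernel[OF g(1) free_mod Qm] Q' r by blast
  then show ?thesis using P Qm g unfolding fp_def by blast
qed

lemma fp_zero: "is_mod sm {0} \<Longrightarrow> fp sm {0}"
proof -
  assume z: "is_mod sm {0}"
  have f0: "free 0 = {0}" by (auto simp: free_def fun_eq_iff A_zero)
  have m0: "is_mod fsm {0}" using free_mod[of 0] by (simp add: f0)
  have l0: "lin fsm (free 0) fsm {0} (\<lambda>_. 0)" "lin fsm (free 0) sm {0} (\<lambda>_. 0)"
    by (auto simp: lin_def f0 sm_zero[OF m0] sm_zero[OF z])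
  have "fp_kernel {0}"
  proof (coinduction rule: fp_kernel.coinduct)
    case fp_kernel
    show ?case
      by (intro exI[of _ "{0}"] exI[of _ "0::nat"] exI[of _ "\<lambda>_. 0"]) (use m0 l0 in \<open>auto simp: f0\<close>)
  qed
  then show ?thesis
    unfolding fp_def using z l0 by (intro conjI exI[of _ "0::nat"] exI[of _ "\<lambda>_. 0"]) (auto simp: f0)
qed

lemma fp_free_rank_one:
  assumes V: "is_mod sm V" and m: "m \<in> V" "(\<lambda>a. sm a m) ` A = V" "\<And>a. a \<in> A \<Longrightarrow> sm a m = 0 \<Longrightarrow> a = 0"
  shows "fp sm V"
proof -
  have f: "lin fsm (free 1) sm V (\<lambda>x. sm (x 0) m)"
    using free_universal[OF V, of 1 "\<lambda>_. m"] m by simp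
  have "(\<lambda>x. sm (x 0) m) ` free 1 = V"
  proof (intro equalityI subsetI)
    fix v assume "v \<in> V"
    then obtain a where a: "a \<in> A" "v = sm a m" using m(2) by blast
    then show "v \<in> (\<lambda>x. sm (x 0) m) ` free 1"
      by (intro image_eqI[where x = "\<lambda>i. if i = 0 then a else 0"]) (auto simp: free_def A_zero)
  qed (use linD(1)[OF f] in auto)
  moreover have "{x \<in> free 1. sm (x 0) m = 0} = {0}"
  proof -
    have "x = 0" if "x \<in> free 1" "sm (x 0) m = 0" for x
    proof
      fix i show "x i = 0 i"
        using m(3)[OF free_in[OF that(1), of 0] that(2)] that(1) by (cases i) (auto simp: free_def)
    qed
    then show ?thesis using lin_zero[OF f free_mod] is_modD(1)[OF free_mod, of 1] by auto
  qed
  moreover have "is_mod fsm {0}"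
    by (auto simp: is_mod_def fsm_def fun_eq_iff mul_zero A_one A_add A_mul)
  ultimately show ?thesis
    unfolding fp_def using V f fp_zero[of fsm] fp_kernel_iff by force
qed

lemma fp_iso:
  assumes V: "fp sm V" and f: "lin sm V sm' W f" "f ` V = W" "\<And>v. v \<in> V \<Longrightarrow> f v = 0 \<Longrightarrow> v = 0"
    and W: "is_mod sm' W"
  shows "fp sm' W"
proof -
  obtain k g where g: "is_mod sm V" "lin fsm (free k) sm V g" "g ` free k = V" "fp_kernel {x \<in> free k. g x = 0}"
    using V unfolding fp_def by blast
  have "{x \<in> free k. f (g x) = 0} = {x \<in> free k. g x = 0}"
    using f(3) linD(1)[OF g(2)] lin_zero[OF f(1) g(1)] by auto
  moreover have "(\<lambda>x. f (g x)) ` free k = W" using g(3) f(2) by (metis image_image)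
  ultimately show ?thesis
    unfolding fp_def using W lin_compose[OF g(2) f(1)] g(4)
    by (intro conjI exI[of _ k] exI[of _ "\<lambda>x. f (g x)"]) simp_all
qed

text \<open>Dependent choice unrolls the coinductive predicate; a state is a rank together with its
  covering map.\<close>

theorem fp_resolution:
  assumes "fp sm V"
  shows "\<exists>ks ds f. lin fsm (free (ks 0)) sm V f \<and> f ` free (ks 0) = V \<and>
    (\<forall>i. lin fsm (free (ks (Suc i))) fsm (free (ks i)) (ds i)) \<and>
    ds 0 ` free (ks 1) = {x \<in> free (ks 0). f x = 0} \<and>
    (\<forall>i. ds (Suc i) ` free (ks (Suc (Suc i))) = {x \<in> free (ks (Suc i)). ds i x = 0})"
proof -
  obtain k f where f: "lin fsm (free k) sm V f" "f ` free k = V" "fp_kernel {x \<in> free k. f x = 0}"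
    using assms unfolding fp_def by blast
  define R where "R L s \<longleftrightarrow> lin fsm (free (fst s)) fsm L (snd s) \<and> snd s ` free (fst s) = L \<and>
    fp_kernel {x \<in> free (fst s). snd s x = 0}"
    for L and s :: "nat \<times> ((nat \<Rightarrow> 'r) \<Rightarrow> (nat \<Rightarrow> 'r))"
  have ex: "\<exists>s. R L s" if "fp_kernel L" for L
    using that by (cases rule: fp_kernel.cases) (auto simp: R_def)
  define ker where "ker s = {x \<in> free (fst s). snd s x = 0}"
    for s :: "nat \<times> ((nat \<Rightarrow> 'r) \<Rightarrow> (nat \<Rightarrow> 'r))"
  obtain s0 where s0: "R {x \<in> free k. f x = 0} s0" using ex[OF f(3)] by blast
  obtain s where s: "s 0 = s0" "\<And>n. R (ker (s n)) (s (Suc n))"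
  proof -
    \<comment> \<open>The clause for \<open>n = 0\<close> anchors the choice at
      \<open>s0\<close>.\<close>
    have "\<exists>s. \<forall>n. ((n = 0 \<longrightarrow> s n = s0) \<and> fp_kernel (ker (s n))) \<and> R (ker (s n)) (s (Suc n))"
    proof (rule dependent_nat_choice)
      show "\<exists>x. (0 = 0 \<longrightarrow> x = s0) \<and> fp_kernel (ker x)" using s0 by (auto simp: R_def ker_def)
      fix x and n :: nat assume "(n = 0 \<longrightarrow> x = s0) \<and> fp_kernel (ker x)"
      then obtain y where "R (ker x) y" using ex by blast
      then show "\<exists>y. ((Suc n = 0 \<longrightarrow> y = s0) \<and> fp_kernel (ker y)) \<and> R (ker x) y"
        by (auto simp: R_def ker_def)
    qed
    then show thesis using that by blast
  qed
  \<comment> \<open>The cover of \<open>V\<close> has another target type and is not one of the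
    states, hence the shift of the index.\<close>
  define ks where "ks i = (case i of 0 \<Rightarrow> k | Suc j \<Rightarrow> fst (s j))" for i
  define ds where "ds i = snd (s i)" for i
  have ks [simp]: "ks 0 = k" "ks (Suc i) = fst (s i)" for i by (simp_all add: ks_def)
  have lin_ds: "lin fsm (free (ks (Suc i))) fsm (free (ks i)) (ds i)" for i
  proof (cases i)
    case 0
    then show ?thesis using s0 s(1) by (auto simp: R_def ds_def lin_def)
  next
    case (Suc j)
    then show ?thesis using s(2)[of j] by (auto simp: R_def ds_def lin_def ker_def)
  qed
  have "ds 0 ` free (ks 1) = {x \<in> free (ks 0). f x = 0}"
    using s0 s(1) by (simp add: R_def ds_def)
  moreover have "ds (Suc i) ` free (ks (Suc (Suc i))) = {x \<in> free (ks (Suc i)). ds i x = 0}" for i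
    using s(2)[of i] by (simp add: R_def ds_def ker_def)
  ultimately show ?thesis using f lin_ds by (intro exI[of _ ks] exI[of _ ds] exI[of _ f]) simp
qed

end

section \<open>From subsets of types to module records\<close>

context car_ring
begin

definition base_ring :: "'r ring" where
  "base_ring = \<lparr>carrier = A, monoid.mult = mul, one = e, ring.zero = 0, add = (+)\<rparr>"

definition fmod :: "nat \<Rightarrow> ('r, nat \<Rightarrow> 'r) module" where
  "fmod k = \<lparr>carrier = free k, monoid.mult = undefined, one = undefined, ring.zero = 0, add = (+), smult = fsm\<rparr>"

lemma base_ring_simps [simp]:
  "carrier base_ring = A" "monoid.mult base_ring = mul" "one base_ring = e"
  "ring.zero base_ring = 0" "add base_ring = (+)"
  by (simp_all add: base_ring_def)

lemma fmod_simps [simp]: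
  "carrier (fmod k) = free k" "ring.zero (fmod k) = 0" "add (fmod k) = (+)" "smult (fmod k) = fsm"
  by (simp_all add: fmod_def)

lemma ring_base_ring: "ring base_ring"
proof (rule ringI)
  show "abelian_group base_ring"
    by (rule abelian_groupI) (auto simp: A_add A_zero add.assoc add.commute intro: bexI[OF _ A_uminus])
  show "Group.monoid base_ring"
    by (rule monoidI) (auto simp: A_mul A_one mul_assoc mul_one_left mul_one_right)
qed (auto simp: mul_add_left mul_add_right)

lemma abelian_group_fmod: "abelian_group (fmod k)"
  by (rule abelian_groupI)
    (auto simp: is_modD[OF free_mod] add.assoc add.commute intro: bexI[OF _ is_modD(3)[OF free_mod]])

lemma left_module_fmod: "left_module base_ring (fmod k)"
  by (intro left_module.intro left_module_axioms.intro ring_base_ring abelian_group_fmod)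
    (simp_all add: is_modD[OF free_mod])

lemma finsum_fmod:
  "finite S \<Longrightarrow> (\<And>s. s \<in> S \<Longrightarrow> F s \<in> free k) \<Longrightarrow> finsum (fmod k) F S = sum F S"
proof (induction S rule: finite_induct)
  case empty
  interpret M: abelian_group "fmod k" by (rule abelian_group_fmod)
  show ?case by simp
next
  case (insert x S)
  interpret M: abelian_group "fmod k" by (rule abelian_group_fmod)
  show ?case using insert by (subst M.finsum_insert) auto
qed

text \<open>\<open>fin_gen_module\<close> indexes coefficients by the generators themselves, so the
  unit vectors have to be distinct; this is where \<open>e \<noteq> 0\<close> enters.\<close>

lemma fin_gen_fmod:
  assumes "e \<noteq> 0"
  shows "fin_gen_module base_ring (fmod k)"
  unfolding fin_gen_module_def
proof (intro exI conjI ballI)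
  let ?S = "unit_vec ` {..<k}"
  have inj: "inj_on unit_vec {..<k}"
    using assms by (auto simp: inj_on_def unit_vec_def fun_eq_iff)
  show "finite ?S" by simp
  show "?S \<subseteq> carrier (fmod k)" using unit_vec_free by auto
  fix x assume x: "x \<in> carrier (fmod k)"
  define a where "a s = x (inv_into {..<k} unit_vec s)" for s
  have aA: "a s \<in> A" for s using x free_in by (simp add: a_def)
  have "finsum (fmod k) (\<lambda>s. fsm (a s) s) ?S = (\<Sum>s\<in>?S. fsm (a s) s)"
    by (rule finsum_fmod) (auto simp: is_modD(5)[OF free_mod] aA unit_vec_free)
  also have "\<dots> = (\<Sum>i<k. fsm (x i) (unit_vec i))"
    by (subst sum.reindex[OF inj]) (simp add: a_def inv_into_f_f[OF inj])
  also have "\<dots> = x" using free_expand x by simp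
  finally have "x = (\<Oplus>\<^bsub>fmod k\<^esub>s\<in>?S. a s \<odot>\<^bsub>fmod k\<^esub> s)" by simp
  then show "\<exists>a\<in>?S \<rightarrow> carrier base_ring. x = (\<Oplus>\<^bsub>fmod k\<^esub>s\<in>?S. a s \<odot>\<^bsub>fmod k\<^esub> s)"
    using aA by (intro bexI[of _ a]) auto
qed

text \<open>The counterpart of \<open>lin_free_expand\<close> for a target record, whose sums are
  \<open>finsum\<close> and not those of a type class.\<close>

lemma lmod_hom_fmod_expand:
  assumes N: "left_module base_ring N" and g: "g \<in> lmod_hom base_ring (fmod k) N" and x: "x \<in> free k"
  shows "g x = (\<Oplus>\<^bsub>N\<^esub>i\<in>{..<k}. x i \<odot>\<^bsub>N\<^esub> g (unit_vec i))"
proof -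
  interpret N: left_module base_ring N by fact
  have g': "g y \<in> carrier N" "g (y + z) = g y \<oplus>\<^bsub>N\<^esub> g z" "g (fsm a y) = a \<odot>\<^bsub>N\<^esub> g y"
    if "y \<in> free k" "z \<in> free k" "a \<in> A" for y z a
    using g that by (auto simp: lmod_hom_def)
  have z: "0 \<in> free k" by (rule is_modD(1)[OF free_mod])
  have g0: "g 0 = \<zero>\<^bsub>N\<^esub>"
    using g'(1)[OF z z A_zero] g'(2)[OF z z A_zero] N.M.add.l_cancel_one' by auto
  have u: "fsm (x i) (unit_vec i) \<in> free k" if "i < k" for i
    using that by (simp add: is_modD(5)[OF free_mod] free_in[OF x] unit_vec_free)
  have c: "x i \<odot>\<^bsub>N\<^esub> g (unit_vec i) \<in> carrier N" if "i < k" for i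
    using that N.smult_closed free_in[OF x] g'(1)[OF unit_vec_free z A_zero] by simp
  have "g (\<Sum>i<j. fsm (x i) (unit_vec i)) = (\<Oplus>\<^bsub>N\<^esub>i\<in>{..<j}. x i \<odot>\<^bsub>N\<^esub> g (unit_vec i))"
    if "j \<le> k" for j
    using that
  proof (induction j)
    case (Suc j)
    have s: "(\<Sum>i<j. fsm (x i) (unit_vec i)) \<in> free k"
      by (rule is_mod_sum[OF free_mod]) (use u Suc in auto)
    have "(\<Oplus>\<^bsub>N\<^esub>i\<in>{..<Suc j}. x i \<odot>\<^bsub>N\<^esub> g (unit_vec i))
        = x j \<odot>\<^bsub>N\<^esub> g (unit_vec j) \<oplus>\<^bsub>N\<^esub> (\<Oplus>\<^bsub>N\<^esub>i\<in>{..<j}. x i \<odot>\<^bsub>N\<^esub> g (unit_vec i))"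
      unfolding lessThan_Suc by (rule N.M.finsum_insert) (use c Suc in auto)
    also have "x j \<odot>\<^bsub>N\<^esub> g (unit_vec j) = g (fsm (x j) (unit_vec j))"
      using g'(3)[OF unit_vec_free z free_in[OF x]] Suc by simp
    finally have *: "(\<Oplus>\<^bsub>N\<^esub>i\<in>{..<Suc j}. x i \<odot>\<^bsub>N\<^esub> g (unit_vec i))
        = g (fsm (x j) (unit_vec j)) \<oplus>\<^bsub>N\<^esub> g (\<Sum>i<j. fsm (x i) (unit_vec i))"
      using Suc by simp
    have "(\<Sum>i<Suc j. fsm (x i) (unit_vec i)) = fsm (x j) (unit_vec j) + (\<Sum>i<j. fsm (x i) (unit_vec i))"
      by (subst sum.lessThan_Suc) (rule add.commute)
    moreover have "g (fsm (x j) (unit_vec j) + (\<Sum>i<j. fsm (x i) (unit_vec i)))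
        = g (fsm (x j) (unit_vec j)) \<oplus>\<^bsub>N\<^esub> g (\<Sum>i<j. fsm (x i) (unit_vec i))"
      using Suc.prems by (intro g'(2)[OF u s A_zero]) simp
    ultimately show ?case unfolding * by (simp only:)
  qed (use g0 in simp)
  from this[of k] show ?thesis using free_expand[OF x] by simp
qed

text \<open>The images of the unit vectors are lifted along \<open>f\<close> and the choice is
  extended linearly; the work lies in the sums of the record \<open>M\<close>.\<close>

lemma projective_fmod: "projective_module base_ring (fmod k)"
  unfolding projective_module_def
proof (intro conjI left_module_fmod allI ballI impI, elim conjE)
  fix M :: "('r, (nat \<Rightarrow> 'r) \<Rightarrow> 'r) module" and N :: "('r, nat \<Rightarrow> 'r) module" and f g
  assume f: "f \<in> lmod_hom base_ring M N" and g: "g \<in> lmod_hom base_ring (fmod k) N"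
    and M: "left_module base_ring M" and N: "left_module base_ring N"
    and onto: "f ` carrier M = carrier N"
  interpret M: left_module base_ring M by fact
  interpret N: left_module base_ring N by fact
  have f': "f y \<in> carrier N" "f (y \<oplus>\<^bsub>M\<^esub> z) = f y \<oplus>\<^bsub>N\<^esub> f z" "f (a \<odot>\<^bsub>M\<^esub> y) = a \<odot>\<^bsub>N\<^esub> f y"
    if "y \<in> carrier M" "z \<in> carrier M" "a \<in> A" for y z a
    using f that by (auto simp: lmod_hom_def)
  have z: "\<zero>\<^bsub>M\<^esub> \<in> carrier M" by simp
  have f0: "f \<zero>\<^bsub>M\<^esub> = \<zero>\<^bsub>N\<^esub>"
    using f'(1)[OF z z A_zero] f'(2)[OF z z A_zero] N.M.add.l_cancel_one' by auto
  have "\<exists>m. i < k \<longrightarrow> m \<in> carrier M \<and> f m = g (unit_vec i)" for i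
  proof (cases "i < k")
    case True
    then have "g (unit_vec i) \<in> carrier N" using g unit_vec_free by (auto simp: lmod_hom_def)
    then obtain m where "m \<in> carrier M" "f m = g (unit_vec i)" using onto by (metis imageE)
    then show ?thesis by blast
  qed simp
  then obtain m where m: "\<And>i. i < k \<Longrightarrow> m i \<in> carrier M \<and> f (m i) = g (unit_vec i)" by metis
  define h where "h x = (\<Oplus>\<^bsub>M\<^esub>i\<in>{..<k}. x i \<odot>\<^bsub>M\<^esub> m i)" for x
  have c: "x i \<odot>\<^bsub>M\<^esub> m i \<in> carrier M" if "x \<in> free k" "i < k" for x i
    using that M.smult_closed m free_in by simp
  have "h x \<in> carrier M" if "x \<in> free k" for x
    unfolding h_def by (rule M.M.finsum_closed) (use c that in auto)
  moreover have "h (x + y) = h x \<oplus>\<^bsub>M\<^esub> h y" if xy: "x \<in> free k" "y \<in> free k" for x y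
  proof -
    have "h (x + y) = (\<Oplus>\<^bsub>M\<^esub>i\<in>{..<k}. x i \<odot>\<^bsub>M\<^esub> m i \<oplus>\<^bsub>M\<^esub> y i \<odot>\<^bsub>M\<^esub> m i)"
      unfolding h_def
    proof (rule M.M.finsum_cong')
      fix i assume "i \<in> {..<k}"
      then show "(x + y) i \<odot>\<^bsub>M\<^esub> m i = x i \<odot>\<^bsub>M\<^esub> m i \<oplus>\<^bsub>M\<^esub> y i \<odot>\<^bsub>M\<^esub> m i"
        using M.smult_l_distr[of "x i" "y i" "m i"] free_in xy m by simp
    qed (use c xy in auto)
    then show ?thesis
      unfolding h_def using M.M.finsum_addf[of "\<lambda>i. x i \<odot>\<^bsub>M\<^esub> m i" "{..<k}" "\<lambda>i. y i \<odot>\<^bsub>M\<^esub> m i"] c xy by auto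
  qed
  moreover have "h (fsm a x) = a \<odot>\<^bsub>M\<^esub> h x" if a: "a \<in> A" and x: "x \<in> free k" for a x
  proof -
    have a0: "a \<odot>\<^bsub>M\<^esub> \<zero>\<^bsub>M\<^esub> = \<zero>\<^bsub>M\<^esub>"
      using M.smult_closed[of a "\<zero>\<^bsub>M\<^esub>"] M.smult_r_distr[of a "\<zero>\<^bsub>M\<^esub>" "\<zero>\<^bsub>M\<^esub>"] a M.M.add.l_cancel_one' by auto
    have "(\<Oplus>\<^bsub>M\<^esub>i\<in>{..<j}. fsm a x i \<odot>\<^bsub>M\<^esub> m i) = a \<odot>\<^bsub>M\<^esub> (\<Oplus>\<^bsub>M\<^esub>i\<in>{..<j}. x i \<odot>\<^bsub>M\<^esub> m i)"
      if "j \<le> k" for j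
      using that
    proof (induction j)
      case (Suc j)
      have s: "(\<Oplus>\<^bsub>M\<^esub>i\<in>{..<j}. x i \<odot>\<^bsub>M\<^esub> m i) \<in> carrier M"
        by (rule M.M.finsum_closed) (use c x Suc in auto)
      have "(\<Oplus>\<^bsub>M\<^esub>i\<in>{..<Suc j}. fsm a x i \<odot>\<^bsub>M\<^esub> m i)
          = fsm a x j \<odot>\<^bsub>M\<^esub> m j \<oplus>\<^bsub>M\<^esub> (\<Oplus>\<^bsub>M\<^esub>i\<in>{..<j}. fsm a x i \<odot>\<^bsub>M\<^esub> m i)"
        unfolding lessThan_Suc
        by (rule M.M.finsum_insert) (use c is_modD(5)[OF free_mod a x] Suc in auto)
      also have "fsm a x j \<odot>\<^bsub>M\<^esub> m j = a \<odot>\<^bsub>M\<^esub> (x j \<odot>\<^bsub>M\<^esub> m j)"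
        using M.smult_assoc1[of a "x j" "m j"] a free_in[OF x] m Suc by (simp add: fsm_def)
      also have "(\<Oplus>\<^bsub>M\<^esub>i\<in>{..<j}. fsm a x i \<odot>\<^bsub>M\<^esub> m i) = a \<odot>\<^bsub>M\<^esub> (\<Oplus>\<^bsub>M\<^esub>i\<in>{..<j}. x i \<odot>\<^bsub>M\<^esub> m i)"
        using Suc by simp
      also have "a \<odot>\<^bsub>M\<^esub> (x j \<odot>\<^bsub>M\<^esub> m j) \<oplus>\<^bsub>M\<^esub> a \<odot>\<^bsub>M\<^esub> (\<Oplus>\<^bsub>M\<^esub>i\<in>{..<j}. x i \<odot>\<^bsub>M\<^esub> m i)
          = a \<odot>\<^bsub>M\<^esub> (x j \<odot>\<^bsub>M\<^esub> m j \<oplus>\<^bsub>M\<^esub> (\<Oplus>\<^bsub>M\<^esub>i\<in>{..<j}. x i \<odot>\<^bsub>M\<^esub> m i))"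
        using M.smult_r_distr[of a _ "\<Oplus>\<^bsub>M\<^esub>i\<in>{..<j}. x i \<odot>\<^bsub>M\<^esub> m i"] a c[OF x, of j] s Suc by simp
      also have "x j \<odot>\<^bsub>M\<^esub> m j \<oplus>\<^bsub>M\<^esub> (\<Oplus>\<^bsub>M\<^esub>i\<in>{..<j}. x i \<odot>\<^bsub>M\<^esub> m i) = (\<Oplus>\<^bsub>M\<^esub>i\<in>{..<Suc j}. x i \<odot>\<^bsub>M\<^esub> m i)"
        unfolding lessThan_Suc by (rule M.M.finsum_insert[symmetric]) (use c x Suc in auto)
      finally show ?case .
    qed (use a0 in simp)
    then show ?thesis unfolding h_def by simp
  qed
  moreover have "f (h x) = g x" if x: "x \<in> free k" for x
  proof -
    have gc: "x i \<odot>\<^bsub>N\<^esub> g (unit_vec i) \<in> carrier N" if "i < k" for i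
      using that N.smult_closed[of "x i" "g (unit_vec i)"] free_in[OF x] m[OF that] f'(1)[OF _ z A_zero]
      by (metis base_ring_simps(1))
    have "f (\<Oplus>\<^bsub>M\<^esub>i\<in>{..<j}. x i \<odot>\<^bsub>M\<^esub> m i) = (\<Oplus>\<^bsub>N\<^esub>i\<in>{..<j}. x i \<odot>\<^bsub>N\<^esub> g (unit_vec i))"
      if "j \<le> k" for j
      using that
    proof (induction j)
      case (Suc j)
      have s: "(\<Oplus>\<^bsub>M\<^esub>i\<in>{..<j}. x i \<odot>\<^bsub>M\<^esub> m i) \<in> carrier M"
        by (rule M.M.finsum_closed) (use c x Suc in auto)
      have "(\<Oplus>\<^bsub>M\<^esub>i\<in>{..<Suc j}. x i \<odot>\<^bsub>M\<^esub> m i)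
          = x j \<odot>\<^bsub>M\<^esub> m j \<oplus>\<^bsub>M\<^esub> (\<Oplus>\<^bsub>M\<^esub>i\<in>{..<j}. x i \<odot>\<^bsub>M\<^esub> m i)"
        unfolding lessThan_Suc by (rule M.M.finsum_insert) (use c x Suc in auto)
      moreover have "(\<Oplus>\<^bsub>N\<^esub>i\<in>{..<Suc j}. x i \<odot>\<^bsub>N\<^esub> g (unit_vec i))
          = x j \<odot>\<^bsub>N\<^esub> g (unit_vec j) \<oplus>\<^bsub>N\<^esub> (\<Oplus>\<^bsub>N\<^esub>i\<in>{..<j}. x i \<odot>\<^bsub>N\<^esub> g (unit_vec i))"
        unfolding lessThan_Suc by (rule N.M.finsum_insert) (use gc Suc in auto)
      moreover have "f (x j \<odot>\<^bsub>M\<^esub> m j) = x j \<odot>\<^bsub>N\<^esub> g (unit_vec j)"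
        using f'(3)[OF _ z free_in[OF x]] m Suc by simp
      ultimately show ?case
        using f'(2)[OF c[OF x, of j] s A_zero] Suc by simp
    qed (use f0 in simp)
    then show ?thesis unfolding h_def using lmod_hom_fmod_expand[OF N g x] by simp
  qed
  ultimately show "\<exists>h\<in>lmod_hom base_ring (fmod k) M. \<forall>x\<in>carrier (fmod k). f (h x) = g x"
    by (intro bexI[of _ h]) (auto simp: lmod_hom_def)
qed

text \<open>All terms of the resolution are finitely generated, so one resolution serves every
  \<open>q\<close>.\<close>

theorem type_FP_if_fp:
  fixes M :: "('r, 'm::ab_group_add) module"
  assumes "e \<noteq> 0" and fp: "fp sm V"
    and M: "carrier M = V" "ring.zero M = 0" "add M = (+)" "smult M = sm"
  shows "type_FP q base_ring M"
proof -
  obtain ks ds f where r: "lin fsm (free (ks 0)) sm V f" "f ` free (ks 0) = V"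
    "\<And>i. lin fsm (free (ks (Suc i))) fsm (free (ks i)) (ds i)"
    "ds 0 ` free (ks 1) = {x \<in> free (ks 0). f x = 0}"
    "\<And>i. ds (Suc i) ` free (ks (Suc (Suc i))) = {x \<in> free (ks (Suc i)). ds i x = 0}"
    using fp_resolution[OF fp] by blast
  have "projective_resolution base_ring M (\<lambda>i. fmod (ks i)) ds f"
    unfolding projective_resolution_def
    using r linD[OF r(1)] linD[OF r(3)]
    by (simp add: projective_fmod lmod_hom_def lmod_kernel_def M)
  then show ?thesis
    unfolding type_FP_def using fin_gen_fmod[OF assms(1)]
    by (intro exI[of _ "\<lambda>i. fmod (ks i)"] exI[of _ ds] exI[of _ f]) simp
qed

end

section \<open>The trivial module over the monoid ring of a half space\<close>

text \<open>The operations on formal integer sums in \<open>monoid_ring\<close> are translated into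
  \<open>scal\<close> and \<open>push\<close>, which serve complex coefficients too.\<close>

lemma frag_cmul_eq_scal: "frag_cmul = scal"
  by (intro ext poly_mapping_eqI) simp

lemma frag_extend_eq_push: "frag_extend (\<lambda>b. frag_of (f b)) = push f"
proof
  fix c :: "'a \<Rightarrow>\<^sub>0 int"
  show "frag_extend (\<lambda>b. frag_of (f b)) c = push f c"
    by (simp add: frag_extend_def push_def lin_ext_def frag_cmul_eq_scal)
qed

lemma gsm_single_right: "gsm act c (single x k) = scal k (push (\<lambda>g. act g x) c)"
  by (rule additive_eq_on_free[where E = UNIV and c = c])
    (auto simp: gsm_single free_on_def mult.commute
      intro: additive_gsm_left additive_compose[OF additive_scal additive_push])

context half_space
begin

sublocale mr: car_ring "free_on \<Gamma> :: ('a \<Rightarrow>\<^sub>0 int) set" "gsm (\<otimes>)" "frag_of \<one>"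
proof
  fix a b c :: "'a \<Rightarrow>\<^sub>0 int" assume a: "a \<in> free_on \<Gamma>"
  have "gsm (\<otimes>) (frag_of \<one>) a = push (\<lambda>g. \<one> \<otimes> g) a" by (simp add: gsm_single)
  also have "\<dots> = push (\<lambda>g. g) a" by (rule push_cong[OF a]) (simp add: \<Gamma>_in)
  finally show "gsm (\<otimes>) (frag_of \<one>) a = a" by (simp add: push_id)
  have "gsm (\<otimes>) a (frag_of \<one>) = push (\<lambda>g. g \<otimes> \<one>) a" by (simp add: gsm_single_right)
  also have "\<dots> = push (\<lambda>g. g) a" by (rule push_cong[OF a]) (simp add: \<Gamma>_in)
  finally show "gsm (\<otimes>) a (frag_of \<one>) = a" by (simp add: push_id)
  assume b: "b \<in> free_on \<Gamma>"
  show "gsm (\<otimes>) a b \<in> free_on \<Gamma>" by (rule gsm_free_on[OF a b \<Gamma>_mult])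
  assume c: "c \<in> free_on \<Gamma>"
  show "gsm (\<otimes>) (gsm (\<otimes>) a b) c = gsm (\<otimes>) a (gsm (\<otimes>) b c)"
    by (rule gsm_assoc[OF a b c]) (simp add: m_assoc \<Gamma>_in)
qed (auto simp: \<Gamma>_one additive.add[OF additive_gsm_left] additive.add[OF additive_gsm_right])

lemma is_mod_bimod:
  assumes V: "bimod G \<Gamma> V"
  shows "mr.is_mod (gsm (l_coset G)) V"
  unfolding mr.is_mod_def
proof (intro conjI ballI)
  show "0 \<in> V" using V by (simp add: bimod_def)
  fix v assume v: "v \<in> V"
  then have vp: "v \<in> free_on (Pow (carrier G))" using V by (auto simp: bimod_def)
  show "- v \<in> V" by (rule bimod_uminus[OF V v])
  have "gsm (l_coset G) (frag_of \<one>) v = push (\<lambda>C. \<one> <# C) v" by (simp add: gsm_single)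
  also have "\<dots> = push (\<lambda>C. C) v" by (rule push_cong[OF vp]) (simp add: lcos_mult_one)
  finally show "gsm (l_coset G) (frag_of \<one>) v = v" by (simp add: push_id)
  show "v + w \<in> V" if "w \<in> V" for w using V v that by (simp add: bimod_def)
  fix a :: "'a \<Rightarrow>\<^sub>0 int" assume a: "a \<in> free_on \<Gamma>"
  show "gsm (l_coset G) a v \<in> V"
    unfolding gsm_def by (rule lin_ext_in_free[OF a]) (use V v in \<open>auto simp: bimod_def\<close>)
  show "gsm (l_coset G) a (v + w) = gsm (l_coset G) a v + gsm (l_coset G) a w" for w
    by (rule additive.add[OF additive_gsm_right])
  show "gsm (l_coset G) (a + b) v = gsm (l_coset G) a v + gsm (l_coset G) b v" for b
    by (rule additive.add[OF additive_gsm_left])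
  show "gsm (l_coset G) (gsm (\<otimes>) a b) v = gsm (l_coset G) a (gsm (l_coset G) b v)" if b: "b \<in> free_on \<Gamma>" for b
    by (rule gsm_assoc[OF a b vp]) (simp add: lcos_m_assoc \<Gamma>_in)
qed

lemma lin_bimod_hom:
  assumes V: "bimod G \<Gamma> V" and f: "bimod_hom G \<Gamma> V W f"
  shows "mr.lin (gsm (l_coset G)) V (gsm (l_coset G)) W f"
proof -
  have ad: "additive f" using f by (simp add: bimod_hom_def)
  have "f (gsm (l_coset G) a v) = gsm (l_coset G) a (f v)" if a: "a \<in> free_on \<Gamma>" and v: "v \<in> V" for a v
  proof (rule additive_eq_on_free[OF _ _ a])
    show "additive (\<lambda>a. f (gsm (l_coset G) a v))" by (rule additive_compose[OF ad additive_gsm_left])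
    show "additive (\<lambda>a. gsm (l_coset G) a (f v))" by (rule additive_gsm_left)
    fix g and k :: int assume "g \<in> \<Gamma>"
    then show "f (gsm (l_coset G) (single g k) v) = gsm (l_coset G) (single g k) (f v)"
      using V f v by (simp add: gsm_single bimod_def bimod_hom_def)
  qed
  then show ?thesis
    using f unfolding mr.lin_def by (auto simp: additive.add[OF ad] bimod_hom_def)
qed

text \<open>Cosets of the trivial subgroup are singletons, so the module is the ring itself, free on
  the point \<open>{\<one>}\<close>.\<close>

lemma fp_regular: "mr.fp (gsm (l_coset G)) (free_on (cosets {\<one>}))"
proof (rule mr.fp_free_rank_one)
  let ?m = "single {\<one>} 1 :: 'a set \<Rightarrow>\<^sub>0 int"
  show "mr.is_mod (gsm (l_coset G)) (free_on (cosets {\<one>}))"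
    by (rule is_mod_bimod[OF bimod_cosets[OF one_is_normal]])
  have co: "cosets {\<one>} = (\<lambda>g. {g}) ` \<Gamma>"
    unfolding cosets_def by (rule image_cong) (auto simp: l_coset_def \<Gamma>_in)
  show "?m \<in> free_on (cosets {\<one>})" using \<Gamma>_one by (simp add: co)
  have sm: "gsm (l_coset G) a ?m = push (\<lambda>g. {g}) a" if "a \<in> free_on \<Gamma>" for a
    unfolding gsm_single_right scal_one
    by (rule push_cong[OF that]) (auto simp: l_coset_def \<Gamma>_in)
  have inv: "push the_elem (push (\<lambda>g. {g}) a) = a" for a :: "'a \<Rightarrow>\<^sub>0 int"
    by (simp add: push_push push_id)
  show "a = 0" if "a \<in> free_on \<Gamma>" "gsm (l_coset G) a ?m = 0" for a
    using inv[of a] that by (simp add: sm)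
  show "(\<lambda>a. gsm (l_coset G) a ?m) ` free_on \<Gamma> = free_on (cosets {\<one>})"
  proof (intro equalityI subsetI)
    fix v :: "'a set \<Rightarrow>\<^sub>0 int" assume v: "v \<in> free_on (cosets {\<one>})"
    have a: "push the_elem v \<in> free_on \<Gamma>" by (rule push_free_on[OF v]) (auto simp: co)
    have "push (\<lambda>g. {g}) (push the_elem v) = push (\<lambda>C. C) v"
      unfolding push_push by (rule push_cong[OF v]) (auto simp: co)
    then show "v \<in> (\<lambda>a. gsm (l_coset G) a ?m) ` free_on \<Gamma>"
      using sm[OF a] a by (intro image_eqI[where x = "push the_elem v"]) (auto simp: push_id)
  next
    fix v assume "v \<in> (\<lambda>a. gsm (l_coset G) a ?m) ` free_on \<Gamma>"
    then obtain a where a: "a \<in> free_on \<Gamma>" "v = gsm (l_coset G) a ?m" by blast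
    show "v \<in> free_on (cosets {\<one>})"
      unfolding a(2) sm[OF a(1)] by (rule push_free_on[OF a(1)]) (simp add: co)
  qed
qed

text \<open>At the end of the chain stands the module on the single coset \<open>G\<close>; the
  coefficient at that coset identifies it with the integers, on which the ring acts by
  augmentation.\<close>

theorem fp_trivial:
  assumes "cyc_chain (carrier G)"
  shows "mr.fp (smult trivial_int_module) (UNIV :: int set)"
proof -
  define aug :: "('a \<Rightarrow>\<^sub>0 int) \<Rightarrow> int" where "aug = lin_ext (\<lambda>_ k. k)"
  have sm: "smult trivial_int_module = (\<lambda>c n. aug c * n)"
    by (simp add: trivial_int_module_def aug_def lin_ext_def)
  have aug_add: "additive aug"
    unfolding aug_def by (rule additive_lin_ext) (rule additive_id)
  have aug_single: "aug (single g k) = k" for g k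
    unfolding aug_def by (rule lin_ext_single) simp
  have aug_scal_push: "aug (scal k (push f c)) = k * aug c" for k f c
    by (rule additive_eq_on_free[where E = UNIV and c = c])
      (auto intro!: additive_compose[OF aug_add] additive_compose[OF additive_scal additive_push]
        additive_compose[OF additive_mult aug_add] simp: aug_single free_on_def)
  have aug_mult: "aug (gsm (\<otimes>) a b) = aug a * aug b" for a b
  proof (rule additive_eq_on_free[where E = UNIV and c = a])
    show "additive (\<lambda>a. aug (gsm (\<otimes>) a b))" by (rule additive_compose[OF aug_add additive_gsm_left])
    show "additive (\<lambda>a. aug a * aug b)" using aug_add by (simp add: additive_def distrib_right)
  qed (auto simp: free_on_def gsm_single aug_single aug_scal_push)
  have "mr.fp (gsm (l_coset G)) (free_on (cosets (carrier G)))"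
  proof (rule good_cyc_chain[OF assms, where Good = "mr.fp (gsm (l_coset G))"])
    show "mr.fp (gsm (l_coset G)) {0}" by (rule mr.fp_zero[OF is_mod_bimod[OF bimod_zero]])
    show "mr.fp (gsm (l_coset G)) (free_on (cosets {\<one>}))" by (rule fp_regular)
    fix \<Q> :: "('a set \<Rightarrow>\<^sub>0 int) set set"
    assume \<Q>: "\<And>Q. Q \<in> \<Q> \<Longrightarrow> bimod G \<Gamma> Q \<and> (\<exists>C f. bimod G \<Gamma> C \<and> mr.fp (gsm (l_coset G)) C \<and>
      bimod_hom G \<Gamma> C Q f \<and> f ` C = Q \<and> {v \<in> C. f v = 0} \<in> \<Q>)"
    show "\<forall>Q\<in>\<Q>. mr.fp (gsm (l_coset G)) Q"
    proof
      fix Q assume "Q \<in> \<Q>"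
      show "mr.fp (gsm (l_coset G)) Q"
        by (rule mr.fp_resolve[OF _ \<open>Q \<in> \<Q>\<close>]) (use \<Q> is_mod_bimod lin_bimod_hom in meson)
    qed
  qed
  then have fp: "mr.fp (gsm (l_coset G)) (free_on {carrier G})" by (simp add: cosets_carrier)
  let ?f = "\<lambda>v :: 'a set \<Rightarrow>\<^sub>0 int. lookup v (carrier G)"
  show ?thesis
    unfolding sm
  proof (rule mr.fp_iso[OF fp, where f = ?f])
    have "?f (gsm (l_coset G) a v) = aug a * ?f v" if a: "a \<in> free_on \<Gamma>" and v: "v \<in> free_on {carrier G}" for a v
    proof (rule additive_eq_on_free[OF _ _ a])
      show "additive (\<lambda>a. ?f (gsm (l_coset G) a v))" by (rule additive_compose[OF additive_lookup additive_gsm_left])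
      show "additive (\<lambda>a. aug a * ?f v)" using aug_add by (simp add: additive_def distrib_right)
      fix g and k :: int assume g: "g \<in> \<Gamma>"
      have "push (\<lambda>C. g <# C) v = push (\<lambda>C. C) v"
        by (rule push_cong[OF v]) (simp add: lcos_carrier \<Gamma>_in g)
      then show "?f (gsm (l_coset G) (single g k) v) = aug (single g k) * ?f v"
        by (simp add: gsm_single aug_single push_id)
    qed
    then show "mr.lin (gsm (l_coset G)) (free_on {carrier G}) (\<lambda>c n. aug c * n) UNIV ?f"
      by (simp add: mr.lin_def lookup_add)
    show "?f ` free_on {carrier G} = UNIV"
    proof (intro equalityI subsetI)
      fix n :: int
      show "n \<in> ?f ` free_on {carrier G}"
        by (rule image_eqI[where x = "single (carrier G) n"]) auto
    qed simp
    show "v = 0" if "v \<in> free_on {carrier G}" "?f v = 0" for v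
    proof (rule poly_mapping_eqI)
      fix C show "lookup v C = lookup 0 C"
        using that by (cases "C = carrier G") (auto simp: free_on_def in_keys_iff)
    qed
    show "mr.is_mod (\<lambda>c n. aug c * n) UNIV"
      by (auto simp: mr.is_mod_def additive.add[OF aug_add] aug_mult aug_single distrib_left distrib_right)
  qed
qed

end

section \<open>The two sides of the formula\<close>

lemma Hom_additiveD:
  assumes "f \<in> Hom G additive_group" "g \<in> carrier G" "h \<in> carrier G"
  shows "f (g \<otimes>\<^bsub>G\<^esub> h) = f g + f h"
  using assms by (auto simp: Hom_def hom_def additive_group_def)

text \<open>Every real character satisfies the finiteness condition, so only the zero character,
  excluded by definition, is missing.\<close>

lemma bieri_renz_cyc_chain:
  fixes G :: "('a, 'b) monoid_scheme"
  assumes G: "group G" and chain: "group.cyc_chain G (carrier G)"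
  shows "bieri_renz q G = Hom G additive_group - {\<lambda>g\<in>carrier G. 0}"
proof -
  interpret group G by fact
  have "type_FP q (monoid_ring (char_submonoid G \<chi>)) trivial_int_module"
    if \<chi>: "\<chi> \<in> Hom G additive_group" for \<chi> :: "'a \<Rightarrow> real"
  proof -
    define \<Gamma> where "\<Gamma> = {g \<in> carrier G. \<chi> g \<ge> 0}"
    note mult = Hom_additiveD[OF \<chi>]
    have one: "\<chi> \<one>\<^bsub>G\<^esub> = 0" using mult[of "\<one>\<^bsub>G\<^esub>" "\<one>\<^bsub>G\<^esub>"] by simp
    interpret half_space G \<Gamma>
    proof
      show "g \<in> \<Gamma> \<or> inv\<^bsub>G\<^esub> g \<in> \<Gamma>" if "g \<in> carrier G" for g
        using that mult[of g "inv\<^bsub>G\<^esub> g"] one by (auto simp: \<Gamma>_def)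
    qed (auto simp: \<Gamma>_def one mult)
    have "monoid_ring (char_submonoid G \<chi>) = mr.base_ring"
      unfolding monoid_ring_def mr.base_ring_def
      by (simp add: char_submonoid_def free_on_def \<Gamma>_def frag_extend_eq_push)
        (simp add: fun_eq_iff gsm_def frag_extend_def lin_ext_def frag_cmul_eq_scal)
    moreover have "type_FP q mr.base_ring trivial_int_module"
      by (rule mr.type_FP_if_fp[OF _ fp_trivial[OF chain]]) (simp_all add: trivial_int_module_def)
    ultimately show ?thesis by simp
  qed
  then show ?thesis by (auto simp: bieri_renz_def)
qed

section \<open>Group homology and the tangent cone\<close>

lemma group_homology_simps:
  "carrier (group_homology n G act) = (\<lambda>c. \<Union>b\<in>bar_boundary G act ` bar_chains G (Suc n). {b + c}) `
     {c \<in> bar_chains G n. bar_boundary G act c = 0}"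
  "\<one>\<^bsub>group_homology n G act\<^esub> = bar_boundary G act ` bar_chains G (Suc n)"
  by (auto simp: group_homology_def FactGroup_def RCOSETS_def r_coset_def additive_group_def)

lemma group_homology_trivial:
  assumes G: "group G" and act: "\<And>g. additive (act g)"
    and acyclic: "\<And>c. c \<in> bar_chains G n \<Longrightarrow> bar_boundary G act c = 0 \<Longrightarrow>
      c \<in> bar_boundary G act ` bar_chains G (Suc n)"
  shows "carrier (group_homology n G act) \<subseteq> {\<one>\<^bsub>group_homology n G act\<^esub>}"
proof -
  interpret group G by fact
  interpret A: bar_coeff G act "{0}"
    by unfold_locales (auto simp: additive.add[OF act] additive.zero[OF act])
  let ?B = "bar_boundary G act ` bar_chains G (Suc n)"
  have B_diff: "b - c \<in> ?B" if "b \<in> ?B" "c \<in> ?B" for b c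
  proof -
    obtain b' c' where "b' \<in> bar_chains G (Suc n)" "c' \<in> bar_chains G (Suc n)"
      "b = bar_boundary G act b'" "c = bar_boundary G act c'" using \<open>b \<in> ?B\<close> \<open>c \<in> ?B\<close> by auto
    then show ?thesis
      by (intro image_eqI[where x = "b' - c'"])
        (auto simp: additive.diff[OF A.additive_boundary] bar_chains_eq intro!: free_in_minus)
  qed
  have coset: "(\<Union>b\<in>?B. {b + c}) = ?B" if c: "c \<in> ?B" for c
  proof (intro equalityI subsetI)
    fix x assume "x \<in> (\<Union>b\<in>?B. {b + c})"
    then obtain b where b: "b \<in> ?B" "x = b + c" by auto
    have "0 - c \<in> ?B" using B_diff[OF B_diff[OF c c] c] by simp
    from B_diff[OF b(1) this] show "x \<in> ?B" using b(2) by simp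
  next
    fix x assume "x \<in> ?B"
    then have "x - c \<in> ?B" by (rule B_diff[OF _ c])
    then show "x \<in> (\<Union>b\<in>?B. {b + c})" by (rule UN_I) simp
  qed
  show ?thesis
    unfolding group_homology_simps
  proof (rule image_subsetI)
    fix c assume "c \<in> {c \<in> bar_chains G n. bar_boundary G act c = 0}"
    then have "c \<in> ?B" using acyclic by simp
    then show "(\<Union>b\<in>?B. {b + c}) \<in> {?B}" using coset by simp
  qed
qed

text \<open>For the trivial character the two faces of \<open>[x]\<close> cancel, so the sum of
  coefficients vanishes on boundaries, but it is 1 on the chain \<open>[]\<close>. Degree 0 occurs
  in the union for every \<open>q\<close>, which puts 0 into the tangent cone.\<close>

lemma one_in_char_variety_0:
  assumes G: "group G"
  shows "(\<lambda>g\<in>carrier G. 1) \<in> char_variety 0 G"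
proof -
  interpret group G by fact
  let ?\<rho> = "\<lambda>g\<in>carrier G. 1 :: complex"
  let ?act = "\<lambda>g m. ?\<rho> g * m"
  let ?B = "bar_boundary G ?act ` bar_chains G (Suc 0)"
  interpret A: bar_coeff G ?act "UNIV"
    by unfold_locales (auto simp: distrib_left)
  have sums: "lin_ext (\<lambda>_ k. k) b = 0" if "b \<in> ?B" for b
  proof -
    obtain c where c: "c \<in> free_in (tuples G (Suc 0)) UNIV" "b = bar_boundary G ?act c"
      using \<open>b \<in> ?B\<close> unfolding bar_chains_eq by blast
    have ad: "additive (lin_ext (\<lambda>_ k. k) :: ('a list \<Rightarrow>\<^sub>0 complex) \<Rightarrow> complex)"
      by (rule additive_lin_ext) (rule additive_id)
    have "lin_ext (\<lambda>_ k. k) (bar_boundary G ?act c) = 0"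
    proof (rule additive_eq_on_free_in[OF _ additive_zero c(1)])
      show "additive (\<lambda>c. lin_ext (\<lambda>_ k. k) (bar_boundary G ?act c))"
        by (rule additive_compose[OF ad A.additive_boundary])
      fix xs m assume "xs \<in> tuples G (Suc 0)"
      then obtain x where x: "xs = [x]" "x \<in> carrier G" by (auto simp: tuples_def length_Suc_conv)
      show "lin_ext (\<lambda>_ k. k) (bar_boundary G ?act (single xs m)) = 0"
      proof -
        have "bar_boundary_basis G ?act [x] m = 0"
          unfolding bar_boundary_basis_def using x(2) by (simp add: single_uminus)
        then show ?thesis unfolding x(1) A.boundary_single by (simp add: additive.zero[OF ad])
      qed
    qed
    then show ?thesis by (simp add: c(2))
  qed
  define u where "u = (single [] 1 :: 'a list \<Rightarrow>\<^sub>0 complex)"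
  have u: "u \<in> bar_chains G 0" "bar_boundary G ?act u = 0"
    unfolding u_def A.boundary_single by (simp_all add: bar_chains_def bar_boundary_basis_def)
  have "0 \<in> ?B"
    by (rule image_eqI[where x = 0], rule additive.zero[OF A.additive_boundary, symmetric])
      (simp add: bar_chains_def)
  moreover have "u \<notin> ?B"
    using sums[of u] by (auto simp: u_def lin_ext_single)
  ultimately have "(\<Union>b\<in>?B. {b + u}) \<noteq> \<one>\<^bsub>group_homology 0 G ?act\<^esub>"
    unfolding group_homology_simps by force
  moreover have "(\<Union>b\<in>?B. {b + u}) \<in> carrier (group_homology 0 G ?act)"
    unfolding group_homology_simps by (rule imageI) (rule CollectI, rule conjI[OF u])
  ultimately have "carrier (group_homology 0 G ?act) \<noteq> {\<one>\<^bsub>group_homology 0 G ?act\<^esub>}"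
    by (metis singletonD)
  moreover have "?\<rho> \<in> Hom G multiplicative_group"
    by (auto simp: Hom_def hom_def multiplicative_group_def)
  ultimately show ?thesis by (simp add: char_variety_def)
qed

text \<open>Here it matters that \<open>x\<close> is real: \<open>exp (x h)\<close> is a positive
  number different from 1, while a purely imaginary value could give 1.\<close>

lemma exp_not_in_char_variety:
  fixes G :: "('a, 'b) monoid_scheme" and x :: "'a \<Rightarrow> real"
  assumes G: "group G" and chain: "group.cyc_chain G (carrier G)"
    and x: "x \<in> Hom G additive_group" and hG: "h \<in> carrier G" and xh: "x h \<noteq> 0"
  shows "(\<lambda>g\<in>carrier G. exp (complex_of_real (x g))) \<notin> char_variety i G"
proof -
  interpret group G by fact
  let ?\<rho> = "\<lambda>g\<in>carrier G. exp (complex_of_real (x g))"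
  interpret rank_one G ?\<rho> h
    by unfold_locales (use hG in \<open>auto simp: Hom_additiveD[OF x] exp_add\<close>)
  have nt: "?\<rho> h \<noteq> 1" 
  proof -
    have "exp (complex_of_real (x h)) = complex_of_real (exp (x h))" by (rule exp_of_real)
    moreover have "complex_of_real (exp (x h)) \<noteq> 1" using xh by (metis exp_eq_one_iff of_real_eq_1_iff)
    ultimately show ?thesis using hG by simp
  qed
  have "carrier (group_homology i G (\<lambda>g m. ?\<rho> g * m)) \<subseteq> {\<one>\<^bsub>group_homology i G (\<lambda>g m. ?\<rho> g * m)\<^esub>}"
    by (rule group_homology_trivial[OF G additive_mult]) (rule bar_acyclic[OF chain nt])
  moreover have "carrier (group_homology i G (\<lambda>g m. ?\<rho> g * m)) \<noteq> {}"
  proof -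
    interpret A: bar_coeff G "\<lambda>g m. ?\<rho> g * m" "{0}"
      by unfold_locales (auto simp: distrib_left)
    have "0 \<in> {c \<in> bar_chains G i. bar_boundary G (\<lambda>g m. ?\<rho> g * m) c = 0}"
      using additive.zero[OF A.additive_boundary] by (simp add: bar_chains_def)
    then show ?thesis unfolding group_homology_simps by blast
  qed
  ultimately have "carrier (group_homology i G (\<lambda>g m. ?\<rho> g * m)) = {\<one>\<^bsub>group_homology i G (\<lambda>g m. ?\<rho> g * m)\<^esub>}"
    by blast
  then show ?thesis by (simp only: char_variety_def mem_Collect_eq) blast
qed

lemma real_exp_tangent_cone_char_varieties:
  fixes G :: "('a, 'b) monoid_scheme"
  assumes G: "group G" and chain: "group.cyc_chain G (carrier G)"
  shows "real_exp_tangent_cone G (\<Union>i\<le>q. char_variety i G) = {\<lambda>g\<in>carrier G. 0}"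
proof (intro equalityI subsetI)
  fix x assume "x \<in> real_exp_tangent_cone G (\<Union>i\<le>q. char_variety i G)"
  then have x: "x \<in> Hom G additive_group"
    and cone: "\<And>t. (\<lambda>g\<in>carrier G. exp (t * (\<lambda>g\<in>carrier G. complex_of_real (x g)) g)) \<in> (\<Union>i\<le>q. char_variety i G)"
    by (auto simp: real_exp_tangent_cone_def exp_tangent_cone_def)
  have "x g = 0" if "g \<in> carrier G" for g
  proof (rule ccontr)
    assume "x g \<noteq> 0"
    \<comment> \<open>The parameter \<open>t = 1\<close> already leads out of every characteristic
      variety.\<close>
    moreover have "(\<lambda>g\<in>carrier G. exp (1 * (\<lambda>g\<in>carrier G. complex_of_real (x g)) g))
        = (\<lambda>g\<in>carrier G. exp (complex_of_real (x g)))" by auto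
    ultimately show False using cone[of 1] exp_not_in_char_variety[OF G chain x that] by auto
  qed
  then show "x \<in> {\<lambda>g\<in>carrier G. 0}"
    using x by (auto simp: Hom_def extensional_def restrict_def)
next
  fix x :: "'a \<Rightarrow> real" assume "x \<in> {\<lambda>g\<in>carrier G. 0}"
  then have x: "x = (\<lambda>g\<in>carrier G. 0)" by simp
  interpret group G by fact
  have "(\<lambda>g\<in>carrier G. exp (t * (\<lambda>g\<in>carrier G. complex_of_real (x g)) g)) = (\<lambda>g\<in>carrier G. 1)" for t
    by (auto simp: x)
  moreover have "(\<lambda>g\<in>carrier G. 1) \<in> (\<Union>i\<le>q. char_variety i G)"
    using one_in_char_variety_0[OF G] by blast
  moreover have "x \<in> Hom G additive_group"
    "(\<lambda>g\<in>carrier G. complex_of_real (x g)) \<in> Hom G additive_group"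
    by (auto simp: Hom_def hom_def additive_group_def x)
  ultimately show "x \<in> real_exp_tangent_cone G (\<Union>i\<le>q. char_variety i G)"
    by (simp add: real_exp_tangent_cone_def exp_tangent_cone_def)
qed

theorem corollary12p4:
  fixes G :: "('a, 'b) monoid_scheme"
  assumes "group G" and "fin_gen_group G" and "nilpotent_group G"
  shows "\<forall>q::nat. bieri_renz q G =
           Hom G additive_group - real_exp_tangent_cone G (\<Union>i\<le>q. char_variety i G)"
proof
  fix q
  have chain: "group.cyc_chain G (carrier G)" by (rule group.cyc_chain_carrier[OF assms])
  show "bieri_renz q G = Hom G additive_group - real_exp_tangent_cone G (\<Union>i\<le>q. char_variety i G)"
    unfolding bieri_renz_cyc_chain[OF assms(1) chain]
      real_exp_tangent_cone_char_varieties[OF assms(1) chain] ..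
qed

end
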